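(* Let $\pi:(M^4,g)\to(N,h)$ be a Riemannian submersion, where $(M^4,g)$ is a compact four-dimensional Einstein manifold. If all fibers of $\pi$ are totally geodesic and have dimension $2$, then locally $\pi$ is the projection of a metric product $B^2(c)\times B^2(c)$ onto one of the factors, where $B^2(c)$ is a two-dimensional compact Riemannian manifold with constant curvature $c$.
   Context: A smooth map $\pi:(M,g)\to(N,h)$ of Riemannian manifolds is a Riemannian submersion if $\pi_*$ is surjective and $g_p(v,w)=h_{\pi(p)}(\pi_*v,\pi_*w)$ for all $v,w\in T_pM$ perpendicular to $\ker\pi_*$. $(M,g)$ is Einstein if $\mathrm{Ric}(g)=\lambda g$ for some constant $\lambda$. "Locally $\pi$ is the projection of a metric product $B\times B$ onto one of the factors" means that every point of $M$ has an open neighborhood isometric to a product $U_1\times U_2$ of open subsets of $B$ (with the product metric), in such a way that $\pi$ restricted to this neighborhood corresponds to the projection onto one factor, that factor being identified isometrically with an open subset of $N$. *)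

theory Defs
  imports "HOL-Analysis.Analysis"
begin

section \<open>Smooth maps between open subsets of Euclidean spaces\<close>

text \<open>\<open>Ck_on k f S\<close> and \<open>smooth_on S f\<close> have their usual meaning for open \<open>S\<close>; they are only
  applied to open sets below.\<close>

primrec Ck_on ::
  "nat \<Rightarrow> ('a::euclidean_space \<Rightarrow> 'b::euclidean_space) \<Rightarrow> 'a set \<Rightarrow> bool" where
  "Ck_on 0 f S \<longleftrightarrow> continuous_on S f"
| "Ck_on (Suc k) f S \<longleftrightarrow>
     (\<forall>x\<in>S. f differentiable (at x)) \<and>
     (\<forall>v. Ck_on k (\<lambda>x. frechet_derivative f (at x) v) S)"

definition smooth_on :: "'a::euclidean_space set \<Rightarrow> ('a \<Rightarrow> 'b::euclidean_space) \<Rightarrow> bool" where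
  "smooth_on S f \<longleftrightarrow> (\<forall>k. Ck_on k f S)"


section \<open>Riemannian manifolds\<close>

text \<open>
  A manifold modelled on the Euclidean space \<open>'e\<close> is given by a topology (whose carrier is the set of
  points) and an atlas of charts \<open>(A, \<phi>)\<close>, \<open>\<phi>\<close> being relevant on the open set \<open>A\<close> only; its
  dimension is \<open>DIM('e)\<close>.

  Tensors are given in the classical way, by their coordinate expressions. A tangent vector at \<open>p\<close> is
  represented in each chart around \<open>p\<close> by its coordinate vector, and coordinate vectors with respect
  to two charts are related by the derivative of the coordinate change. Accordingly,
  \<open>riem_metric M \<phi> p v w\<close> is the inner product of the tangent vectors at \<open>p\<close> whose coordinates in the
  chart with coordinate map \<open>\<phi>\<close> are \<open>v\<close> and \<open>w\<close>.
\<close>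

record ('a, 'e) riem =
  mtop :: "'a topology"
  charts :: "('a set \<times> ('a \<Rightarrow> 'e)) set"
  riem_metric :: "('a \<Rightarrow> 'e) \<Rightarrow> 'a \<Rightarrow> 'e \<Rightarrow> 'e \<Rightarrow> real"

abbreviation points :: "('a, 'e) riem \<Rightarrow> 'a set" where
  "points M \<equiv> topspace (mtop M)"

definition chart_on :: "'a topology \<Rightarrow> 'a set \<Rightarrow> ('a \<Rightarrow> 'e::euclidean_space) \<Rightarrow> bool" where
  "chart_on X A \<phi> \<longleftrightarrow>
     openin X A \<and> open (\<phi> ` A) \<and> homeomorphic_map (subtopology X A) (top_of_set (\<phi> ` A)) \<phi>"

definition smooth_transition ::
  "'a set \<times> ('a \<Rightarrow> 'e::euclidean_space) \<Rightarrow> 'a set \<times> ('a \<Rightarrow> 'e) \<Rightarrow> bool" where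
  "smooth_transition = (\<lambda>(A, \<phi>) (B, \<psi>). smooth_on (\<phi> ` (A \<inter> B)) (\<psi> \<circ> inv_into A \<phi>))"

definition smooth_manifold :: "('a, 'e::euclidean_space) riem \<Rightarrow> bool" where
  "smooth_manifold M \<longleftrightarrow>
     Hausdorff_space (mtop M) \<and> second_countable (mtop M) \<and>
     (\<forall>(A, \<phi>)\<in>charts M. chart_on (mtop M) A \<phi>) \<and>
     (\<Union>(A, \<phi>)\<in>charts M. A) = points M \<and>
     (\<forall>a\<in>charts M. \<forall>b\<in>charts M. smooth_transition a b)"

definition maximal_atlas :: "('a, 'e::euclidean_space) riem \<Rightarrow> ('a set \<times> ('a \<Rightarrow> 'e)) set" where
  "maximal_atlas M = {(A, \<phi>). chart_on (mtop M) A \<phi> \<and>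
     (\<forall>b\<in>charts M. smooth_transition (A, \<phi>) b \<and> smooth_transition b (A, \<phi>))}"

text \<open>The derivative at \<open>p\<close> of a map \<open>f\<close>, with respect to the chart \<open>(A, \<phi>)\<close> of the source and the
  coordinate map \<open>\<psi>\<close> of the target.\<close>

definition coord_diff ::
  "'a set \<Rightarrow> ('a \<Rightarrow> 'e::euclidean_space) \<Rightarrow> ('b \<Rightarrow> 'f::euclidean_space) \<Rightarrow> ('a \<Rightarrow> 'b) \<Rightarrow> 'a \<Rightarrow> 'e \<Rightarrow> 'f"
  where "coord_diff A \<phi> \<psi> f p = frechet_derivative (\<psi> \<circ> f \<circ> inv_into A \<phi>) (at (\<phi> p))"

definition riemannian_manifold :: "('a, 'e::euclidean_space) riem \<Rightarrow> bool" where
  "riemannian_manifold M \<longleftrightarrow>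
     smooth_manifold M \<and>
     (\<forall>(A, \<phi>)\<in>charts M.
        (\<forall>p\<in>A. bilinear (riem_metric M \<phi> p) \<and>
               (\<forall>v w. riem_metric M \<phi> p v w = riem_metric M \<phi> p w v) \<and>
               (\<forall>v. v \<noteq> 0 \<longrightarrow> riem_metric M \<phi> p v v > 0)) \<and>
        (\<forall>v w. smooth_on (\<phi> ` A) (\<lambda>x. riem_metric M \<phi> (inv_into A \<phi> x) v w))) \<and>
     (\<forall>(A, \<phi>)\<in>charts M. \<forall>(B, \<psi>)\<in>charts M. \<forall>p\<in>A \<inter> B. \<forall>v w.
        riem_metric M \<phi> p v w =
        riem_metric M \<psi> p (coord_diff A \<phi> \<psi> id p v) (coord_diff A \<phi> \<psi> id p w))"


section \<open>Levi-Civita connection and curvature in coordinates\<close>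

text \<open>In this section \<open>G x v w\<close> is a metric on an open subset of the Euclidean space \<open>'e\<close>.\<close>

definition local_metric ::
  "('a, 'e) riem \<Rightarrow> 'a set \<Rightarrow> ('a \<Rightarrow> 'e) \<Rightarrow> 'e \<Rightarrow> 'e \<Rightarrow> 'e \<Rightarrow> real" where
  "local_metric M A \<phi> x = riem_metric M \<phi> (inv_into A \<phi> x)"

text \<open>\<open>christoffel G x v w\<close> is \<open>\<nabla>\<^sub>v w\<close> at \<open>x\<close> for the constant vector fields \<open>v\<close>, \<open>w\<close>, as determined by
  the Koszul formula.\<close>

definition christoffel ::
  "('e::euclidean_space \<Rightarrow> 'e \<Rightarrow> 'e \<Rightarrow> real) \<Rightarrow> 'e \<Rightarrow> 'e \<Rightarrow> 'e \<Rightarrow> 'e" where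
  "christoffel G x v w = (THE z. \<forall>u. G x z u =
     (frechet_derivative (\<lambda>y. G y w u) (at x) v
      + frechet_derivative (\<lambda>y. G y v u) (at x) w
      - frechet_derivative (\<lambda>y. G y v w) (at x) u) / 2)"

text \<open>\<open>cov_deriv G V x u\<close> is the covariant derivative \<open>\<nabla>\<^sub>u V\<close> at \<open>x\<close> of the vector field \<open>V\<close>.\<close>

definition cov_deriv ::
  "('e::euclidean_space \<Rightarrow> 'e \<Rightarrow> 'e \<Rightarrow> real) \<Rightarrow> ('e \<Rightarrow> 'e) \<Rightarrow> 'e \<Rightarrow> 'e \<Rightarrow> 'e" where
  "cov_deriv G V x u = frechet_derivative V (at x) u + christoffel G x u (V x)"

text \<open>\<open>R(u,v)w = \<nabla>\<^sub>u \<nabla>\<^sub>v w - \<nabla>\<^sub>v \<nabla>\<^sub>u w\<close>, evaluated on constant (hence commuting) vector fields.\<close>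

definition curvature ::
  "('e::euclidean_space \<Rightarrow> 'e \<Rightarrow> 'e \<Rightarrow> real) \<Rightarrow> 'e \<Rightarrow> 'e \<Rightarrow> 'e \<Rightarrow> 'e \<Rightarrow> 'e" where
  "curvature G x u v w =
     cov_deriv G (\<lambda>y. cov_deriv G (\<lambda>_. w) y v) x u -
     cov_deriv G (\<lambda>y. cov_deriv G (\<lambda>_. w) y u) x v"

text \<open>\<open>ricci G x v w\<close> is the trace of the endomorphism \<open>u \<mapsto> R(u,v)w\<close>.\<close>

definition ricci ::
  "('e::euclidean_space \<Rightarrow> 'e \<Rightarrow> 'e \<Rightarrow> real) \<Rightarrow> 'e \<Rightarrow> 'e \<Rightarrow> 'e \<Rightarrow> real" where
  "ricci G x v w = (\<Sum>b\<in>Basis. curvature G x b v w \<bullet> b)"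

text \<open>The sectional curvature of the plane spanned by linearly independent \<open>v\<close>, \<open>w\<close>.\<close>

definition sectional_curvature ::
  "('e::euclidean_space \<Rightarrow> 'e \<Rightarrow> 'e \<Rightarrow> real) \<Rightarrow> 'e \<Rightarrow> 'e \<Rightarrow> 'e \<Rightarrow> real" where
  "sectional_curvature G x v w =
     G x (curvature G x v w w) v / (G x v v * G x w w - (G x v w)\<^sup>2)"

definition einstein :: "('a, 'e::euclidean_space) riem \<Rightarrow> bool" where
  "einstein M \<longleftrightarrow> (\<exists>l::real. \<forall>(A, \<phi>)\<in>charts M. \<forall>p\<in>A. \<forall>v w.
     ricci (local_metric M A \<phi>) (\<phi> p) v w = l * riem_metric M \<phi> p v w)"

definition constant_curvature :: "('a, 'e::euclidean_space) riem \<Rightarrow> real \<Rightarrow> bool" where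
  "constant_curvature M c \<longleftrightarrow> (\<forall>(A, \<phi>)\<in>charts M. \<forall>p\<in>A. \<forall>v w.
     v \<noteq> w \<and> independent {v, w} \<longrightarrow> sectional_curvature (local_metric M A \<phi>) (\<phi> p) v w = c)"


section \<open>Smooth maps, isometries, products\<close>

text \<open>\<open>smooth_map_on M U N f\<close>: the map \<open>f\<close> is smooth from the open subset \<open>U\<close> of \<open>M\<close> to \<open>N\<close>.\<close>

definition smooth_map_on ::
  "('a, 'e::euclidean_space) riem \<Rightarrow> 'a set \<Rightarrow> ('b, 'f::euclidean_space) riem \<Rightarrow> ('a \<Rightarrow> 'b) \<Rightarrow> bool"
  where
  "smooth_map_on M U N f \<longleftrightarrow>
     openin (mtop M) U \<and> continuous_map (subtopology (mtop M) U) (mtop N) f \<and>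
     (\<forall>(A, \<phi>)\<in>charts M. \<forall>(B, \<psi>)\<in>charts N.
        smooth_on (\<phi> ` (U \<inter> A \<inter> f -` B)) (\<psi> \<circ> f \<circ> inv_into A \<phi>))"

text \<open>\<open>isometry_on M U N V f\<close>: \<open>f\<close> restricts to an isometry from the open subset \<open>U\<close> of \<open>M\<close> onto the
  open subset \<open>V\<close> of \<open>N\<close>.\<close>

definition isometry_on ::
  "('a, 'e::euclidean_space) riem \<Rightarrow> 'a set \<Rightarrow> ('b, 'f::euclidean_space) riem \<Rightarrow> 'b set
     \<Rightarrow> ('a \<Rightarrow> 'b) \<Rightarrow> bool"
  where
  "isometry_on M U N V f \<longleftrightarrow>
     bij_betw f U V \<and> smooth_map_on M U N f \<and> smooth_map_on N V M (inv_into U f) \<and>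
     (\<forall>(A, \<phi>)\<in>charts M. \<forall>(B, \<psi>)\<in>charts N. \<forall>p\<in>U \<inter> A \<inter> f -` B. \<forall>v w.
        riem_metric M \<phi> p v w =
        riem_metric N \<psi> (f p) (coord_diff A \<phi> \<psi> f p v) (coord_diff A \<phi> \<psi> f p w))"

text \<open>The charts of a product are the maps \<open>\<xi> = map_prod \<phi> \<psi>\<close>. The two factors of \<open>\<xi>\<close> are recovered as
  \<open>\<phi> = (\<lambda>a. fst (\<xi> (a, b)))\<close> and \<open>\<psi> = (\<lambda>b. snd (\<xi> (a, b)))\<close>; see the lemma below.\<close>

definition riem_product ::
  "('a, 'e) riem \<Rightarrow> ('b, 'f) riem \<Rightarrow> ('a \<times> 'b, 'e \<times> 'f) riem" where
  "riem_product M N = \<lparr>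
     mtop = prod_topology (mtop M) (mtop N),
     charts = {(A \<times> B, map_prod \<phi> \<psi>) | A \<phi> B \<psi>. (A, \<phi>) \<in> charts M \<and> (B, \<psi>) \<in> charts N},
     riem_metric = (\<lambda>\<xi>. \<lambda>(a, b) (v, v') (w, w').
       riem_metric M (\<lambda>y. fst (\<xi> (y, b))) a v w + riem_metric N (\<lambda>z. snd (\<xi> (a, z))) b v' w')\<rparr>"

lemma riem_product_metric:
  "riem_metric (riem_product M N) (map_prod \<phi> \<psi>) (a, b) (v, v') (w, w') =
   riem_metric M \<phi> a v w + riem_metric N \<psi> b v' w'"
  by (simp add: riem_product_def)


section \<open>Submanifolds and Riemannian submersions\<close>

text \<open>Embedded \<open>k\<close>-dimensional submanifolds, by slice charts.\<close>

definition embedded_submanifold ::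
  "('a, 'e::euclidean_space) riem \<Rightarrow> nat \<Rightarrow> 'a set \<Rightarrow> bool" where
  "embedded_submanifold M k F \<longleftrightarrow> F \<subseteq> points M \<and>
     (\<forall>p\<in>F. \<exists>(A, \<phi>)\<in>maximal_atlas M. \<exists>S. p \<in> A \<and> subspace S \<and> dim S = k \<and>
        \<phi> ` (A \<inter> F) = \<phi> ` A \<inter> S)"

text \<open>The tangent space of \<open>F\<close> at \<open>p\<close>, in coordinates: velocities at \<open>p\<close> of smooth curves in \<open>F\<close>.\<close>

definition tangent_space :: "'a set \<Rightarrow> ('a \<Rightarrow> 'e::euclidean_space) \<Rightarrow> 'a set \<Rightarrow> 'a \<Rightarrow> 'e set" where
  "tangent_space A \<phi> F p = {v. \<exists>\<gamma>::real \<Rightarrow> 'a. \<exists>\<epsilon>>0.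
     \<gamma> ` {-\<epsilon><..<\<epsilon>} \<subseteq> F \<inter> A \<and> \<gamma> 0 = p \<and> smooth_on {-\<epsilon><..<\<epsilon>} (\<phi> \<circ> \<gamma>) \<and>
     ((\<phi> \<circ> \<gamma>) has_vector_derivative v) (at 0)}"

text \<open>A submanifold \<open>F\<close> is totally geodesic if its second fundamental form vanishes: for every
  \<open>u \<in> T\<^sub>pF\<close> and every smooth vector field \<open>V\<close> near \<open>p\<close> which is tangent to \<open>F\<close> along \<open>F\<close>, the component
  of \<open>\<nabla>\<^sub>u V\<close> normal to \<open>F\<close> is zero.\<close>

definition totally_geodesic :: "('a, 'e::euclidean_space) riem \<Rightarrow> 'a set \<Rightarrow> bool" where
  "totally_geodesic M F \<longleftrightarrow>
     (\<forall>(A, \<phi>)\<in>charts M. \<forall>p\<in>A \<inter> F. \<forall>W V.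
        open W \<and> \<phi> p \<in> W \<and> W \<subseteq> \<phi> ` A \<and> smooth_on W V \<and>
        (\<forall>q\<in>A \<inter> F. \<phi> q \<in> W \<longrightarrow> V (\<phi> q) \<in> tangent_space A \<phi> F q) \<longrightarrow>
        (\<forall>u\<in>tangent_space A \<phi> F p.
           cov_deriv (local_metric M A \<phi>) V (\<phi> p) u \<in> tangent_space A \<phi> F p))"

definition fiber :: "('a, 'e) riem \<Rightarrow> ('a \<Rightarrow> 'b) \<Rightarrow> 'b \<Rightarrow> 'a set" where
  "fiber M \<pi> q = {p \<in> points M. \<pi> p = q}"

definition riemannian_submersion ::
  "('a, 'e::euclidean_space) riem \<Rightarrow> ('b, 'f::euclidean_space) riem \<Rightarrow> ('a \<Rightarrow> 'b) \<Rightarrow> bool" where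
  "riemannian_submersion M N \<pi> \<longleftrightarrow>
     smooth_map_on M (points M) N \<pi> \<and>
     (\<forall>(A, \<phi>)\<in>charts M. \<forall>(B, \<psi>)\<in>charts N. \<forall>p\<in>A \<inter> \<pi> -` B.
        let D = coord_diff A \<phi> \<psi> \<pi> p;
            horizontal = {v. \<forall>u. D u = 0 \<longrightarrow> riem_metric M \<phi> p v u = 0}
        in surj D \<and>
           (\<forall>v\<in>horizontal. \<forall>w\<in>horizontal.
              riem_metric M \<phi> p v w = riem_metric N \<psi> (\<pi> p) (D v) (D w)))"

text \<open>Locally, \<open>\<pi>\<close> is the projection of the metric product \<open>B \<times> B\<close> onto its first factor (the order of
  the two equal factors being immaterial), where \<open>\<psi>\<close> identifies an open subset of that factor
  isometrically with an open subset of \<open>N\<close>.\<close>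

definition locally_projection_of_square ::
  "('a, 'e::euclidean_space) riem \<Rightarrow> ('b, 'f::euclidean_space) riem \<Rightarrow> ('a \<Rightarrow> 'b)
     \<Rightarrow> ('c, 'g::euclidean_space) riem \<Rightarrow> bool"
  where
  "locally_projection_of_square M N \<pi> B \<longleftrightarrow>
     (\<forall>p\<in>points M. \<exists>U U\<^sub>1 U\<^sub>2 \<Phi> W \<psi>.
        p \<in> U \<and> openin (mtop M) U \<and> openin (mtop B) U\<^sub>1 \<and> openin (mtop B) U\<^sub>2 \<and> openin (mtop N) W \<and>
        isometry_on M U (riem_product B B) (U\<^sub>1 \<times> U\<^sub>2) \<Phi> \<and>
        isometry_on B U\<^sub>1 N W \<psi> \<and>
        (\<forall>x\<in>U. \<pi> x = \<psi> (fst (\<Phi> x))))"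

end

theory Submission
  imports Defs
begin

text \<open>
  The statement is local. Let \<open>e\<^sub>0, e\<^sub>1\<close> be horizontal and \<open>e\<^sub>2, e\<^sub>3\<close> vertical fields forming an
  orthonormal frame, and let \<open>w\<close> be the vertical part of the covariant derivative of \<open>e\<^sub>1\<close> in the direction
  \<open>e\<^sub>0\<close> (O'Neill's tensor). As the fibers
  are totally geodesic, the Ricci curvature on vertical vectors is
  \<open>Ric(e\<^sub>a, e\<^sub>b) = K \<delta>\<^sub>a\<^sub>b + 2 w\<^sub>a w\<^sub>b\<close> with \<open>K\<close> the curvature of the vertical plane. If the metric is
  Einstein, \<open>w \<otimes> w\<close> is a multiple of the identity on a plane, hence \<open>w = 0\<close>. So the horizontal and
  vertical distributions are parallel, and both the base and the fibers have curvature \<open>c\<close> equal to the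
  Einstein constant.

  Let \<open>\<theta>\<close>, \<open>\<eta>\<close> be the coframe dual to \<open>e\<^sub>2, e\<^sub>3\<close> and \<open>\<omega>\<close> its connection form. The linear system
  \<open>df = a \<theta> + b \<eta>\<close>, \<open>da = - c f \<theta> + b \<omega>\<close>, \<open>db = - c f \<eta> - a \<omega>\<close> is the parallel transport equation of a
  flat connection, and two of its solutions \<open>F = (f\<^sub>1, f\<^sub>2)\<close> express the fiber metric as a function of \<open>F\<close>
  and \<open>dF\<close> that depends on \<open>c\<close> only. The same construction on the base gives \<open>F'\<close>, and
  \<open>(\<pi>, F'\<^sup>-\<^sup>1 \<circ> F)\<close> is the local isometry onto the product. This replaces both the Frobenius theorem and
  the local classification of surfaces of constant curvature.
\<close>

section \<open>Functions of class \<open>C\<^sup>k\<close>\<close>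

text \<open>The vertical forms live on a four-dimensional domain, where \<theta>, \<eta> are not a
  coframe. \<open>developing_map\<close> therefore asks only for the structure equations of a
  surface, for three 1-forms on a space of any dimension; they alone make the linear system flat.
  The differential of F factors through the vertical forms, and \<pi> and F together form a local
  diffeomorphism because the squares of their differentials add up to the metric. F and F' can be
  compared because one constant serves both: once the planes are parallel, the Ricci curvature of a
  unit vector in either plane is the curvature of that plane. The linear system is solved by
  integrating along rays, and flatness is what controls the directions transverse to them. Globally,
  the factor B is the open subset \<pi>(M) of N: a submersion is an open map, and the continuous
  image of a compact space is compact. Its charts are composed with a linear isomorphism onto
  real^2, which exists because the kernel of the differential of \<pi> is the two-dimensional
  tangent space of a fiber.\<close>

abbreviation D :: "('a::real_normed_vector \<Rightarrow> 'b::real_normed_vector) \<Rightarrow> 'a \<Rightarrow> 'a \<Rightarrow> 'b" where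
  "D f x \<equiv> frechet_derivative f (at x)"

lemma D_eq: "(f has_derivative f') (at x) \<Longrightarrow> D f x = f'"
  by (metis frechet_derivative_at)

lemma D_cong:
  assumes "open S" "x \<in> S" "\<And>y. y \<in> S \<Longrightarrow> f y = g y"
  shows "D f x = D g x"
proof -
  have "(f has_derivative f') (at x) = (g has_derivative f') (at x)" for f'
    using assms has_derivative_transform_within_open[of f f' x UNIV S g]
      has_derivative_transform_within_open[of g f' x UNIV S f] by auto
  then show ?thesis by (simp add: frechet_derivative_def)
qed

lemma differentiable_cong_open:
  assumes "open S" "x \<in> S" "\<And>y. y \<in> S \<Longrightarrow> f y = g y" "f differentiable (at x)"
  shows "g differentiable (at x)"
  using assms has_derivative_transform_within_open[of f _ x UNIV S g] by (auto simp: differentiable_def)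

lemma Ck_on_cong:
  assumes "open S" "\<And>y. y \<in> S \<Longrightarrow> f y = g y" "Ck_on k f S"
  shows "Ck_on k g S"
  using assms(2-)
proof (induction k arbitrary: f g)
  case 0
  then show ?case using continuous_on_cong by (metis Ck_on.simps(1))
next
  case (Suc k)
  have "Ck_on k (\<lambda>x. D g x v) S" for v
  proof (rule Suc.IH)
    show "Ck_on k (\<lambda>x. D f x v) S" using Suc.prems by auto
    show "D f y v = D g y v" if "y \<in> S" for y
      using D_cong[OF assms(1) that, of f g] Suc.prems by auto
  qed
  then show ?case
    using Suc.prems differentiable_cong_open[OF assms(1), of _ f g] by auto
qed

text \<open>\<open>Ck_on\<close> is phrased with the total operator
  \<open>frechet_derivative\<close>. This rule lets the inductions on the order work with an
  explicit derivative that is only known on the open set.\<close>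

lemma Ck_on_SucI:
  assumes "open S" "\<And>x. x \<in> S \<Longrightarrow> (f has_derivative f' x) (at x)" "\<And>v. Ck_on k (\<lambda>x. f' x v) S"
  shows "Ck_on (Suc k) f S"
proof -
  have "Ck_on k (\<lambda>x. D f x v) S" for v
    by (rule Ck_on_cong[OF assms(1) _ assms(3)[of v]]) (simp add: D_eq[OF assms(2)])
  then show ?thesis using assms(2) by (auto simp: differentiable_def)
qed

lemma Ck_on_Suc_imp: "Ck_on (Suc k) f S \<Longrightarrow> Ck_on k f S"
proof (induction k arbitrary: f)
  case 0
  then show ?case
    by (auto intro!: continuous_at_imp_continuous_on differentiable_imp_continuous_within)
next
  case (Suc k)
  then have "\<And>v. Ck_on (Suc k) (\<lambda>x. D f x v) S" by (metis Ck_on.simps(2))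
  then have "\<And>v. Ck_on k (\<lambda>x. D f x v) S" using Suc.IH by blast
  then show ?case using Suc.prems by (auto)
qed

lemma Ck_on_continuous: "Ck_on k f S \<Longrightarrow> continuous_on S f"
  by (induction k) (auto dest: Ck_on_Suc_imp simp del: Ck_on.simps(2))

lemma Ck_on_has_derivative:
  assumes "Ck_on (Suc k) f S" "x \<in> S"
  shows "(f has_derivative D f x) (at x)"
  using assms frechet_derivative_works by auto

lemma Ck_on_subset: "Ck_on k f S \<Longrightarrow> T \<subseteq> S \<Longrightarrow> Ck_on k f T"
proof (induction k arbitrary: f)
  case 0
  then show ?case by (auto intro: continuous_on_subset)
qed auto

lemma Ck_on_local:
  assumes "open S" "\<And>x. x \<in> S \<Longrightarrow> \<exists>T. open T \<and> x \<in> T \<and> Ck_on k f T"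
  shows "Ck_on k f S"
  using assms(2)
proof (induction k arbitrary: f)
  case 0
  then have "isCont f x" if "x \<in> S" for x
    using that continuous_on_eq_continuous_at by (metis Ck_on.simps(1))
  then show ?case by (simp add: continuous_at_imp_continuous_on)
next
  case (Suc k)
  then show ?case
    by (metis Ck_on.simps(2))
qed

lemma Ck_on_const: "Ck_on k (\<lambda>x. c) S"
  by (induction k arbitrary: c) auto

lemma Ck_on_add:
  assumes "open S" "Ck_on k f S" "Ck_on k g S"
  shows "Ck_on k (\<lambda>x. f x + g x) S"
  using assms(2-)
proof (induction k arbitrary: f g)
  case 0
  then show ?case by (auto intro: continuous_intros)
next
  case (Suc k)
  show ?case
    by (rule Ck_on_SucI[OF assms(1), where f'="\<lambda>x v. D f x v + D g x v"])
      (use Suc in \<open>auto intro!: has_derivative_add intro: Ck_on_has_derivative\<close>)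
qed

lemma Ck_on_bounded_linear:
  assumes "open S" "Ck_on k f S" "bounded_linear L"
  shows "Ck_on k (\<lambda>x. L (f x)) S"
  using assms(2)
proof (induction k arbitrary: f)
  case 0
  then show ?case using bounded_linear.continuous_on[OF assms(3)] by auto
next
  case (Suc k)
  show ?case
    by (rule Ck_on_SucI[OF assms(1), where f'="\<lambda>x v. L (D f x v)"])
      (use Suc in \<open>auto intro!: bounded_linear.has_derivative[OF assms(3)] intro: Ck_on_has_derivative\<close>)
qed

lemma Ck_on_bounded_bilinear:
  fixes f :: "'e::euclidean_space \<Rightarrow> 'a::euclidean_space" and g :: "'e \<Rightarrow> 'b::euclidean_space"
    and prod :: "'a \<Rightarrow> 'b \<Rightarrow> 'c::euclidean_space"
  assumes "open S" "bounded_bilinear prod" "Ck_on k f S" "Ck_on k g S"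
  shows "Ck_on k (\<lambda>x. prod (f x) (g x)) S"
  using assms(3-)
proof (induction k arbitrary: f g)
  case 0
  then show ?case using bounded_bilinear.continuous_on[OF assms(2)] by auto
next
  case (Suc k)
  have "Ck_on k f S" "Ck_on k g S" using Suc.prems Ck_on_Suc_imp by blast+
  then have "Ck_on k (\<lambda>x. prod (f x) (D g x v) + prod (D f x v) (g x)) S" for v
    using Suc by (intro Ck_on_add[OF assms(1)] Suc.IH) auto
  then show ?case
    by (intro Ck_on_SucI[OF assms(1), where f'="\<lambda>x v. prod (f x) (D g x v) + prod (D f x v) (g x)"])
      (use Suc.prems in \<open>auto intro!: bounded_bilinear.FDERIV[OF assms(2)] intro: Ck_on_has_derivative\<close>)
qed

lemma Ck_on_sum:
  assumes "open S" "\<And>i. i \<in> I \<Longrightarrow> Ck_on k (f i) S"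
  shows "Ck_on k (\<lambda>x. \<Sum>i\<in>I. f i x) S"
  using assms(2)
  by (induction I rule: infinite_finite_induct)
     (simp_all add: Ck_on_const Ck_on_add[OF assms(1)])

lemma linear_expand:
  fixes L :: "'a::euclidean_space \<Rightarrow> 'b::real_vector"
  assumes "linear L" shows "L v = (\<Sum>b\<in>Basis. (v \<bullet> b) *\<^sub>R L b)"
  using linear_sum[OF assms, of "\<lambda>b. (v \<bullet> b) *\<^sub>R b" Basis] linear_scale[OF assms]
  by (simp add: euclidean_representation)

text \<open>The chain rule gives \<open>D g (f x) (D f x v)\<close>, where both the map and its
  argument vary with \<open>x\<close>. Expanding the argument in the basis leaves products of C^k
  functions in which \<open>g\<close> is replaced by its partial derivatives; hence the induction
  runs over all \<open>f\<close> and \<open>g\<close>.\<close>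

lemma Ck_on_compose:
  fixes f :: "'a::euclidean_space \<Rightarrow> 'b::euclidean_space" and g :: "'b \<Rightarrow> 'c::euclidean_space"
  assumes "open S" "open T" "Ck_on k f S" "Ck_on k g T" "f ` S \<subseteq> T"
  shows "Ck_on k (\<lambda>x. g (f x)) S"
  using assms(3-)
proof (induction k arbitrary: f g)
  case 0
  then show ?case by (auto intro: continuous_on_compose2)
next
  case (Suc k)
  have fk: "Ck_on k f S" "continuous_on S f" using Suc.prems Ck_on_Suc_imp Ck_on_continuous by blast+
  have "Ck_on k (\<lambda>x. D g (f x) b) S" for b
    using Suc.IH[of f "\<lambda>y. D g y b"] Suc.prems fk by auto
  then have *: "Ck_on k (\<lambda>x. \<Sum>b\<in>Basis. (D f x v \<bullet> b) *\<^sub>R D g (f x) b) S" for v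
    using Suc.prems by (intro Ck_on_sum[OF assms(1)]
       Ck_on_bounded_bilinear[OF assms(1) bounded_bilinear_scaleR]
       Ck_on_bounded_linear[OF assms(1) _ bounded_linear_inner_left]) auto
  have d: "((\<lambda>x. g (f x)) has_derivative (\<lambda>v. D g (f x) (D f x v))) (at x)" if "x \<in> S" for x
    using Ck_on_has_derivative[OF Suc.prems(1) that] Ck_on_has_derivative[OF Suc.prems(2), of "f x"]
      that Suc.prems(3) has_derivative_compose by blast
  have "linear (D g (f x))" if "x \<in> S" for x
    using that Suc.prems by (intro linear_frechet_derivative) auto
  then have "D g (f x) (D f x v) = (\<Sum>b\<in>Basis. (D f x v \<bullet> b) *\<^sub>R D g (f x) b)" if "x \<in> S" for x v
    using linear_expand that by blast
  with d have "((\<lambda>x. g (f x)) has_derivative (\<lambda>v. \<Sum>b\<in>Basis. (D f x v \<bullet> b) *\<^sub>R D g (f x) b)) (at x)"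
    if "x \<in> S" for x using that by simp
  then show ?case using * by (rule Ck_on_SucI[OF assms(1)])
qed

text \<open>The derivative is a polynomial in \<open>inverse\<close> itself, so each order yields
  the next.\<close>

lemma Ck_on_inverse: "Ck_on k (inverse :: real \<Rightarrow> real) (- {0})"
proof (induction k)
  case 0
  then show ?case by (auto intro!: continuous_intros)
next
  case (Suc k)
  have o: "open (- {0::real})" by auto
  have "Ck_on k (\<lambda>x::real. - ((inverse x * v) * inverse x)) (- {0})" for v
    by (intro Ck_on_bounded_linear[OF o _ bounded_linear_minus[OF bounded_linear_ident]]
      Ck_on_bounded_bilinear[OF o bounded_bilinear_mult] Suc Ck_on_const)
  then show ?case
    by (intro Ck_on_SucI[OF o, where f'="\<lambda>x v. - (inverse x * v * inverse x)"])
       (auto intro!: has_derivative_inverse')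
qed

lemma Ck_on_sqrt: "Ck_on k sqrt {0<..}"
proof (induction k)
  case 0
  then show ?case by (auto intro!: continuous_intros)
next
  case (Suc k)
  have o: "open {0::real<..}" "open (-{0::real})" by auto
  have "Ck_on k (\<lambda>x. inverse (sqrt x)) {0<..}"
    by (rule Ck_on_compose[OF o Suc Ck_on_inverse]) auto
  then have "Ck_on k (\<lambda>x. (v / 2) * inverse (sqrt x)) {0<..}" for v
    by (intro Ck_on_bounded_bilinear[OF o(1) bounded_bilinear_mult] Ck_on_const)
  then show ?case
    by (intro Ck_on_SucI[OF o(1), where f'="\<lambda>x v. (v / 2) * inverse (sqrt x)"])
       (auto intro!: derivative_eq_intros simp: field_simps)
qed

section \<open>Smooth functions\<close>

lemma smooth_onI: "(\<And>k. Ck_on k f S) \<Longrightarrow> smooth_on S f" by (simp add: smooth_on_def)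
lemma smooth_onD: "smooth_on S f \<Longrightarrow> Ck_on k f S" by (simp add: smooth_on_def)

lemma smooth_on_cong: "open S \<Longrightarrow> smooth_on S f \<Longrightarrow> (\<And>y. y \<in> S \<Longrightarrow> f y = g y) \<Longrightarrow> smooth_on S g"
  unfolding smooth_on_def by (metis Ck_on_cong)

lemma smooth_on_subset: "smooth_on S f \<Longrightarrow> T \<subseteq> S \<Longrightarrow> smooth_on T f"
  unfolding smooth_on_def by (metis Ck_on_subset)

lemma smooth_on_local:
  assumes "open S" "\<And>x. x \<in> S \<Longrightarrow> \<exists>T. open T \<and> x \<in> T \<and> smooth_on T f"
  shows "smooth_on S f"
  unfolding smooth_on_def by (metis Ck_on_local assms smooth_on_def)

lemma smooth_on_differentiable: "smooth_on S f \<Longrightarrow> x \<in> S \<Longrightarrow> f differentiable (at x)"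
  using smooth_onD[of S f 1] by auto

lemma smooth_on_has_derivative: "smooth_on S f \<Longrightarrow> x \<in> S \<Longrightarrow> (f has_derivative D f x) (at x)"
  using smooth_on_differentiable frechet_derivative_works by blast

lemma smooth_on_linear_D: "smooth_on S f \<Longrightarrow> x \<in> S \<Longrightarrow> linear (D f x)"
  using smooth_on_differentiable linear_frechet_derivative by blast

lemma smooth_on_continuous: "smooth_on S f \<Longrightarrow> continuous_on S f"
  using smooth_onD[of S f 0] by simp

lemma smooth_on_D: "smooth_on S f \<Longrightarrow> smooth_on S (\<lambda>x. D f x v)"
  unfolding smooth_on_def by (metis Ck_on.simps(2))

named_theorems smooth

lemma smooth_on_const[smooth]: "smooth_on S (\<lambda>x. c)"
  by (simp add: smooth_on_def Ck_on_const)

lemma smooth_on_bounded_linear: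
  "open S \<Longrightarrow> bounded_linear L \<Longrightarrow> smooth_on S f \<Longrightarrow> smooth_on S (\<lambda>x. L (f x))"
  unfolding smooth_on_def by (metis Ck_on_bounded_linear)

lemma smooth_on_linear:
  fixes L :: "'a::euclidean_space \<Rightarrow> 'b::euclidean_space"
  shows "open S \<Longrightarrow> linear L \<Longrightarrow> smooth_on S f \<Longrightarrow> smooth_on S (\<lambda>x. L (f x))"
  by (simp add: linear_conv_bounded_linear smooth_on_bounded_linear)

lemma smooth_on_ident[smooth]: "smooth_on S (\<lambda>x. x)"
proof -
  have "Ck_on k (\<lambda>x. x) (UNIV::'a set)" for k
  proof (induction k)
    case (Suc k)
    then show ?case by (simp add: Ck_on_const)
  qed auto
  then show ?thesis by (metis smooth_onI Ck_on_subset top_greatest)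
qed

lemma smooth_on_add[smooth]:
  "open S \<Longrightarrow> smooth_on S f \<Longrightarrow> smooth_on S g \<Longrightarrow> smooth_on S (\<lambda>x. f x + g x)"
  unfolding smooth_on_def by (metis Ck_on_add)

lemma smooth_on_minus[smooth]: "open S \<Longrightarrow> smooth_on S f \<Longrightarrow> smooth_on S (\<lambda>x. - f x)"
  by (rule smooth_on_bounded_linear[OF _ bounded_linear_minus[OF bounded_linear_ident]])

lemma smooth_on_diff[smooth]:
  "open S \<Longrightarrow> smooth_on S f \<Longrightarrow> smooth_on S g \<Longrightarrow> smooth_on S (\<lambda>x. f x - g x)"
  using smooth_on_add[of S f "\<lambda>x. - g x"] smooth_on_minus[of S g] by simp

lemma smooth_on_sum[smooth]:
  "open S \<Longrightarrow> (\<And>i. i \<in> I \<Longrightarrow> smooth_on S (f i)) \<Longrightarrow> smooth_on S (\<lambda>x. \<Sum>i\<in>I. f i x)"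
  unfolding smooth_on_def by (metis Ck_on_sum)

lemma smooth_on_scaleR[smooth]:
  "open S \<Longrightarrow> smooth_on S f \<Longrightarrow> smooth_on S g \<Longrightarrow> smooth_on S (\<lambda>x. f x *\<^sub>R g x)"
  unfolding smooth_on_def by (metis Ck_on_bounded_bilinear bounded_bilinear_scaleR)

lemma smooth_on_mult[smooth]:
  fixes f g :: "'e::euclidean_space \<Rightarrow> real"
  shows "open S \<Longrightarrow> smooth_on S f \<Longrightarrow> smooth_on S g \<Longrightarrow> smooth_on S (\<lambda>x. f x * g x)"
  unfolding smooth_on_def by (metis Ck_on_bounded_bilinear bounded_bilinear_mult)

lemma smooth_on_inner[smooth]:
  "open S \<Longrightarrow> smooth_on S f \<Longrightarrow> smooth_on S g \<Longrightarrow> smooth_on S (\<lambda>x. f x \<bullet> g x)"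
  unfolding smooth_on_def by (metis Ck_on_bounded_bilinear bounded_bilinear_inner)

lemma smooth_on_compose:
  "open S \<Longrightarrow> open T \<Longrightarrow> smooth_on S f \<Longrightarrow> smooth_on T g \<Longrightarrow> f ` S \<subseteq> T \<Longrightarrow> smooth_on S (\<lambda>x. g (f x))"
  unfolding smooth_on_def by (metis Ck_on_compose)

lemma smooth_on_inverse[smooth]:
  fixes f :: "'e::euclidean_space \<Rightarrow> real"
  shows "open S \<Longrightarrow> smooth_on S f \<Longrightarrow> (\<And>x. x \<in> S \<Longrightarrow> f x \<noteq> 0) \<Longrightarrow> smooth_on S (\<lambda>x. inverse (f x))"
  by (rule smooth_on_compose[of S "-{0}"]) (auto intro: smooth_onI Ck_on_inverse)

lemma smooth_on_divide[smooth]: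
  fixes f g :: "'e::euclidean_space \<Rightarrow> real"
  shows "open S \<Longrightarrow> smooth_on S f \<Longrightarrow> smooth_on S g \<Longrightarrow> (\<And>x. x \<in> S \<Longrightarrow> g x \<noteq> 0)
    \<Longrightarrow> smooth_on S (\<lambda>x. f x / g x)"
  unfolding divide_inverse by (intro smooth)

lemma smooth_on_sqrt[smooth]:
  fixes f :: "'e::euclidean_space \<Rightarrow> real"
  shows "open S \<Longrightarrow> smooth_on S f \<Longrightarrow> (\<And>x. x \<in> S \<Longrightarrow> f x > 0) \<Longrightarrow> smooth_on S (\<lambda>x. sqrt (f x))"
  by (rule smooth_on_compose[of S "{0<..}"]) (auto intro: smooth_onI Ck_on_sqrt)

lemma smooth_on_fst[smooth]: "open S \<Longrightarrow> smooth_on S f \<Longrightarrow> smooth_on S (\<lambda>x. fst (f x))"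
  by (rule smooth_on_bounded_linear[OF _ bounded_linear_fst])

lemma smooth_on_snd[smooth]: "open S \<Longrightarrow> smooth_on S f \<Longrightarrow> smooth_on S (\<lambda>x. snd (f x))"
  by (rule smooth_on_bounded_linear[OF _ bounded_linear_snd])

lemma smooth_on_Pair[smooth]:
  assumes "open S" "smooth_on S f" "smooth_on S g"
  shows "smooth_on S (\<lambda>x. (f x, g x))"
proof -
  have "smooth_on S (\<lambda>x. (f x, 0) + (0, g x))"
    by (intro smooth_on_add assms smooth_on_bounded_linear[of S "\<lambda>y. (y, 0)"]
       smooth_on_bounded_linear[of S "\<lambda>y. (0, y)"] bounded_linear_intros bounded_linear_Pair) 
  then show ?thesis by simp
qed

text \<open>Smoothness of a tensor is stated for constant arguments. In finite dimension this
  suffices for inserting a smooth field, by expanding the field in the basis.\<close>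

lemma smooth_on_apply_linear:
  fixes L :: "'a::euclidean_space \<Rightarrow> 'b::euclidean_space \<Rightarrow> 'c::euclidean_space"
  assumes "open S" "\<And>x. x \<in> S \<Longrightarrow> linear (L x)" "\<And>v. smooth_on S (\<lambda>x. L x v)" "smooth_on S X"
  shows "smooth_on S (\<lambda>x. L x (X x))"
proof (rule smooth_on_cong[OF assms(1)])
  show "smooth_on S (\<lambda>x. \<Sum>b\<in>Basis. (X x \<bullet> b) *\<^sub>R L x b)" by (intro smooth assms)
  show "(\<Sum>b\<in>Basis. (X y \<bullet> b) *\<^sub>R L y b) = L y (X y)" if "y \<in> S" for y
    using linear_expand[OF assms(2)[OF that]] by metis
qed

text \<open>Only the derivatives of \<open>L y v\<close> for fixed \<open>v\<close> are given. The
  basis expansion of \<open>X\<close> reduces the claim to finitely many of them, and the resulting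
  sums are reassembled by linearity in \<open>v\<close>.\<close>

lemma has_derivative_apply_linear:
  fixes L :: "'a::euclidean_space \<Rightarrow> 'b::euclidean_space \<Rightarrow> 'c::euclidean_space"
  assumes "open S" "x \<in> S" "\<And>x. x \<in> S \<Longrightarrow> linear (L x)" "\<And>v. (\<lambda>y. L y v) differentiable (at x)"
    "X differentiable (at x)"
  shows "((\<lambda>y. L y (X y)) has_derivative (\<lambda>u. D (\<lambda>y. L y (X x)) x u + L x (D X x u))) (at x)"
proof -
  have dL: "((\<lambda>y. L y v) has_derivative D (\<lambda>y. L y v) x) (at x)" for v
    using assms(4) frechet_derivative_works by blast
  have dX: "(X has_derivative D X x) (at x)"
    using assms(5) frechet_derivative_works by blast
  have "((\<lambda>y. \<Sum>b\<in>Basis. (X y \<bullet> b) *\<^sub>R L y b) has_derivative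
      (\<lambda>u. \<Sum>b\<in>Basis. (X x \<bullet> b) *\<^sub>R D (\<lambda>y. L y b) x u + (D X x u \<bullet> b) *\<^sub>R L x b)) (at x)"
    by (intro has_derivative_sum has_derivative_scaleR has_derivative_inner_left dL dX)
  moreover have "((\<lambda>y. \<Sum>b\<in>Basis. (X x \<bullet> b) *\<^sub>R L y b) has_derivative
      (\<lambda>u. \<Sum>b\<in>Basis. (X x \<bullet> b) *\<^sub>R D (\<lambda>y. L y b) x u)) (at x)"
    by (intro has_derivative_sum has_derivative_scaleR_right dL)
  then have dd: "((\<lambda>y. L y (X x)) has_derivative
      (\<lambda>u. \<Sum>b\<in>Basis. (X x \<bullet> b) *\<^sub>R D (\<lambda>y. L y b) x u)) (at x)"
    by (rule has_derivative_transform_within_open[OF _ assms(1,2)])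
       (rule linear_expand[OF assms(3), symmetric])
  have "D (\<lambda>y. L y (X x)) x u = (\<Sum>b\<in>Basis. (X x \<bullet> b) *\<^sub>R D (\<lambda>y. L y b) x u)" for u
    unfolding D_eq[OF dd] ..
  ultimately have "((\<lambda>y. \<Sum>b\<in>Basis. (X y \<bullet> b) *\<^sub>R L y b) has_derivative
      (\<lambda>u. D (\<lambda>y. L y (X x)) x u + L x (D X x u))) (at x)"
    by (simp add: sum.distrib flip: linear_expand[OF assms(3)[OF assms(2)]])
  then show ?thesis
    by (rule has_derivative_transform_within_open[OF _ assms(1,2)])
       (rule linear_expand[OF assms(3), symmetric])
qed

section \<open>Symmetry of the second derivative\<close>

text \<open>The mean value theorem is applied twice: along \<open>u\<close> to the difference of
  \<open>f\<close> in direction \<open>v\<close>, then along \<open>v\<close> to the derivative. The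
  left side is symmetric in \<open>u\<close> and \<open>v\<close>, which is the point; the bound on
  \<open>h\<close> keeps the whole parallelogram in the ball.\<close>

lemma second_difference:
  fixes f :: "'a::euclidean_space \<Rightarrow> real"
  assumes sm: "smooth_on S f" and sub: "ball x r \<subseteq> S" and h: "0 < h" "h * (norm u + norm v) < r"
  obtains p where "p \<in> ball x r"
    "f (x + h *\<^sub>R u + h *\<^sub>R v) - f (x + h *\<^sub>R u) - f (x + h *\<^sub>R v) + f x = h * h * D (\<lambda>y. D f y u) p v"
proof -
  have inb: "x + s *\<^sub>R u + t *\<^sub>R v \<in> ball x r"
    if "0 \<le> s" "s \<le> h" "0 \<le> t" "t \<le> h" for s t
  proof -
    have "norm (s *\<^sub>R u + t *\<^sub>R v) \<le> s * norm u + t * norm v"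
      using norm_triangle_ineq[of "s *\<^sub>R u" "t *\<^sub>R v"] that by simp
    also have "\<dots> \<le> h * norm u + h * norm v"
      using that by (intro add_mono mult_right_mono) auto
    finally have *: "norm (s *\<^sub>R u + t *\<^sub>R v) \<le> h * (norm u + norm v)" by (simp add: algebra_simps)
    then have "dist x (x + s *\<^sub>R u + t *\<^sub>R v) \<le> h * (norm u + norm v)"
      by (metis add.assoc dist_add_cancel dist_0_norm add.right_neutral)
    then show "x + s *\<^sub>R u + t *\<^sub>R v \<in> ball x r" using h(2) by simp
  qed
  define g where "g s = f (x + s *\<^sub>R u + h *\<^sub>R v) - f (x + s *\<^sub>R u + 0 *\<^sub>R v)" for s
  have line: "((\<lambda>s. F (a + s *\<^sub>R w)) has_real_derivative D F (a + s *\<^sub>R w) w) (at s)"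
    if "smooth_on S F" "a + s *\<^sub>R w \<in> S" for F :: "'a \<Rightarrow> real" and a w s
  proof -
    have "((\<lambda>s. a + s *\<^sub>R w) has_derivative (\<lambda>k. k *\<^sub>R w)) (at s)"
      by (auto intro!: derivative_eq_intros)
    from has_derivative_compose[OF this, of F "D F (a + s *\<^sub>R w)"]
    have "((\<lambda>s. F (a + s *\<^sub>R w)) has_derivative (\<lambda>k. D F (a + s *\<^sub>R w) (k *\<^sub>R w))) (at s)"
      using smooth_on_has_derivative[OF that] by simp
    moreover have "(\<lambda>k. D F (a + s *\<^sub>R w) (k *\<^sub>R w)) = (*) (D F (a + s *\<^sub>R w) w)"
      using linear_scale[OF smooth_on_linear_D[OF that]] by auto
    ultimately show ?thesis by (simp add: has_field_derivative_def)
  qed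
  have d1: "(g has_real_derivative D f (x + s *\<^sub>R u + h *\<^sub>R v) u - D f (x + s *\<^sub>R u + 0 *\<^sub>R v) u) (at s)"
    if "0 \<le> s" "s \<le> h" for s
  proof -
    have "((\<lambda>s. f ((x + h *\<^sub>R v) + s *\<^sub>R u)) has_real_derivative D f ((x + h *\<^sub>R v) + s *\<^sub>R u) u) (at s)"
      using inb[of s h] that sub h by (intro line[OF sm]) (auto simp: algebra_simps)
    moreover have "((\<lambda>s. f (x + s *\<^sub>R u)) has_real_derivative D f (x + s *\<^sub>R u) u) (at s)"
      using inb[of s 0] that sub h by (intro line[OF sm]) (auto simp: algebra_simps)
    ultimately show ?thesis unfolding g_def
      by (auto intro!: derivative_eq_intros simp: algebra_simps)
  qed
  then obtain z where z: "0 < z" "z < h" "g h - g 0 = (h - 0) * (D f (x + z *\<^sub>R u + h *\<^sub>R v) u - D f (x + z *\<^sub>R u + 0 *\<^sub>R v) u)"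
    using MVT2[OF h(1) d1] by blast
  have d2: "((\<lambda>t. D f (x + z *\<^sub>R u + t *\<^sub>R v) u) has_real_derivative D (\<lambda>y. D f y u) (x + z *\<^sub>R u + t *\<^sub>R v) v) (at t)"
    if "0 \<le> t" "t \<le> h" for t
    using inb[of z t] that sub z by (intro line[OF smooth_on_D[OF sm]]) auto
  then obtain t where t: "0 < t" "t < h" "D f (x + z *\<^sub>R u + h *\<^sub>R v) u - D f (x + z *\<^sub>R u + 0 *\<^sub>R v) u
      = (h - 0) * D (\<lambda>y. D f y u) (x + z *\<^sub>R u + t *\<^sub>R v) v"
    using MVT2[OF h(1) d2] by blast
  show ?thesis
  proof (rule that[of "x + z *\<^sub>R u + t *\<^sub>R v"])
    show "x + z *\<^sub>R u + t *\<^sub>R v \<in> ball x r"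
      using inb[of z t] z t by auto
    show "f (x + h *\<^sub>R u + h *\<^sub>R v) - f (x + h *\<^sub>R u) - f (x + h *\<^sub>R v) + f x =
       h * h * D (\<lambda>y. D f y u) (x + z *\<^sub>R u + t *\<^sub>R v) v"
      using z(3) t(3) by (simp add: g_def)
  qed
qed

text \<open>One and the same second difference is \<open>h * h\<close> times each mixed derivative,
  taken at two nearby points. Continuity then excludes a gap between the two mixed derivatives at
  \<open>x\<close>.\<close>

lemma second_derivative_symmetric_real:
  fixes f :: "'a::euclidean_space \<Rightarrow> real"
  assumes "open S" "smooth_on S f" "x \<in> S"
  shows "D (\<lambda>y. D f y u) x v = D (\<lambda>y. D f y v) x u"
proof (rule ccontr)
  let ?P = "\<lambda>y. D (\<lambda>y. D f y u) y v" and ?Q = "\<lambda>y. D (\<lambda>y. D f y v) y u"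
  assume ne: "?P x \<noteq> ?Q x"
  define e where "e = \<bar>?P x - ?Q x\<bar> / 2"
  have "e > 0" using ne by (simp add: e_def)
  have "isCont ?P x" "isCont ?Q x"
    using assms smooth_on_continuous[OF smooth_on_D[OF smooth_on_D[OF assms(2)]]]
    by (auto simp: continuous_on_eq_continuous_at)
  then have "\<exists>d>0. \<forall>y. dist y x < d \<longrightarrow> dist (?P y) (?P x) < e" "\<exists>d>0. \<forall>y. dist y x < d \<longrightarrow> dist (?Q y) (?Q x) < e"
    using \<open>e > 0\<close> unfolding continuous_at_eps_delta by blast+
  then obtain d1 d2 where d: "d1 > 0" "d2 > 0" "\<And>y. dist y x < d1 \<Longrightarrow> dist (?P y) (?P x) < e"
     "\<And>y. dist y x < d2 \<Longrightarrow> dist (?Q y) (?Q x) < e"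
    by blast
  obtain r0 where r0: "r0 > 0" "ball x r0 \<subseteq> S" using assms open_contains_ball by blast
  define r where "r = min r0 (min d1 d2)"
  have r: "r > 0" "ball x r \<subseteq> S" using r0 d by (auto simp: r_def)
  \<comment> \<open>The summand 1 keeps the denominator positive when \<open>u\<close> and
    \<open>v\<close> both vanish, and the factor 2 makes the bound strict.\<close>
  define h where "h = r / (2 * (norm u + norm v + 1))"
  have pos: "norm u + norm v + 1 > 0" by (smt (verit) norm_ge_zero)
  have h: "h > 0" using r pos by (simp add: h_def)
  have "h * (norm u + norm v) < h * (2 * (norm u + norm v + 1))"
    using h pos by (intro mult_strict_left_mono) (auto intro: add_nonneg_pos)
  also have "\<dots> = r" using pos by (simp add: h_def)
  finally have hr: "h * (norm u + norm v) < r" .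
  obtain p where p: "p \<in> ball x r" 
    "f (x + h *\<^sub>R u + h *\<^sub>R v) - f (x + h *\<^sub>R u) - f (x + h *\<^sub>R v) + f x = h * h * ?P p"
    using second_difference[OF assms(2) r(2) h hr] by metis
  obtain q where q: "q \<in> ball x r" 
    "f (x + h *\<^sub>R v + h *\<^sub>R u) - f (x + h *\<^sub>R v) - f (x + h *\<^sub>R u) + f x = h * h * ?Q q"
    using second_difference[OF assms(2) r(2) h, of v u] hr by (metis add.commute)
  have "x + h *\<^sub>R v + h *\<^sub>R u = x + h *\<^sub>R u + h *\<^sub>R v" by simp
  with p(2) q(2) have "h * h * ?P p = h * h * ?Q q" by (metis (no_types, lifting) diff_diff_eq add.commute)
  then have "?P p = ?Q q" using h by simp
  moreover have "dist (?P p) (?P x) < e" "dist (?Q q) (?Q x) < e"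
    using p(1) q(1) d(3)[of p] d(4)[of q] by (auto simp: r_def dist_commute)
  ultimately show False by (simp add: e_def dist_real_def abs_if split: if_splits)
qed

lemma second_derivative_symmetric:
  fixes f :: "'a::euclidean_space \<Rightarrow> 'b::euclidean_space"
  assumes "open S" "smooth_on S f" "x \<in> S"
  shows "D (\<lambda>y. D f y u) x v = D (\<lambda>y. D f y v) x u"
proof (rule euclidean_eqI)
  fix b :: 'b assume "b \<in> Basis"
  have sm: "smooth_on S (\<lambda>y. f y \<bullet> b)" by (intro smooth assms)
  have inner: "D (\<lambda>y. g y \<bullet> b) z w = D g z w \<bullet> b" if "smooth_on S g" "z \<in> S" for g z w
    using D_eq[OF has_derivative_inner_left[OF smooth_on_has_derivative[OF that], of b]] by simp
  have "D (\<lambda>y. D f y u) x v \<bullet> b = D (\<lambda>y. D (\<lambda>y. f y \<bullet> b) y u) x v" for u v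
    using inner[OF smooth_on_D[OF assms(2)] assms(3), of u v]
      D_cong[OF assms(1,3), of "\<lambda>y. D f y u \<bullet> b" "\<lambda>y. D (\<lambda>y. f y \<bullet> b) y u"] inner[OF assms(2)]
    by simp
  then show "D (\<lambda>y. D f y u) x v \<bullet> b = D (\<lambda>y. D f y v) x u \<bullet> b"
    using second_derivative_symmetric_real[OF assms(1) sm assms(3), of u v] by simp
qed

section \<open>Orthonormal frames\<close>

definition metric_on :: "'e::euclidean_space set \<Rightarrow> ('e \<Rightarrow> 'e \<Rightarrow> 'e \<Rightarrow> real) \<Rightarrow> bool" where
  "metric_on S G \<longleftrightarrow> open S \<and>
     (\<forall>x\<in>S. bilinear (G x) \<and> (\<forall>v w. G x v w = G x w v) \<and> (\<forall>v. v \<noteq> 0 \<longrightarrow> G x v v > 0)) \<and>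
     (\<forall>v w. smooth_on S (\<lambda>x. G x v w))"

definition frame_on :: "'e::euclidean_space set \<Rightarrow> ('e \<Rightarrow> 'e \<Rightarrow> 'e \<Rightarrow> real) \<Rightarrow> nat \<Rightarrow> (nat \<Rightarrow> 'e \<Rightarrow> 'e) \<Rightarrow> bool"
  where
  "frame_on S G n E \<longleftrightarrow> (\<forall>i<n. smooth_on S (E i)) \<and>
     (\<forall>x\<in>S. \<forall>i<n. \<forall>j<n. G x (E i x) (E j x) = (if i = j then 1 else 0))"

lemma metric_onD:
  assumes "metric_on S G"
  shows "open S" "x \<in> S \<Longrightarrow> bilinear (G x)" "x \<in> S \<Longrightarrow> G x v w = G x w v"
    "x \<in> S \<Longrightarrow> v \<noteq> 0 \<Longrightarrow> G x v v > 0" "smooth_on S (\<lambda>x. G x v w)"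
    "x \<in> S \<Longrightarrow> linear (G x v)" "x \<in> S \<Longrightarrow> linear (\<lambda>v. G x v w)"
  using assms by (auto simp: metric_on_def bilinear_def)

lemma metric_on_subset: "metric_on S G \<Longrightarrow> open T \<Longrightarrow> T \<subseteq> S \<Longrightarrow> metric_on T G"
  unfolding metric_on_def by (meson smooth_on_subset subsetD)

lemma metric_on_simps:
  assumes "metric_on S G" "x \<in> S"
  shows "G x (u + v) w = G x u w + G x v w" "G x u (v + w) = G x u v + G x u w"
    "G x (c *\<^sub>R u) w = c * G x u w" "G x u (c *\<^sub>R w) = c * G x u w"
    "G x (u - v) w = G x u w - G x v w" "G x u (v - w) = G x u v - G x u w"
    "G x (- u) w = - G x u w" "G x u (- w) = - G x u w"
    "G x 0 w = 0" "G x u 0 = 0"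
    "G x (\<Sum>i\<in>I. f i) w = (\<Sum>i\<in>I. G x (f i) w)" "G x u (\<Sum>i\<in>I. f i) = (\<Sum>i\<in>I. G x u (f i))"
  by (simp_all add: linear_add[OF metric_onD(6)[OF assms]] linear_add[OF metric_onD(7)[OF assms]]
      linear_scale[OF metric_onD(6)[OF assms]] linear_scale[OF metric_onD(7)[OF assms]]
      linear_diff[OF metric_onD(6)[OF assms]] linear_diff[OF metric_onD(7)[OF assms]]
      linear_neg[OF metric_onD(6)[OF assms]] linear_neg[OF metric_onD(7)[OF assms]]
      linear_0[OF metric_onD(6)[OF assms]] linear_0[OF metric_onD(7)[OF assms]]
      linear_sum[OF metric_onD(6)[OF assms]] linear_sum[OF metric_onD(7)[OF assms]])

lemma metric_on_eqI:
  assumes "metric_on S G" "x \<in> S" "\<And>u. G x v u = G x w u"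
  shows "v = w"
proof (rule ccontr)
  assume "v \<noteq> w"
  then have "G x (v - w) (v - w) > 0" using metric_onD(4)[OF assms(1,2)] by simp
  then show False using assms(3)[of "v - w"] by (simp add: metric_on_simps[OF assms(1,2)])
qed

lemma smooth_on_metric:
  assumes "metric_on S G" "T \<subseteq> S" "open T" "smooth_on T X" "smooth_on T Y"
  shows "smooth_on T (\<lambda>x. G x (X x) (Y x))"
proof -
  have xS: "x \<in> S" if "x \<in> T" for x using that assms(2) by blast
  have 1: "smooth_on T (\<lambda>x. G x v (Y x))" for v
    by (rule smooth_on_apply_linear[OF assms(3) metric_onD(6)[OF assms(1) xS]
        smooth_on_subset[OF metric_onD(5)[OF assms(1)] assms(2)] assms(5)])
  show ?thesis
    by (rule smooth_on_apply_linear[where L="\<lambda>x v. G x v (Y x)",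
        OF assms(3) metric_onD(7)[OF assms(1) xS] 1 assms(4)])
qed

text \<open>A Gram-Schmidt step, started from a constant vector outside the span at
  \<open>x0\<close>. Its remainder is nonzero at \<open>x0\<close>, hence nearby, which is why the
  domain shrinks. The given fields are kept, so that horizontal lifts can later be completed to a
  full frame.\<close>

lemma frame_on_extend:
  fixes G :: "'e::euclidean_space \<Rightarrow> 'e \<Rightarrow> 'e \<Rightarrow> real"
  assumes M: "metric_on S G" and F: "frame_on S G n E" and n: "n < DIM('e)" and x0: "x0 \<in> S"
  shows "\<exists>T E'. open T \<and> x0 \<in> T \<and> T \<subseteq> S \<and> frame_on T G (Suc n) E' \<and> (\<forall>i<n. E' i = E i)"
proof -
  have "dim (span ((\<lambda>i. E i x0) ` {..<n})) \<le> card ((\<lambda>i. E i x0) ` {..<n})"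
    by (simp add: dim_le_card')
  also have "\<dots> \<le> n" using card_image_le[of "{..<n}"] by fastforce
  finally have "span ((\<lambda>i. E i x0) ` {..<n}) \<noteq> UNIV"
    using n by (metis dim_UNIV not_le)
  then obtain v where v: "v \<notin> span ((\<lambda>i. E i x0) ` {..<n})" by auto
  define w where "w x = v - (\<Sum>i<n. G x v (E i x) *\<^sub>R E i x)" for x
  have oS: "open S" using metric_onD[OF M] by blast
  have smE: "smooth_on S (E i)" if "i < n" for i using F that by (auto simp: frame_on_def)
  have smw: "smooth_on S w"
    unfolding w_def by (intro smooth smooth_on_metric[OF M order.refl] oS) (auto intro: smE)
  define q where "q x = G x (w x) (w x)" for x
  have smq: "smooth_on S q" unfolding q_def by (rule smooth_on_metric[OF M order.refl oS smw smw])
  define T where "T = S \<inter> q -` {0<..}"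
  have "w x0 \<noteq> 0"
  proof
    assume "w x0 = 0"
    then have "v = (\<Sum>i<n. G x0 v (E i x0) *\<^sub>R E i x0)" by (simp add: w_def)
    also have "\<dots> \<in> span ((\<lambda>i. E i x0) ` {..<n})"
      by (intro span_sum span_scale span_base) auto
    finally show False using v by simp
  qed
  then have x0T: "x0 \<in> T" using metric_onD(4)[OF M x0] x0 by (auto simp: T_def q_def)
  have oT: "open T" unfolding T_def
    using continuous_open_preimage[OF smooth_on_continuous[OF smq] oS] by auto
  have TS: "T \<subseteq> S" by (auto simp: T_def)
  have qpos: "q x > 0" if "x \<in> T" for x using that by (auto simp: T_def)
  define E' where "E' = E(n := \<lambda>x. (1 / sqrt (q x)) *\<^sub>R w x)"
  have sm': "smooth_on T (E' i)" if "i < Suc n" for i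
  proof (cases "i = n")
    case True
    have "smooth_on T (\<lambda>x. (1 / sqrt (q x)) *\<^sub>R w x)"
      by (intro smooth oT smooth_on_subset[OF smq TS] smooth_on_subset[OF smw TS]) (auto dest!: qpos)
    then show ?thesis using True by (simp add: E'_def)
  next
    case False
    then have "i < n" using that by simp
    then show ?thesis using smooth_on_subset[OF smE TS] by (simp add: E'_def)
  qed
  have wE: "G x (w x) (E j x) = 0" if "x \<in> T" "j < n" for x j
  proof -
    have xS: "x \<in> S" using that TS by auto
    have "G x (w x) (E j x) = G x v (E j x) - (\<Sum>i<n. G x v (E i x) * G x (E i x) (E j x))"
      by (simp add: w_def metric_on_simps[OF M xS])
    also have "(\<Sum>i<n. G x v (E i x) * G x (E i x) (E j x)) = (\<Sum>i<n. if i = j then G x v (E j x) else 0)"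
      using F xS that by (intro sum.cong) (auto simp: frame_on_def)
    finally show ?thesis using that by simp
  qed
  have "G x (E' i x) (E' j x) = (if i = j then 1 else 0)" if that: "x \<in> T" "i < Suc n" "j < Suc n" for x i j
  proof -
    have xS: "x \<in> S" using that TS by auto
    have "i < n \<or> i = n" "j < n \<or> j = n" using that by auto
    then consider "i < n" "j < n" | "i = n" "j < n" | "i < n" "j = n" | "i = n" "j = n"
      by blast
    then show ?thesis
    proof cases
      case 1 then show ?thesis using F xS by (auto simp: frame_on_def E'_def)
    next
      case 2 then show ?thesis using wE[OF that(1)] by (auto simp: E'_def metric_on_simps[OF M xS])
    next
      case 3 then show ?thesis using wE[OF that(1)] metric_onD(3)[OF M xS, of "E i x"]
        by (auto simp: E'_def metric_on_simps[OF M xS])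
    next
      case 4
      have "q x > 0" using qpos that by auto
      then show ?thesis using 4 by (auto simp: E'_def metric_on_simps[OF M xS] q_def[symmetric])
    qed
  qed
  then have "frame_on T G (Suc n) E'" using sm' by (auto simp: frame_on_def)
  then show ?thesis using oT x0T TS by (intro exI[of _ T] exI[of _ E']) (auto simp: E'_def)
qed

lemma frame_on_complete:
  fixes G :: "'e::euclidean_space \<Rightarrow> 'e \<Rightarrow> 'e \<Rightarrow> real"
  assumes "metric_on S G" "frame_on S G n E" "n \<le> DIM('e)" "x0 \<in> S"
  obtains T E' where "open T" "x0 \<in> T" "T \<subseteq> S" "frame_on T G DIM('e) E'" "\<And>i. i < n \<Longrightarrow> E' i = E i"
proof -
  have "\<exists>T E'. open T \<and> x0 \<in> T \<and> T \<subseteq> S \<and> frame_on T G DIM('e) E' \<and> (\<forall>i<n. E' i = E i)"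
    using assms
  proof (induction "DIM('e) - n" arbitrary: n S E)
    case 0
    then show ?case using metric_onD(1)[OF 0(2)] by (intro exI[of _ S] exI[of _ E]) auto
  next
    case (Suc k)
    then have "n < DIM('e)" by linarith
    from frame_on_extend[OF Suc.prems(1,2) this Suc.prems(4)] obtain T E' where
      T: "open T" "x0 \<in> T" "T \<subseteq> S" "frame_on T G (Suc n) E'" "\<forall>i<n. E' i = E i" by blast
    have "k = DIM('e) - Suc n" "Suc n \<le> DIM('e)" using Suc by linarith+
    from Suc.hyps(1)[OF this(1) metric_on_subset[OF Suc.prems(1) T(1,3)] T(4) this(2) T(2)]
    obtain T' E'' where *: "open T'" "x0 \<in> T'" "T' \<subseteq> T" "frame_on T' G DIM('e) E''" "\<forall>i<Suc n. E'' i = E' i"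
      by blast
    then show ?case using T by (intro exI[of _ T'] exI[of _ E'']) auto
  qed
  then show ?thesis using that by blast
qed

lemma frame_on_exists:
  fixes G :: "'e::euclidean_space \<Rightarrow> 'e \<Rightarrow> 'e \<Rightarrow> real"
  assumes "metric_on S G" "x0 \<in> S"
  obtains T E where "open T" "x0 \<in> T" "T \<subseteq> S" "frame_on T G DIM('e) E"
  using frame_on_complete[OF assms(1) _ _ assms(2), of 0] by (auto simp: frame_on_def)

text \<open>The coefficient map \<open>T\<close> and the combination map \<open>C\<close> satisfy T
  o C = id by orthonormality. The dimensions agree, so also C o T = id, which is the
  expansion.\<close>

lemma frame_on_expand:
  fixes G :: "'e::euclidean_space \<Rightarrow> 'e \<Rightarrow> 'e \<Rightarrow> real"
  assumes M: "metric_on S G" and F: "frame_on S G DIM('e) E" and x: "x \<in> S"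
  shows "v = (\<Sum>i<DIM('e). G x v (E i x) *\<^sub>R E i x)"
proof -
  obtain b where b: "bij_betw b {..<DIM('e)} (Basis :: 'e set)"
    using ex_bij_betw_nat_finite[OF finite_Basis] by (metis atLeast0LessThan)
  define T where "T v = (\<Sum>i<DIM('e). G x v (E i x) *\<^sub>R b i)" for v
  define C where "C c = (\<Sum>i<DIM('e). (c \<bullet> b i) *\<^sub>R E i x)" for c
  have "linear T" "linear C" unfolding T_def C_def
    by (auto intro!: linearI simp: metric_on_simps[OF M x] scaleR_add_left sum.distrib
        scaleR_sum_right inner_add_left)
  have bb: "b i \<bullet> b j = (if i = j then 1 else 0)" if "i < DIM('e)" "j < DIM('e)" for i j
    using bij_betwE[OF b] bij_betw_imp_inj_on[OF b] that by (auto simp: inner_Basis inj_on_def)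
  have "T (C c) = c" for c
  proof -
    have "G x (C c) (E j x) = c \<bullet> b j" if "j < DIM('e)" for j
    proof -
      have "G x (C c) (E j x) = (\<Sum>i<DIM('e). if i = j then c \<bullet> b j else 0)"
        unfolding C_def metric_on_simps[OF M x]
        using F x that by (intro sum.cong) (auto simp: frame_on_def)
      then show ?thesis using that by simp
    qed
    then have "T (C c) = (\<Sum>i<DIM('e). (c \<bullet> b i) *\<^sub>R b i)" by (simp add: T_def)
    also have "\<dots> = (\<Sum>y\<in>Basis. (c \<bullet> y) *\<^sub>R y)" by (rule sum.reindex_bij_betw[OF b])
    finally show ?thesis by (simp add: euclidean_representation)
  qed
  then have "T \<circ> C = id" by auto
  then have "C \<circ> T = id" using linear_inverse_left \<open>linear T\<close> \<open>linear C\<close> by blast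
  then have "v = C (T v)" by (metis comp_apply id_apply)
  moreover have "T v \<bullet> b j = G x v (E j x)" if "j < DIM('e)" for j
  proof -
    have "T v \<bullet> b j = (\<Sum>i<DIM('e). if i = j then G x v (E j x) else 0)"
      unfolding T_def inner_sum_left using bb that by (intro sum.cong) auto
    then show ?thesis using that by simp
  qed
  ultimately show ?thesis by (simp add: C_def)
qed

lemma metric_on_sharp_exists:
  fixes G :: "'e::euclidean_space \<Rightarrow> 'e \<Rightarrow> 'e \<Rightarrow> real"
  assumes M: "metric_on S G" and x: "x \<in> S" and "linear \<alpha>"
  shows "\<exists>!z. \<forall>u. G x z u = \<alpha> u"
proof -
  obtain T E where T: "open T" "x \<in> T" "T \<subseteq> S" "frame_on T G DIM('e) E"
    using frame_on_exists[OF M x] .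
  note M' = metric_on_subset[OF M T(1,3)]
  have "G x (\<Sum>i<DIM('e). \<alpha> (E i x) *\<^sub>R E i x) u = \<alpha> u" for u
  proof -
    have "\<alpha> u = \<alpha> (\<Sum>i<DIM('e). G x u (E i x) *\<^sub>R E i x)"
      using frame_on_expand[OF M' T(4,2)] by metis
    also have "\<dots> = (\<Sum>i<DIM('e). G x u (E i x) * \<alpha> (E i x))"
      using assms(3) by (simp add: linear_sum linear_scale)
    finally show ?thesis
      using metric_onD(3)[OF M x] by (simp add: metric_on_simps[OF M x] mult.commute)
  qed
  then show ?thesis using metric_on_eqI[OF M x] by metis
qed

text \<open>The components of \<open>z\<close> in a local smooth orthonormal frame are \<alpha>
  evaluated on the frame, so no inverse of the metric matrix is needed.\<close>

lemma smooth_on_sharp: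
  fixes G :: "'e::euclidean_space \<Rightarrow> 'e \<Rightarrow> 'e \<Rightarrow> real"
  assumes M: "metric_on S G" and z: "\<And>x u. x \<in> S \<Longrightarrow> G x (z x) u = \<alpha> x u"
    and sm: "\<And>u. smooth_on S (\<lambda>x. \<alpha> x u)"
  shows "smooth_on S z"
proof (rule smooth_on_local[OF metric_onD(1)[OF M]])
  fix x assume "x \<in> S"
  then obtain T E where T: "open T" "x \<in> T" "T \<subseteq> S" "frame_on T G DIM('e) E"
    using frame_on_exists[OF M] by metis
  note M' = metric_on_subset[OF M T(1,3)]
  have "smooth_on T (\<lambda>y. \<Sum>i<DIM('e). G y (z y) (E i y) *\<^sub>R E i y)"
  proof (intro smooth T)
    fix i assume "i \<in> {..<DIM('e)}"
    then show E: "smooth_on T (E i)" using T by (auto simp: frame_on_def)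
    have "linear (\<alpha> y)" if "y \<in> T" for y
    proof -
      have "y \<in> S" using T(3) that by auto
      then have "\<alpha> y = G y (z y)" using z by auto
      then show ?thesis using metric_onD(6)[OF M \<open>y \<in> S\<close>] by simp
    qed
    then have "smooth_on T (\<lambda>y. \<alpha> y (E i y))"
      by (rule smooth_on_apply_linear[where L=\<alpha>, OF T(1) _ smooth_on_subset[OF sm T(3)] E])
    then show "smooth_on T (\<lambda>y. G y (z y) (E i y))"
      by (rule smooth_on_cong[OF T(1)]) (use z T in auto)
  qed
  then have "smooth_on T z"
    by (rule smooth_on_cong[OF T(1)]) (rule frame_on_expand[OF M' T(4), symmetric])
  then show "\<exists>T. open T \<and> x \<in> T \<and> smooth_on T z" using T by blast
qed

section \<open>The smooth inverse function theorem\<close>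

text \<open>The derivative of \<open>g\<close> is written without inverting a matrix: for a frame
  \<open>E\<close> orthonormal with respect to the pullback \<open>G\<close> of the inner product,
  its coefficients are the inner products of \<open>v\<close> with the images of \<open>E\<close>.
  The formula involves \<open>g\<close> only through composition, so C^k of \<open>g\<close> gives
  C^(k+1).\<close>

lemma smooth_on_inverse_function:
  fixes f :: "'a::euclidean_space \<Rightarrow> 'b::euclidean_space"
  assumes U: "open U" "smooth_on U f" "\<And>x. x \<in> U \<Longrightarrow> inj (D f x)"
    and V: "open V" "\<And>y. y \<in> V \<Longrightarrow> g y \<in> U" "\<And>y. y \<in> V \<Longrightarrow> f (g y) = y"
    and g: "\<And>y. y \<in> V \<Longrightarrow> g differentiable (at y)"
  shows "smooth_on V g"
proof (rule smooth_on_local[OF V(1)])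
  define G where "G x u v = D f x u \<bullet> D f x v" for x u v
  have lin: "linear (D f x)" if "x \<in> U" for x using smooth_on_linear_D[OF U(2) that] .
  have M: "metric_on U G"
    unfolding metric_on_def
  proof (intro conjI ballI allI impI)
    show "open U" by fact
    show "bilinear (G x)" if "x \<in> U" for x
      using lin[OF that] by (auto simp: bilinear_def G_def linear_iff inner_add_left inner_add_right)
    show "G x v w = G x w v" for x v w by (simp add: G_def inner_commute)
    show "G x v v > 0" if "x \<in> U" "v \<noteq> 0" for x v
      using U(3)[OF that(1)] that(2) unfolding G_def linear_injective_0[OF lin[OF that(1)]] by (metis inner_gt_zero_iff)
    show "smooth_on U (\<lambda>x. G x v w)" for v w
      unfolding G_def by (intro smooth U(1) smooth_on_D U(2))
  qed
  fix y0 assume y0: "y0 \<in> V"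
  obtain T E where T: "open T" "g y0 \<in> T" "T \<subseteq> U" "frame_on T G DIM('a) E"
    using frame_on_exists[OF M V(2)[OF y0]] .
  note M' = metric_on_subset[OF M T(1,3)]
  have cg: "continuous_on V g"
    using g by (meson continuous_at_imp_continuous_on differentiable_imp_continuous_within)
  define V' where "V' = V \<inter> g -` T"
  have oV: "open V'" unfolding V'_def using continuous_open_preimage[OF cg V(1) T(1)] .
  have gV: "g ` V' \<subseteq> T" by (auto simp: V'_def)
  define h where "h i x = D f x (E i x)" for i x
  have smE: "smooth_on T (E i)" if "i < DIM('a)" for i using T(4) that by (auto simp: frame_on_def)
  have smh: "smooth_on T (h i)" if "i < DIM('a)" for i
    unfolding h_def using T(3) lin
    by (intro smooth_on_apply_linear[where L="D f", OF T(1) _ smooth_on_subset[OF smooth_on_D[OF U(2)] T(3)] smE[OF that]]) auto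
  have dg: "D g y v = (\<Sum>i<DIM('a). (v \<bullet> h i (g y)) *\<^sub>R E i (g y))" if "y \<in> V'" for y v
  proof -
    have yV: "y \<in> V" "g y \<in> T" "g y \<in> U" using that V(2) by (auto simp: V'_def)
    have 1: "((\<lambda>y. f (g y)) has_derivative (\<lambda>v. D f (g y) (D g y v))) (at y)"
      using has_derivative_compose[of g "D g y" y UNIV f "D f (g y)"] g[OF yV(1), unfolded frechet_derivative_works]
        smooth_on_has_derivative[OF U(2) yV(3)] by blast
    have "((\<lambda>y. f (g y)) has_derivative (\<lambda>v. v)) (at y)"
      by (rule has_derivative_transform_within_open[OF has_derivative_ident V(1) yV(1)]) (simp add: V(3))
    then have "D f (g y) (D g y v) = v" using has_derivative_unique[OF 1] by metis
    then have "G (g y) (D g y v) (E i (g y)) = v \<bullet> h i (g y)" for i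
      by (simp add: G_def h_def)
    then show ?thesis using frame_on_expand[OF M' T(4) yV(2), of "D g y v"] by simp
  qed
  have "Ck_on k g V'" for k
  proof (induction k)
    case 0
    then show ?case using cg by (auto simp: V'_def intro: continuous_on_subset)
  next
    case (Suc k)
    have "Ck_on k (\<lambda>y. \<Sum>i<DIM('a). (v \<bullet> h i (g y)) *\<^sub>R E i (g y)) V'" for v
      by (intro Ck_on_sum Ck_on_bounded_bilinear[OF oV bounded_bilinear_scaleR]
         Ck_on_bounded_linear[OF oV _ bounded_linear_inner_right] oV
         Ck_on_compose[OF oV T(1) Suc _ gV] smooth_onD smE smh) auto
    moreover have "(g has_derivative (\<lambda>v. \<Sum>i<DIM('a). (v \<bullet> h i (g y)) *\<^sub>R E i (g y))) (at y)"
      if "y \<in> V'" for y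
    proof -
      have "(g has_derivative D g y) (at y)"
        using g[of y, unfolded frechet_derivative_works] that by (auto simp: V'_def)
      moreover have "D g y = (\<lambda>v. \<Sum>i<DIM('a). (v \<bullet> h i (g y)) *\<^sub>R E i (g y))"
        using dg[OF that] by blast
      ultimately show ?thesis by metis
    qed
    ultimately show ?case by (intro Ck_on_SucI[OF oV])
  qed
  then have "smooth_on V' g" by (rule smooth_onI)
  then show "\<exists>T. open T \<and> y0 \<in> T \<and> smooth_on T g"
    using oV y0 T(2) by (intro exI[of _ V']) (auto simp: V'_def)
qed

text \<open>Composition with a linear isomorphism \<open>i\<close> turns \<open>f\<close> into a map
  of a space to itself, to which \<open>inverse_function_theorem\<close> applies. It yields a
  differentiable inverse, which \<open>smooth_on_inverse_function\<close> improves to a smooth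
  one.\<close>

theorem smooth_inverse_function_theorem:
  fixes f :: "'a::euclidean_space \<Rightarrow> 'b::euclidean_space"
  assumes dim: "DIM('a) = DIM('b)" and U: "open U" "smooth_on U f" "x0 \<in> U" and inj: "inj (D f x0)"
  obtains U' V g where "open U'" "U' \<subseteq> U" "x0 \<in> U'" "open V" "homeomorphism U' V f g" "smooth_on V g"
    "\<And>x. x \<in> U' \<Longrightarrow> inj (D f x)"
proof -
  obtain i :: "'b \<Rightarrow> 'a" and j where ij: "linear i" "linear j" "\<And>x. j (i x) = x" "\<And>y. i (j y) = y"
    using isomorphisms_UNIV_UNIV[OF dim[symmetric]] by metis
  define F where "F x = i (f x)" for x
  have smF: "smooth_on U F" unfolding F_def by (rule smooth_on_linear[OF U(1) ij(1) U(2)])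
  have DF: "D F x = (\<lambda>v. i (D f x v))" if "x \<in> U" for x
    unfolding F_def by (rule D_eq[OF bounded_linear.has_derivative[OF ij(1)[unfolded linear_conv_bounded_linear]
        smooth_on_has_derivative[OF U(2) that]]])
  have bl: "bounded_linear (D F x)" if "x \<in> U" for x
    using smooth_on_linear_D[OF smF that] by (simp add: linear_conv_bounded_linear)
  define F' where "F' x = Blinfun (D F x)" for x
  have F': "blinfun_apply (F' x) = D F x" if "x \<in> U" for x
    unfolding F'_def using bounded_linear_Blinfun_apply[OF bl[OF that]] .
  have der: "(F has_derivative blinfun_apply (F' x)) (at x)" if "x \<in> U" for x
    using smooth_on_has_derivative[OF smF that] F'[OF that] by simp
  have cont: "continuous_on U F'"
  proof (rule continuous_on_blinfun_componentwise)
    fix b :: 'a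
    show "continuous_on U (\<lambda>x. blinfun_apply (F' x) b)"
      using continuous_on_cong[of U U "\<lambda>x. blinfun_apply (F' x) b" "\<lambda>x. D F x b"] F'
        smooth_on_continuous[OF smooth_on_D[OF smF]] by auto
  qed
  have "inj i" using ij(3) by (metis injI)
  have linF: "linear (D F x0)" using smooth_on_linear_D[OF smF U(3)] .
  have "inj (D F x0)" using inj \<open>inj i\<close> by (auto simp: DF[OF U(3)] inj_def)
  then obtain k where k: "linear k" "k \<circ> D F x0 = id"
    using linear_injective_left_inverse linF by blast
  have "Blinfun k o\<^sub>L F' x0 = id_blinfun"
    using k bounded_linear_Blinfun_apply[of k] F'[OF U(3)]
    by (intro blinfun_eqI) (auto simp: linear_conv_bounded_linear o_def fun_eq_iff id_def)
  from inverse_function_theorem[OF U(1) der cont U(3) this]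
  obtain U' W g g' where *: "open U'" "U' \<subseteq> U" "x0 \<in> U'" "open W" "F x0 \<in> W" "homeomorphism U' W F g"
    "\<And>y. y \<in> W \<Longrightarrow> (g has_derivative (g' y)) (at y)"
    "\<And>y. y \<in> W \<Longrightarrow> bij (blinfun_apply (F'(g y)))" by metis
  define V where "V = i -` W"
  define h where "h y = g (i y)" for y
  have ci: "continuous_on UNIV i" "continuous_on A i" for A using ij(1) linear_continuous_on linear_conv_bounded_linear by blast+
  have oV: "open V" unfolding V_def using open_vimage[OF *(4) ci(1)] .
  note homD = *(6)[unfolded homeomorphism_def]
  have gF: "\<And>x. x \<in> U' \<Longrightarrow> g (F x) = x" "\<And>y. y \<in> W \<Longrightarrow> F (g y) = y" "F ` U' = W" "g ` W = U'"
    using homD by auto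
  have injD: "inj (D f x)" if "x \<in> U'" for x
  proof -
    have "bij (blinfun_apply (F'(g (F x))))" using *(8) gF(3) that by blast
    then have "inj (D F x)" using gF(1)[OF that] F' that *(2) by (auto simp: bij_def)
    moreover have "x \<in> U" using that *(2) by auto
    ultimately show ?thesis by (auto simp: DF inj_def)
  qed
  have fh: "f (h y) = y" if "y \<in> V" for y
    using gF(2)[of "i y"] that \<open>inj i\<close> by (auto simp: V_def h_def F_def inj_def)
  have hU: "h y \<in> U'" if "y \<in> V" for y using gF(4) that by (auto simp: V_def h_def)
  have hom: "homeomorphism U' V f h"
    unfolding homeomorphism_def
  proof (intro conjI ballI)
    show 1: "h (f x) = x" if "x \<in> U'" for x using gF(1)[OF that] by (simp add: h_def F_def)
    show "f (h y) = y" if "y \<in> V" for y by (rule fh[OF that])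
    have fV: "f x \<in> V" if "x \<in> U'" for x using gF(3) that by (auto simp: V_def F_def)
    show "f ` U' = V" using fV fh hU by (auto simp: image_iff) metis
    show "h ` V = U'" using fV hU 1 by (auto simp: image_iff) metis
    show "continuous_on U' f" using smooth_on_continuous[OF U(2)] *(2) continuous_on_subset by blast
    show "continuous_on V h" unfolding h_def
      using *(6) by (intro continuous_on_compose2[OF _ ci(2)]) (auto simp: homeomorphism_def V_def)
  qed
  have dh: "h differentiable (at y)" if "y \<in> V" for y
  proof -
    have "(i has_derivative i) (at y)"
      using ij(1) by (simp add: linear_conv_bounded_linear bounded_linear_imp_has_derivative)
    from has_derivative_compose[OF this *(7)[of "i y"]] show ?thesis
      using that unfolding h_def differentiable_def by (auto simp: V_def)
  qed
  have "smooth_on V h"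
    using smooth_on_inverse_function[OF *(1) smooth_on_subset[OF U(2) *(2)] injD oV hU fh dh] .
  then show ?thesis using that[OF *(1,2,3) oV hom] injD by blast
qed

section \<open>Bilinear expressions\<close>

lemma linear_D_param:
  fixes L :: "'a::euclidean_space \<Rightarrow> 'b::euclidean_space \<Rightarrow> 'c::euclidean_space"
  assumes "open S" "x \<in> S" "\<And>y. y \<in> S \<Longrightarrow> linear (L y)" "\<And>v. smooth_on S (\<lambda>y. L y v)"
  shows "linear (\<lambda>v. D (\<lambda>y. L y v) x u)"
proof (rule linearI)
  note d = smooth_on_has_derivative[OF assms(4) assms(2)]
  show "D (\<lambda>y. L y (v + w)) x u = D (\<lambda>y. L y v) x u + D (\<lambda>y. L y w) x u" for v w
    using D_cong[OF assms(1,2), of "\<lambda>y. L y (v + w)" "\<lambda>y. L y v + L y w"]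
      D_eq[OF has_derivative_add[OF d d]] linear_add[OF assms(3)] by simp
  show "D (\<lambda>y. L y (c *\<^sub>R v)) x u = c *\<^sub>R D (\<lambda>y. L y v) x u" for c v
    using D_cong[OF assms(1,2), of "\<lambda>y. L y (c *\<^sub>R v)" "\<lambda>y. c *\<^sub>R L y v"]
      D_eq[OF has_derivative_scaleR_right[OF d]] linear_scale[OF assms(3)] by simp
qed

lemma bilinearD:
  assumes "bilinear B" shows "linear (B u)" "linear (\<lambda>u. B u v)"
  using assms by (auto simp: bilinear_def)

lemma has_derivative_apply_bilinear:
  fixes B :: "'a::euclidean_space \<Rightarrow> 'b::euclidean_space \<Rightarrow> 'c::euclidean_space \<Rightarrow> 'd::euclidean_space"
  assumes S: "open S" "x \<in> S" and B: "\<And>y. y \<in> S \<Longrightarrow> bilinear (B y)"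
    and d: "\<And>u v. (\<lambda>y. B y u v) differentiable (at x)"
    and U: "U differentiable (at x)" and V: "V differentiable (at x)"
  shows "((\<lambda>y. B y (U y) (V y)) has_derivative
    (\<lambda>h. D (\<lambda>y. B y (U x) (V x)) x h + B x (D U x h) (V x) + B x (U x) (D V x h))) (at x)"
proof -
  have 1: "((\<lambda>y. B y u (V y)) has_derivative
    (\<lambda>h. D (\<lambda>y. B y u (V x)) x h + B x u (D V x h))) (at x)" for u
    by (rule has_derivative_apply_linear[OF S bilinearD(1)[OF B] d V])
  then have "(\<lambda>y. B y u (V y)) differentiable (at x)" for u unfolding differentiable_def by blast
  from has_derivative_apply_linear[where L="\<lambda>y u. B y u (V y)", OF S bilinearD(2)[OF B] this U]
  show ?thesis unfolding D_eq[OF 1] by (simp add: add.assoc add.left_commute add.commute)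
qed

section \<open>Parameter-dependent linear maps: continuity, bounds on compact sets,
  integrals\<close>

lemma continuous_on_apply_linear:
  fixes L :: "'z::topological_space \<Rightarrow> 'b::euclidean_space \<Rightarrow> 'c::real_normed_vector"
  assumes "\<And>z. z \<in> S \<Longrightarrow> linear (L z)" "\<And>u. continuous_on S (\<lambda>z. L z u)" "continuous_on S U"
  shows "continuous_on S (\<lambda>z. L z (U z))"
proof -
  have "continuous_on S (\<lambda>z. \<Sum>b\<in>Basis. (U z \<bullet> b) *\<^sub>R L z b)"
    by (intro continuous_intros assms)
  then show ?thesis
    by (rule continuous_on_eq) (rule linear_expand[OF assms(1), symmetric])
qed

lemma continuous_on_apply_bilinear:
  fixes B :: "'z::topological_space \<Rightarrow> 'b::euclidean_space \<Rightarrow> 'c::euclidean_space \<Rightarrow> 'd::real_normed_vector"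
  assumes "\<And>z. z \<in> S \<Longrightarrow> bilinear (B z)" "\<And>u v. continuous_on S (\<lambda>z. B z u v)"
    "continuous_on S U" "continuous_on S V"
  shows "continuous_on S (\<lambda>z. B z (U z) (V z))"
proof -
  have "continuous_on S (\<lambda>z. B z u (V z))" for u
    by (rule continuous_on_apply_linear[OF bilinearD(1)[OF assms(1)] assms(2,4)])
  then show ?thesis
    using continuous_on_apply_linear[where L="\<lambda>z u. B z u (V z)", OF bilinearD(2)[OF assms(1)] _ assms(3)] by blast
qed

lemma linear_bounded_on_compact:
  fixes L :: "'z::topological_space \<Rightarrow> 'b::euclidean_space \<Rightarrow> 'c::real_normed_vector"
  assumes "compact K" "\<And>z. z \<in> K \<Longrightarrow> linear (L z)" "\<And>u. continuous_on K (\<lambda>z. L z u)"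
  obtains C where "C \<ge> 0" "\<And>z u. z \<in> K \<Longrightarrow> norm (L z u) \<le> C * norm u"
proof -
  have "\<exists>c. \<forall>z\<in>K. norm (L z u) \<le> c" for u
    using compact_imp_bounded[OF compact_continuous_image[OF assms(3) assms(1)]]
    by (auto simp: bounded_iff)
  then obtain c where c: "\<And>u z. z \<in> K \<Longrightarrow> norm (L z u) \<le> c u" by metis
  show ?thesis
  proof (rule that[of "\<Sum>b\<in>Basis. \<bar>c b\<bar>"])
    show "norm (L z u) \<le> (\<Sum>b\<in>Basis. \<bar>c b\<bar>) * norm u" if "z \<in> K" for z u
    proof -
      have "norm (L z u) \<le> (\<Sum>b\<in>Basis. norm ((u \<bullet> b) *\<^sub>R L z b))"
        unfolding linear_expand[OF assms(2)[OF that], of u] by (rule norm_sum)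
      also have "\<dots> \<le> (\<Sum>b\<in>Basis. norm u * \<bar>c b\<bar>)"
        using c[OF that] Basis_le_norm by (intro sum_mono) (auto intro!: mult_mono order_trans[OF c[OF that]])
      finally show ?thesis by (simp add: sum_distrib_left mult.commute)
    qed
  qed (auto intro: sum_nonneg)
qed

lemma bilinear_bounded_on_compact:
  fixes B :: "'z::topological_space \<Rightarrow> 'b::euclidean_space \<Rightarrow> 'c::euclidean_space \<Rightarrow> 'd::real_normed_vector"
  assumes "compact K" "\<And>z. z \<in> K \<Longrightarrow> bilinear (B z)" "\<And>u v. continuous_on K (\<lambda>z. B z u v)"
  obtains C where "C \<ge> 0" "\<And>z u v. z \<in> K \<Longrightarrow> norm (B z u v) \<le> C * norm u * norm v"
proof -
  have "\<exists>C\<ge>0. \<forall>z v. z \<in> K \<longrightarrow> norm (B z u v) \<le> C * norm v" for u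
    by (rule linear_bounded_on_compact[of K "\<lambda>z. B z u"]) (use assms bilinearD in blast)+
  then obtain c where c: "\<And>u. c u \<ge> 0" "\<And>u z v. z \<in> K \<Longrightarrow> norm (B z u v) \<le> c u * norm v" by metis
  show ?thesis
  proof (rule that[of "\<Sum>b\<in>Basis. c b"])
    show "norm (B z u v) \<le> (\<Sum>b\<in>Basis. c b) * norm u * norm v" if "z \<in> K" for z u v
    proof -
      have "norm (B z u v) \<le> (\<Sum>b\<in>Basis. norm ((u \<bullet> b) *\<^sub>R B z b v))"
        unfolding linear_expand[OF bilinearD(2)[OF assms(2)[OF that]], of u] by (rule norm_sum)
      also have "\<dots> \<le> (\<Sum>b\<in>Basis. norm u * (c b * norm v))"
        using c(2)[OF that] Basis_le_norm by (intro sum_mono) (auto intro!: mult_mono)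
      finally show ?thesis by (simp add: sum_distrib_left sum_distrib_right mult.commute mult.left_commute)
    qed
  qed (auto intro: sum_nonneg c)
qed

text \<open>\<open>leibniz_rule\<close> wants the derivative continuous as a bounded linear map. In
  finite dimension this follows from continuity for each fixed direction \<open>h\<close>.\<close>

lemma leibniz_rule_unit_interval:
  fixes f :: "'a::euclidean_space \<Rightarrow> real \<Rightarrow> 'b::euclidean_space"
  assumes S: "open S" "convex S" "x0 \<in> S"
    and d: "\<And>x t. x \<in> S \<Longrightarrow> t \<in> {0..1} \<Longrightarrow> ((\<lambda>x. f x t) has_derivative f' x t) (at x)"
    and c: "\<And>h. continuous_on (S \<times> {0..1}) (\<lambda>(x, t). f' x t h)"
    and cf: "\<And>x. x \<in> S \<Longrightarrow> continuous_on {0..1} (f x)"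
  shows "((\<lambda>x. integral {0..1} (f x)) has_derivative (\<lambda>h. integral {0..1} (\<lambda>t. f' x0 t h))) (at x0)"
proof -
  define F where "F x t = Blinfun (f' x t)" for x t
  have F: "blinfun_apply (F x t) = f' x t" if "x \<in> S" "t \<in> {0..1}" for x t
    unfolding F_def using bounded_linear_Blinfun_apply has_derivative_bounded_linear[OF d[OF that]] by blast
  have cF: "continuous_on (S \<times> cbox 0 1) (\<lambda>(x, t). F x t)"
  proof (rule continuous_on_blinfun_componentwise)
    fix h :: 'a
    show "continuous_on (S \<times> cbox 0 1) (\<lambda>z. blinfun_apply (case z of (x, t) \<Rightarrow> F x t) h)"
      by (rule continuous_on_eq[OF c[of h, folded cbox_interval]]) (auto simp: F)
  qed
  have der: "((\<lambda>x. integral (cbox 0 1) (f x)) has_derivative integral (cbox 0 1) (F x0)) (at x0 within S)"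
  proof (rule leibniz_rule[OF _ _ cF S(3,2)])
    show "((\<lambda>x. f x t) has_derivative blinfun_apply (F x t)) (at x within S)" if "x \<in> S" "t \<in> cbox 0 1" for x t
      using d[of x t] F[of x t] that by (simp add: has_derivative_at_withinI)
    show "f x integrable_on cbox 0 1" if "x \<in> S" for x
      using cf[OF that] by (simp add: integrable_continuous_real)
  qed
  have "F x0 integrable_on {0..1}"
  proof (rule integrable_continuous_real)
    have "continuous_on {0..1} (\<lambda>t. case (x0, t) of (x, t) \<Rightarrow> F x t)"
      by (rule continuous_on_compose2[OF cF]) (auto intro!: continuous_intros simp: S)
    then show "continuous_on {0..1} (F x0)" by simp
  qed
  then have I: "integral {0..1} ((\<lambda>b. blinfun_apply b h) \<circ> F x0) = blinfun_apply (integral {0..1} (F x0)) h" for h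
    by (intro integral_linear blinfun.bounded_linear_left)
  have "blinfun_apply (integral {0..1} (F x0)) h = integral {0..1} (\<lambda>t. f' x0 t h)" for h
    unfolding I[symmetric] by (rule integral_cong) (simp add: F[OF S(3)])
  then have "blinfun_apply (integral {0..1} (F x0)) = (\<lambda>h. integral {0..1} (\<lambda>t. f' x0 t h))" by blast
  with der show ?thesis using at_within_open[OF S(3,1)] by simp
qed

lemma norm_sum_minus_suminf_le:
  fixes a :: "nat \<Rightarrow> 'a::banach"
  assumes "\<And>i. norm (a i) \<le> M * (1/2) ^ i"
  shows "summable a" "norm ((\<Sum>i<n. a i) - suminf a) \<le> 2 * M * (1/2) ^ n"
proof -
  have g: "summable (\<lambda>i. M * (1/2) ^ i :: real)" by (intro summable_mult summable_geometric) auto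
  show s: "summable a" using summable_comparison_test'[OF g, of 0] assms by auto
  have "(\<lambda>i. (1/2)^i :: real) sums 2" using geometric_sums[of "1/2::real"] by simp
  from sums_mult[OF this, of "M * (1/2)^n"]
  have m: "(\<lambda>i. M * (1/2) ^ (i + n)) sums (2 * M * (1/2)^n)"
    by (simp add: power_add mult_ac)
  have "(\<Sum>i<n. a i) - suminf a = - (\<Sum>i. a (i + n))"
    using suminf_split_initial_segment[OF s, of n] by simp
  also have "norm \<dots> \<le> (\<Sum>i. M * (1/2) ^ (i + n))"
    using assms m by (auto intro!: norm_suminf_le dest: sums_summable)
  finally show "norm ((\<Sum>i<n. a i) - suminf a) \<le> 2 * M * (1/2) ^ n" using m sums_unique by metis
qed

section \<open>Parallel sections of a flat connection\<close>

text \<open>The equation to be solved is \<open>D \<sigma> x u = \<Omega> x u (\<sigma> x)\<close>.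
  Differentiating it once more expresses the second derivative of a solution through \<Omega>, and
  \<open>flat\<close> says that this expression is symmetric in \<open>u\<close> and
  \<open>v\<close>: it is the integrability condition, i.e. vanishing curvature.\<close>

locale flat_connection =
  fixes O' :: "'e::euclidean_space set" and \<Omega> :: "'e \<Rightarrow> 'e \<Rightarrow> 's::euclidean_space \<Rightarrow> 's"
  assumes open_dom: "open O'"
    and bil: "\<And>x. x \<in> O' \<Longrightarrow> bilinear (\<Omega> x)"
    and sm: "\<And>u s. smooth_on O' (\<lambda>x. \<Omega> x u s)"
    and flat: "\<And>x u v s. x \<in> O' \<Longrightarrow>
      D (\<lambda>y. \<Omega> y v s) x u + \<Omega> x v (\<Omega> x u s) = D (\<lambda>y. \<Omega> y u s) x v + \<Omega> x u (\<Omega> x v s)"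
begin

abbreviation D\<Omega> where "D\<Omega> x h u s \<equiv> D (\<lambda>y. \<Omega> y u s) x h"

lemma lin: "x \<in> O' \<Longrightarrow> linear (\<Omega> x u)" "x \<in> O' \<Longrightarrow> linear (\<lambda>u. \<Omega> x u s)"
  using bil bilinearD by blast+

lemma bilinear_D\<Omega>: "x \<in> O' \<Longrightarrow> bilinear (D\<Omega> x h)"
  unfolding bilinear_def
  using linear_D_param[OF open_dom _ lin(1) sm] linear_D_param[where L="\<lambda>y u. \<Omega> y u s" for s, OF open_dom _ lin(2) sm]
  by blast

lemma linear_D\<Omega>: "x \<in> O' \<Longrightarrow> linear (\<lambda>h. D\<Omega> x h u s)"
  using smooth_on_linear_D[OF sm] by blast

definition pth :: "'e \<Rightarrow> 'e \<Rightarrow> real \<Rightarrow> 'e" where "pth x0 x t = x0 + t *\<^sub>R (x - x0)"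

text \<open>The equation integrated along the ray from \<open>x0\<close> to \<open>x\<close>. Its
  solution with value \<open>v0\<close> at \<open>x0\<close> is a fixed point of v0 +
  \<open>Iop x0\<close>.\<close>

definition Iop :: "'e \<Rightarrow> ('e \<Rightarrow> 's) \<Rightarrow> 'e \<Rightarrow> 's" where
  "Iop x0 s x = integral {0..1} (\<lambda>t. \<Omega> (pth x0 x t) (x - x0) (s (pth x0 x t)))"

text \<open>The derivative in \<open>x\<close>, in direction \<open>h\<close>, of the integrand of
  \<open>Iop\<close>. The factors \<open>t\<close> arise because the ray point
  \<open>pth x0 x t\<close> moves by \<open>t *\<^sub>R h\<close>.\<close>

definition dI :: "'e \<Rightarrow> ('e \<Rightarrow> 's) \<Rightarrow> 'e \<Rightarrow> 'e \<Rightarrow> real \<Rightarrow> 's" where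
  "dI x0 s x h t = t *\<^sub>R D\<Omega> (pth x0 x t) h (x - x0) (s (pth x0 x t)) + \<Omega> (pth x0 x t) h (s (pth x0 x t))
     + t *\<^sub>R \<Omega> (pth x0 x t) (x - x0) (D s (pth x0 x t) h)"

definition err :: "('e \<Rightarrow> 's) \<Rightarrow> 'e \<Rightarrow> 'e \<Rightarrow> 's" where "err s x h = D s x h - \<Omega> x h (s x)"

context
  fixes x0 r assumes sub: "ball x0 r \<subseteq> O'"
begin

abbreviation "B \<equiv> ball x0 r"

lemma pth_B: "x \<in> B \<Longrightarrow> t \<in> {0..1} \<Longrightarrow> pth x0 x t \<in> B"
  using convexD_alt[of B x0 x t] by (cases "B = {}") (auto simp: pth_def algebra_simps)

lemma pth_O: "x \<in> B \<Longrightarrow> t \<in> {0..1} \<Longrightarrow> pth x0 x t \<in> O'"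
  using pth_B sub by blast

lemma continuous_pth: "continuous_on A (\<lambda>(x, t). pth x0 x t)" 
  unfolding pth_def case_prod_beta by (intro continuous_intros)

lemma continuous_pth_t: "continuous_on A (pth x0 x)" 
  unfolding pth_def by (intro continuous_intros)

lemma continuous_D\<Omega>: "continuous_on O' (\<lambda>x. D\<Omega> x h u s)"
  by (rule smooth_on_continuous[OF smooth_on_D[OF sm]])

lemma C1D:
  assumes "Ck_on 1 s B"
  shows "x \<in> B \<Longrightarrow> (s has_derivative D s x) (at x)" "continuous_on B s" "continuous_on B (\<lambda>x. D s x h)"
    "x \<in> B \<Longrightarrow> linear (D s x)"
  using assms Ck_on_continuous[OF assms] linear_frechet_derivative[of s "at x"]
  by (auto simp: frechet_derivative_works[symmetric])

lemma continuous_comp_pth: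
  assumes "continuous_on B f"
  shows "continuous_on (B \<times> {0..1}) (\<lambda>z. f (pth x0 (fst z) (snd z)))"
  by (rule continuous_on_compose2[OF assms continuous_pth[unfolded case_prod_beta]]) (use pth_B in auto)

lemma continuous_dI:
  assumes s: "Ck_on 1 s B"
  shows "continuous_on (B \<times> {0..1}) (\<lambda>(x, t). dI x0 s x h t)"
proof -
  have *: "pth x0 (fst z) (snd z) \<in> O'" if "z \<in> B \<times> {0..1}" for z using that pth_O by auto
  let ?S = "B \<times> {0..1::real}" and ?p = "\<lambda>z::'e \<times> real. pth x0 (fst z) (snd z)"
  have cs: "continuous_on ?S (\<lambda>z. s (?p z))" by (rule continuous_comp_pth[OF C1D(2)[OF s]])
  have cd: "continuous_on ?S (\<lambda>z. D s (?p z) h)" by (rule continuous_comp_pth[OF C1D(3)[OF s]])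
  have c\<Omega>: "continuous_on ?S (\<lambda>z. \<Omega> (?p z) u v)" for u v
    by (rule continuous_comp_pth[OF continuous_on_subset[OF smooth_on_continuous[OF sm] sub]])
  have cD\<Omega>: "continuous_on ?S (\<lambda>z. D\<Omega> (?p z) h u v)" for u v
    by (rule continuous_comp_pth[OF continuous_on_subset[OF continuous_D\<Omega> sub]])
  have cv: "continuous_on ?S (\<lambda>z. fst z - x0)" by (intro continuous_intros)
  have 1: "continuous_on ?S (\<lambda>z. D\<Omega> (?p z) h (fst z - x0) (s (?p z)))"
    by (rule continuous_on_apply_bilinear[OF bilinear_D\<Omega>[OF *] cD\<Omega> cv cs])
  have 2: "continuous_on ?S (\<lambda>z. \<Omega> (?p z) h (s (?p z)))"
    by (rule continuous_on_apply_linear[OF lin(1)[OF *] c\<Omega> cs])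
  have 3: "continuous_on ?S (\<lambda>z. \<Omega> (?p z) (fst z - x0) (D s (?p z) h))"
    by (rule continuous_on_apply_bilinear[OF bil[OF *] c\<Omega> cv cd])
  show ?thesis
    unfolding dI_def case_prod_beta
    by (intro continuous_on_add continuous_on_scaleR continuous_on_snd continuous_on_id 1 2 3)
qed

lemma continuous_dI_t:
  assumes s: "Ck_on 1 s B" and x: "x \<in> B"
  shows "continuous_on {0..1} (dI x0 s x h)"
proof -
  have "continuous_on {0..1} (\<lambda>t. case (x, t) of (x, t) \<Rightarrow> dI x0 s x h t)"
    by (rule continuous_on_compose2[OF continuous_dI[OF s]]) (use x in \<open>auto intro!: continuous_intros\<close>)
  then show ?thesis by simp
qed

lemma continuous_I_t:
  assumes s: "continuous_on B s" and x: "x \<in> B"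
  shows "continuous_on {0..1} (\<lambda>t. \<Omega> (pth x0 x t) u (s (pth x0 x t)))"
proof (rule continuous_on_apply_linear[where L="\<lambda>t. \<Omega> (pth x0 x t) u"])
  show "continuous_on {0..1} (\<lambda>t. \<Omega> (pth x0 x t) u v)" for v
    by (rule continuous_on_compose2[OF smooth_on_continuous[OF sm] continuous_pth_t]) (use pth_O x in auto)
  show "continuous_on {0..1} (\<lambda>t. s (pth x0 x t))"
    by (rule continuous_on_compose2[OF s continuous_pth_t]) (use pth_B x in auto)
qed (use lin pth_O x in auto)

lemma Iop_derivative:
  assumes s: "Ck_on 1 s B" and x: "x \<in> B"
  shows "(Iop x0 s has_derivative (\<lambda>h. integral {0..1} (dI x0 s x h))) (at x)"
  unfolding Iop_def[abs_def]
proof (rule leibniz_rule_unit_interval[OF open_ball convex_ball x])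
  fix y t assume y: "y \<in> B" and t: "t \<in> {0..1::real}"
  have dp: "((\<lambda>y. pth x0 y t) has_derivative (\<lambda>h. t *\<^sub>R h)) (at y)"
    unfolding pth_def by (auto intro!: derivative_eq_intros)
  have d1: "((\<lambda>y. \<Omega> (pth x0 y t) u v) has_derivative (\<lambda>h. t *\<^sub>R D\<Omega> (pth x0 y t) h u v)) (at y)" for u v
    using has_derivative_compose[OF dp smooth_on_has_derivative[OF sm[of u v] pth_O[OF y t]]]
    by (simp add: linear_scale[OF linear_D\<Omega>[OF pth_O[OF y t]]])
  have d2: "((\<lambda>y. s (pth x0 y t)) has_derivative (\<lambda>h. t *\<^sub>R D s (pth x0 y t) h)) (at y)"
    using has_derivative_compose[OF dp C1D(1)[OF s pth_B[OF y t]]]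
    by (simp add: linear_scale[OF C1D(4)[OF s pth_B[OF y t]]])
  have d3: "((\<lambda>y. y - x0) has_derivative (\<lambda>h. h)) (at y)" by (auto intro!: derivative_eq_intros)
  have "((\<lambda>y. \<Omega> (pth x0 y t) (y - x0) (s (pth x0 y t))) has_derivative
    (\<lambda>h. D (\<lambda>z. \<Omega> (pth x0 z t) (y - x0) (s (pth x0 y t))) y h
       + \<Omega> (pth x0 y t) (D (\<lambda>y. y - x0) y h) (s (pth x0 y t))
       + \<Omega> (pth x0 y t) (y - x0) (D (\<lambda>y. s (pth x0 y t)) y h))) (at y)"
  proof (rule has_derivative_apply_bilinear[OF open_ball y])
    show "bilinear (\<Omega> (pth x0 z t))" if "z \<in> B" for z using bil pth_O[OF that t] by blast
  qed (use d1 d2 d3 in \<open>auto simp: differentiable_def\<close>)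
  then show "((\<lambda>y. \<Omega> (pth x0 y t) (y - x0) (s (pth x0 y t))) has_derivative (\<lambda>h. dI x0 s y h t)) (at y)"
    unfolding D_eq[OF d1] D_eq[OF d2] D_eq[OF d3] dI_def
    by (simp add: linear_scale[OF lin(1)[OF pth_O[OF y t]]])
next
  show "continuous_on (B \<times> {0..1}) (\<lambda>(x, t). dI x0 s x h t)" for h
    by (rule continuous_dI[OF s])
  show "continuous_on {0..1} (\<lambda>t. \<Omega> (pth x0 x t) (x - x0) (s (pth x0 x t)))" if "x \<in> B" for x
    by (rule continuous_I_t[OF C1D(2)[OF s] that])
qed

lemma Iop_C1:
  assumes s: "Ck_on 1 s B"
  shows "Ck_on 1 (Iop x0 s) B"
proof -
  have "continuous_on B (\<lambda>x. integral (cbox 0 1) (dI x0 s x h))" for h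
    using continuous_dI[OF s] by (intro integral_continuous_on_param) auto
  then show ?thesis
    using Ck_on_SucI[of B "Iop x0 s" "\<lambda>x h. integral {0..1} (dI x0 s x h)" 0] Iop_derivative[OF s] by auto
qed

lemma Iop_sum:
  fixes n :: nat
  assumes "\<And>i. i < n \<Longrightarrow> continuous_on B (s i)" "x \<in> B"
  shows "Iop x0 (\<lambda>y. \<Sum>i<n. s i y) x = (\<Sum>i<n. Iop x0 (s i) x)"
proof -
  have "Iop x0 (\<lambda>y. \<Sum>i<n. s i y) x = integral {0..1} (\<lambda>t. \<Sum>i<n. \<Omega> (pth x0 x t) (x - x0) (s i (pth x0 x t)))"
    unfolding Iop_def
    by (intro integral_cong) (use linear_sum[OF lin(1)[OF pth_O[OF assms(2)]]] in auto)
  also have "\<dots> = (\<Sum>i<n. Iop x0 (s i) x)"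
    unfolding Iop_def
    by (rule integral_sum) (auto intro!: integrable_continuous_real continuous_I_t assms)
  finally show ?thesis .
qed

text \<open>The term \<open>\<Omega> x h (s x)\<close> is the integral over [0,1] of the derivative
  of t \<Omega>(h) s along the ray. Subtracting it from the integral of \<open>dI\<close> leaves the
  antisymmetrized derivative of \<Omega>, which \<open>flat\<close> converts into products of
  \<Omega>; these complete the derivatives of \<open>s\<close> to values of \<open>err\<close>. The
  second claim provides the continuity for estimating the integral.\<close>

lemma Iop_err:
  assumes s: "Ck_on 1 s B" and x: "x \<in> B"
  shows "D (Iop x0 s) x h - \<Omega> x h (s x) = integral {0..1} (\<lambda>t. t *\<^sub>R
     (\<Omega> (pth x0 x t) (x - x0) (err s (pth x0 x t) h) - \<Omega> (pth x0 x t) h (err s (pth x0 x t) (x - x0))))"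
    (is "_ = integral _ ?J")
    and "continuous_on {0..1} (\<lambda>t. t *\<^sub>R
     (\<Omega> (pth x0 x t) (x - x0) (err s (pth x0 x t) h) - \<Omega> (pth x0 x t) h (err s (pth x0 x t) (x - x0))))"
proof -
  define v where "v = x - x0"
  let ?p = "pth x0 x"
  define \<phi> where "\<phi> t = t *\<^sub>R \<Omega> (?p t) h (s (?p t))" for t
  define \<phi>' where "\<phi>' t = \<Omega> (?p t) h (s (?p t)) + t *\<^sub>R (D\<Omega> (?p t) v h (s (?p t)) + \<Omega> (?p t) h (D s (?p t) v))" for t
  have der: "(\<phi> has_vector_derivative \<phi>' t) (at t within {0..1})" if t: "t \<in> {0..1}" for t
  proof -
    have pO: "?p t \<in> O'" and pB: "?p t \<in> B" using pth_O pth_B x t by auto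
    have dp: "(?p has_derivative (\<lambda>k. k *\<^sub>R v)) (at t)"
      unfolding pth_def v_def by (auto intro!: derivative_eq_intros)
    have "((\<lambda>z. \<Omega> z h (s z)) has_derivative (\<lambda>w. D (\<lambda>z. \<Omega> z h (s (?p t))) (?p t) w + \<Omega> (?p t) h (D s (?p t) w))) (at (?p t))"
    proof (rule has_derivative_apply_linear[OF open_ball pB])
      show "linear (\<Omega> z h)" if "z \<in> B" for z using lin that sub by blast
      show "(\<lambda>z. \<Omega> z h v) differentiable at (?p t)" for v
        using smooth_on_differentiable[OF sm pO] .
      show "s differentiable at (?p t)" using C1D(1)[OF s pB] by (auto simp: differentiable_def)
    qed
    from has_derivative_compose[OF dp this]
    have "((\<lambda>t. \<Omega> (?p t) h (s (?p t))) has_derivative (\<lambda>k. k *\<^sub>R (D\<Omega> (?p t) v h (s (?p t)) + \<Omega> (?p t) h (D s (?p t) v)))) (at t)"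
      by (simp add: linear_scale[OF linear_D\<Omega>[OF pO]] linear_scale[OF lin(1)[OF pO]] linear_scale[OF C1D(4)[OF s pB]] scaleR_add_right)
    then have "((\<lambda>t. \<Omega> (?p t) h (s (?p t))) has_vector_derivative (D\<Omega> (?p t) v h (s (?p t)) + \<Omega> (?p t) h (D s (?p t) v))) (at t)"
      by (simp add: has_vector_derivative_def)
    from has_vector_derivative_scaleR[OF DERIV_ident this]
    have "(\<phi> has_vector_derivative \<phi>' t) (at t)" unfolding \<phi>_def \<phi>'_def by (simp add: add.commute)
    then show ?thesis by (rule has_vector_derivative_at_within)
  qed
  have "(\<phi>' has_integral (\<phi> 1 - \<phi> 0)) {0..1}"
    by (rule fundamental_theorem_of_calculus) (use der in auto)
  then have I1: "(\<phi>' has_integral \<Omega> x h (s x)) {0..1}" by (simp add: \<phi>_def pth_def)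
  have I2: "(dI x0 s x h has_integral D (Iop x0 s) x h) {0..1}"
    unfolding D_eq[OF Iop_derivative[OF s x]]
    by (intro integrable_integral integrable_continuous_real continuous_dI_t s x)
  have eq: "dI x0 s x h t - \<phi>' t = ?J t" if t: "t \<in> {0..1}" for t
  proof -
    have pO: "?p t \<in> O'" using pth_O x t by auto
    have f: "D\<Omega> (?p t) h v (s (?p t)) - D\<Omega> (?p t) v h (s (?p t)) = \<Omega> (?p t) h (\<Omega> (?p t) v (s (?p t))) - \<Omega> (?p t) v (\<Omega> (?p t) h (s (?p t)))"
      using flat[OF pO, of v "s (?p t)" h] by (simp add: algebra_simps)
    have "dI x0 s x h t - \<phi>' t = t *\<^sub>R ((D\<Omega> (?p t) h v (s (?p t)) - D\<Omega> (?p t) v h (s (?p t)))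
       + \<Omega> (?p t) v (D s (?p t) h) - \<Omega> (?p t) h (D s (?p t) v))"
      by (simp add: dI_def \<phi>'_def v_def algebra_simps)
    also have "\<dots> = ?J t" unfolding f err_def v_def[symmetric]
      by (simp add: linear_diff[OF lin(1)[OF pO]] algebra_simps)
    finally show ?thesis .
  qed
  have "(?J has_integral (D (Iop x0 s) x h - \<Omega> x h (s x))) {0..1}"
    by (rule has_integral_eq[OF _ has_integral_diff[OF I2 I1]]) (use eq in auto)
  then show "D (Iop x0 s) x h - \<Omega> x h (s x) = integral {0..1} ?J" by (simp add: integral_unique)
  have cE: "continuous_on B (\<lambda>x. err s x w)" for w
    unfolding err_def
    by (rule continuous_on_diff[OF C1D(3)[OF s] continuous_on_apply_linear[where L="\<lambda>x. \<Omega> x w",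
      OF _ continuous_on_subset[OF smooth_on_continuous[OF sm] sub] C1D(2)[OF s]]])
      (use lin sub in auto)
  show "continuous_on {0..1} ?J"
    by (intro continuous_intros continuous_I_t[OF cE x])
qed

end

lemma trilinear_bound:
  assumes K: "compact K" "K \<subseteq> O'"
  obtains C where "C \<ge> 0" "\<And>x h u s. x \<in> K \<Longrightarrow> norm (D\<Omega> x h u s) \<le> C * norm h * norm u * norm s"
proof -
  have bl: "bilinear (\<lambda>h u. D\<Omega> x h u s)" if "x \<in> K" for x s
    using linear_D\<Omega>[of x] bilinearD(2)[OF bilinear_D\<Omega>[of x]] that K by (auto simp: bilinear_def)
  have "\<exists>C\<ge>0. \<forall>x h u. x \<in> K \<longrightarrow> norm (D\<Omega> x h u s) \<le> C * norm h * norm u" for s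
    by (rule bilinear_bounded_on_compact[OF K(1), of "\<lambda>x h u. D\<Omega> x h u s"])
      (use bl continuous_on_subset[OF smooth_on_continuous[OF smooth_on_D[OF sm]] K(2)] in blast)+
  then obtain c where c: "\<And>s. c s \<ge> 0" "\<And>s x h u. x \<in> K \<Longrightarrow> norm (D\<Omega> x h u s) \<le> c s * norm h * norm u"
    by metis
  show ?thesis
  proof (rule that[of "\<Sum>b\<in>Basis. c b"])
    show "norm (D\<Omega> x h u s) \<le> (\<Sum>b\<in>Basis. c b) * norm h * norm u * norm s" if x: "x \<in> K" for x h u s
    proof -
      have l: "linear (D\<Omega> x h u)" using bilinearD(1)[OF bilinear_D\<Omega>[of x]] x K by blast
      have "norm (D\<Omega> x h u s) \<le> (\<Sum>b\<in>Basis. norm ((s \<bullet> b) *\<^sub>R D\<Omega> x h u b))"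
        unfolding linear_expand[OF l, of s] by (rule norm_sum)
      also have "\<dots> \<le> (\<Sum>b\<in>Basis. norm s * (c b * norm h * norm u))"
        using c(2)[OF x] Basis_le_norm by (intro sum_mono) (auto intro!: mult_mono)
      also have "\<dots> = (\<Sum>b\<in>Basis. c b) * norm h * norm u * norm s"
        by (simp add: sum_distrib_left sum_distrib_right mult_ac)
      finally show ?thesis .
    qed
  qed (auto intro: sum_nonneg c)
qed

text \<open>The section is obtained by solving the equation along rays, as a Dyson series. By flatness, the
  defect \<open>err\<close> of the equation in the directions transverse to the rays satisfies the homogeneous integral
  equation \<open>Iop_err\<close>, which forces it to vanish in the limit.\<close>

theorem parallel_section_exists:
  assumes x0: "x0 \<in> O'"
  obtains r \<sigma> where "r > 0" "ball x0 r \<subseteq> O'" "smooth_on (ball x0 r) \<sigma>" "\<sigma> x0 = v0"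
    "\<And>x u. x \<in> ball x0 r \<Longrightarrow> D \<sigma> x u = \<Omega> x u (\<sigma> x)"
proof -
  obtain r0 where r0: "r0 > 0" "cball x0 r0 \<subseteq> O'" using open_dom x0 open_contains_cball by blast
  obtain K1 where K1: "K1 \<ge> 0" "\<And>x u s. x \<in> cball x0 r0 \<Longrightarrow> norm (\<Omega> x u s) \<le> K1 * norm u * norm s"
    by (rule bilinear_bounded_on_compact[of "cball x0 r0" \<Omega>])
      (use r0 bil continuous_on_subset[OF smooth_on_continuous[OF sm] r0(2)] in auto)
  obtain K2 where K2: "K2 \<ge> 0" "\<And>x h u s. x \<in> cball x0 r0 \<Longrightarrow> norm (D\<Omega> x h u s) \<le> K2 * norm h * norm u * norm s"
    using trilinear_bound[OF compact_cball r0(2)] by metis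
  \<comment> \<open>The summand 1 makes \<open>K\<close> positive, so that the radius below may
    divide by it.\<close>
  define K where "K = max K1 K2 + 1"
  have K: "K > 0" using K1 by (simp add: K_def)
  \<comment> \<open>With \<open>K * r \<le> 1/8\<close>, applying \<Omega> in the radial direction
    \<open>x - x0\<close> shrinks norms by the factor 1/8; \<open>r \<le> 1\<close> absorbs the
    factor \<open>norm (x - x0)\<close> in the derivative estimate.\<close>
  define r where "r = min r0 (min 1 (1 / (8 * K)))"
  have r: "r > 0" "r \<le> 1" "r \<le> 1 / (8 * K)" "r \<le> r0"
    using r0 K by (auto simp: r_def)
  then have r: "r > 0" "r \<le> 1" "K * r \<le> 1/8" "r \<le> r0"
    using K by (auto simp: field_simps)
  let ?B = "ball x0 r"
  have Bc: "x \<in> cball x0 r0" if "x \<in> ?B" for x using that r by auto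
  have sub: "?B \<subseteq> O'" using r0 Bc by blast
  have b\<Omega>: "norm (\<Omega> x u s) \<le> K * (norm u * norm s)" if "x \<in> ?B" for x u s
  proof -
    have "K1 * (norm u * norm s) \<le> K * (norm u * norm s)" by (rule mult_right_mono) (auto simp: K_def)
    then show ?thesis using K1(2)[OF Bc[OF that], of u s] by (simp add: mult.assoc)
  qed
  have bD\<Omega>: "norm (D\<Omega> x h u s) \<le> K * (norm h * norm u * norm s)" if "x \<in> ?B" for x h u s
  proof -
    have "K2 * (norm h * norm u * norm s) \<le> K * (norm h * norm u * norm s)" by (rule mult_right_mono) (auto simp: K_def)
    then show ?thesis using K2(2)[OF Bc[OF that], of u s h] by (simp add: mult.assoc)
  qed
  have b\<Omega>r: "norm (\<Omega> y (x - x0) s) \<le> 1/8 * c" if "y \<in> ?B" "x \<in> ?B" "norm s \<le> c" for y x s c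
  proof -
    have "norm (\<Omega> y (x - x0) s) \<le> K * (norm (x - x0) * norm s)" by (rule b\<Omega>[OF that(1)])
    also have "\<dots> \<le> K * (r * c)"
      using that K r by (intro mult_left_mono mult_mono) (auto simp: dist_norm norm_minus_commute)
    also have "\<dots> \<le> 1/8 * c" using mult_right_mono[OF r(3), of c] norm_ge_zero[of s] that(3) by (simp add: mult_ac)
    finally show ?thesis .
  qed
  note pB = pth_B[OF sub]
  define s where "s k = (Iop x0 ^^ k) (\<lambda>_. v0)" for k
  have s0: "s 0 = (\<lambda>_. v0)" and sS: "s (Suc k) = Iop x0 (s k)" for k by (simp_all add: s_def)
  have C1: "Ck_on 1 (s k) ?B" for k
  proof (induction k)
    case 0 then show ?case unfolding s0 by (rule Ck_on_const)
  next
    case (Suc k) then show ?case unfolding sS by (rule Iop_C1[OF sub])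
  qed
  note cs = C1D(2)[OF sub C1]
  define C where "C = norm v0"
  have C0: "C \<ge> 0" by (simp add: C_def)
  have bs: "norm (s k x) \<le> C * (1/2) ^ k" if "x \<in> ?B" for k x
    using that
  proof (induction k arbitrary: x)
    case 0 then show ?case by (simp add: s0 C_def)
  next
    case (Suc k)
    have "norm (s (Suc k) x) \<le> (1/8 * (C * (1/2) ^ k)) * (1 - 0)"
      unfolding sS Iop_def using Suc pB[OF Suc.prems]
      by (intro integral_bound continuous_I_t[OF sub cs] b\<Omega>r) auto
    also have "\<dots> \<le> C * (1/2) ^ Suc k" using C0 by (simp add: field_simps)
    finally show ?case .
  qed
  \<comment> \<open>The constant 8 cancels the 1/8 of \<open>b\<Omega>r\<close> in the term
    containing the previous derivative. Each of the three terms of \<open>dI\<close> is then at most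
    \<open>K * c * norm h\<close>, and 3 is below 4, half of 8.\<close>
  have bd: "norm (D (s k) x h) \<le> 8 * K * C * norm h * (1/2) ^ k" if "x \<in> ?B" for k x h
    using that
  proof (induction k arbitrary: x)
    case 0 then show ?case using K C0 by (simp add: s0)
  next
    case (Suc k)
    define c where "c = C * (1/2)^k"
    have c0: "c \<ge> 0" using C0 by (simp add: c_def)
    have "norm (dI x0 (s k) x h t) \<le> 4 * K * c * norm h" if t: "t \<in> {0..1}" for t
    proof -
      let ?p = "pth x0 x t"
      have p: "?p \<in> ?B" using pB[OF Suc.prems t] .
      have "norm (D\<Omega> ?p h (x - x0) (s k ?p)) \<le> K * (norm h * norm (x - x0) * norm (s k ?p))"
        by (rule bD\<Omega>[OF p])
      also have "\<dots> \<le> K * (norm h * 1 * c)"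
        using K r Suc.prems bs[OF p, of k] c0
        by (intro mult_left_mono mult_mono) (auto simp: dist_norm norm_minus_commute c_def)
      finally have 1: "norm (D\<Omega> ?p h (x - x0) (s k ?p)) \<le> K * c * norm h" by (simp add: mult_ac)
      have "norm (\<Omega> ?p h (s k ?p)) \<le> K * (norm h * norm (s k ?p))" by (rule b\<Omega>[OF p])
      also have "\<dots> \<le> K * (norm h * c)"
        using K bs[OF p, of k] by (intro mult_left_mono) (auto simp: c_def)
      finally have 2: "norm (\<Omega> ?p h (s k ?p)) \<le> K * c * norm h" by (simp add: mult_ac)
      have 3: "norm (\<Omega> ?p (x - x0) (D (s k) ?p h)) \<le> K * c * norm h"
        using b\<Omega>r[OF p Suc.prems Suc.IH[OF p]] by (simp add: c_def mult_ac)
      have "norm (dI x0 (s k) x h t) \<le> norm (t *\<^sub>R D\<Omega> ?p h (x - x0) (s k ?p)) + norm (\<Omega> ?p h (s k ?p))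
         + norm (t *\<^sub>R \<Omega> ?p (x - x0) (D (s k) ?p h))"
        unfolding dI_def by (intro norm_triangle_le add_right_mono norm_triangle_ineq)
      also have "\<dots> \<le> K * c * norm h + K * c * norm h + K * c * norm h"
      proof (intro add_mono 2)
        show "norm (t *\<^sub>R D\<Omega> ?p h (x - x0) (s k ?p)) \<le> K * c * norm h"
          using t 1 mult_left_le_one_le[of "norm (D\<Omega> ?p h (x - x0) (s k ?p))" t] by simp
        show "norm (t *\<^sub>R \<Omega> ?p (x - x0) (D (s k) ?p h)) \<le> K * c * norm h"
          using t 3 mult_left_le_one_le[of "norm (\<Omega> ?p (x - x0) (D (s k) ?p h))" t] by simp
      qed
      also have "\<dots> \<le> 4 * K * c * norm h" using K c0 by simp
      finally show ?thesis .
    qed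
    then have "norm (integral {0..1} (dI x0 (s k) x h)) \<le> (4 * K * c * norm h) * (1 - 0)"
      by (intro integral_bound continuous_dI_t[OF sub C1 Suc.prems]) auto
    then show ?case
      unfolding sS D_eq[OF Iop_derivative[OF sub C1 Suc.prems]] by (simp add: c_def mult_ac)
  qed
  define S where "S n x = (\<Sum>k<n. s k x)" for n x
  define \<sigma> where "\<sigma> x = (\<Sum>k. s k x)" for x
  define d\<sigma> where "d\<sigma> x h = (\<Sum>k. D (s k) x h)" for x h
  have bs': "norm (S n x - \<sigma> x) \<le> 2 * C * (1/2) ^ n" and sums: "summable (\<lambda>k. s k x)" if "x \<in> ?B" for n x
    using norm_sum_minus_suminf_le[of "\<lambda>k. s k x" C] bs[OF that] by (auto simp: S_def \<sigma>_def)
  have bd': "norm ((\<Sum>k<n. D (s k) x h) - d\<sigma> x h) \<le> 2 * (8 * K * C * norm h) * (1/2) ^ n" if "x \<in> ?B" for n x h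
    using norm_sum_minus_suminf_le[of "\<lambda>k. D (s k) x h" "8 * K * C * norm h"] bd[OF that] by (auto simp: d\<sigma>_def)
  have lim0: "(\<lambda>n. M * (1/2::real) ^ n) \<longlonglongrightarrow> 0" for M
    by (rule tendsto_mult_right_zero) (simp add: LIMSEQ_power_zero)
  have der: "(\<sigma> has_derivative d\<sigma> x) (at x)" if x: "x \<in> ?B" for x
  proof -
    have "\<exists>g. \<forall>x\<in>?B. (\<lambda>n. s n x) sums (g x) \<and> (g has_derivative d\<sigma> x) (at x within ?B)"
    proof (rule has_derivative_series[where f=s and f'="\<lambda>n. D (s n)", OF convex_ball])
      show "(s n has_derivative D (s n) x) (at x within ?B)" if "x \<in> ?B" for n x
        using C1D(1)[OF sub C1 that] has_derivative_at_withinI by blast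
      show "x0 \<in> ?B" using r by simp
      show "(\<lambda>n. s n x0) sums (\<sigma> x0)" using sums[of x0] r by (simp add: \<sigma>_def summable_sums)
      fix e :: real assume "e > 0"
      then have "\<forall>\<^sub>F n in sequentially. 2 * (8 * K * C) * (1/2) ^ n < e"
        using order_tendstoD(2)[OF lim0] by blast
      then show "\<forall>\<^sub>F n in sequentially. \<forall>x\<in>?B. \<forall>h. norm ((\<Sum>i<n. D (s i) x h) - d\<sigma> x h) \<le> e * norm h"
      proof eventually_elim
        case (elim n)
        show ?case
        proof (intro ballI allI)
          fix x h assume "x \<in> ?B"
          from bd'[OF this, of h n] have "norm ((\<Sum>i<n. D (s i) x h) - d\<sigma> x h) \<le> (2 * (8 * K * C) * (1/2) ^ n) * norm h"
            by (simp add: mult_ac)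
          also have "\<dots> \<le> e * norm h" using elim by (intro mult_right_mono) auto
          finally show "norm ((\<Sum>i<n. D (s i) x h) - d\<sigma> x h) \<le> e * norm h" .
        qed
      qed
    qed
    then obtain g where g: "\<And>x. x \<in> ?B \<Longrightarrow> (\<lambda>n. s n x) sums (g x)" "\<And>x. x \<in> ?B \<Longrightarrow> (g has_derivative d\<sigma> x) (at x within ?B)"
      by blast
    have "g y = \<sigma> y" if "y \<in> ?B" for y using g(1)[OF that] sums_unique by (auto simp: \<sigma>_def)
    then show ?thesis
      using has_derivative_transform_within_open[of g "d\<sigma> x" x UNIV ?B \<sigma>] g(2)[OF x] at_within_open[OF x open_ball] x
      by auto
  qed
  have S_C1: "Ck_on 1 (S n) ?B" for n
    unfolding S_def by (rule Ck_on_sum[OF open_ball C1])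
  have DS: "D (S n) x h = (\<Sum>k<n. D (s k) x h)" if "x \<in> ?B" for n x h
    unfolding S_def[abs_def] by (subst D_eq[OF has_derivative_sum[OF C1D(1)[OF sub C1 that]]]) simp
  \<comment> \<open>By this index shift the partial sums are Picard iterates, so
    \<open>Iop_err\<close> applies to them.\<close>
  have SS: "S (Suc n) x = v0 + Iop x0 (S n) x" if "x \<in> ?B" for n x
  proof -
    have "S (Suc n) x = v0 + (\<Sum>k<n. Iop x0 (s k) x)"
      unfolding S_def sum.lessThan_Suc_shift by (simp add: s0 sS)
    then show ?thesis using Iop_sum[OF sub _ that, where n=n and s=s, OF cs] by (simp add: S_def[abs_def])
  qed
  have DSS: "D (S (Suc n)) x h = D (Iop x0 (S n)) x h" if x: "x \<in> ?B" for n x h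
  proof -
    note d = Iop_derivative[OF sub S_C1 x, of n]
    have "D (\<lambda>y. v0 + Iop x0 (S n) y) x = D (Iop x0 (S n)) x"
      using D_eq[OF has_derivative_add[OF has_derivative_const d]] D_eq[OF d] by simp
    moreover have "D (S (Suc n)) x = D (\<lambda>y. v0 + Iop x0 (S n) y) x" by (rule D_cong[OF open_ball x SS])
    ultimately show ?thesis by simp
  qed
  \<comment> \<open>The constant 4 closes the recursion: the integral contributes at most c/4 by
    \<open>Iop_err\<close>, and the lag of one summand between \<open>S (Suc n)\<close> and
    \<open>S n\<close> another c/4, which together halve the bound.\<close>
  have err: "norm (err (S n) x h) \<le> 4 * K * C * norm h * (1/2) ^ n" if "x \<in> ?B" for n x h
    using that
  proof (induction n arbitrary: x h)
    case 0
    have "linear (\<Omega> x h)" using lin sub 0 by blast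
    then show ?case using K C0 by (simp add: err_def S_def linear_0)
  next
    case (Suc n)
    define c where "c = 4 * K * C * norm h * (1/2) ^ n"
    have c0: "c \<ge> 0" using K C0 by (simp add: c_def)
    let ?J = "\<lambda>t. t *\<^sub>R (\<Omega> (pth x0 x t) (x - x0) (err (S n) (pth x0 x t) h)
       - \<Omega> (pth x0 x t) h (err (S n) (pth x0 x t) (x - x0)))"
    have "norm (?J t) \<le> 1/4 * c" if t: "t \<in> {0..1}" for t
    proof -
      let ?p = "pth x0 x t"
      have p: "?p \<in> ?B" using pB[OF Suc.prems t] .
      have 1: "norm (\<Omega> ?p (x - x0) (err (S n) ?p h)) \<le> 1/8 * c"
        unfolding c_def by (rule b\<Omega>r[OF p Suc.prems Suc.IH[OF p]])
      have "norm (\<Omega> ?p h (err (S n) ?p (x - x0))) \<le> K * (norm h * norm (err (S n) ?p (x - x0)))"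
        by (rule b\<Omega>[OF p])
      also have "\<dots> \<le> K * (norm h * (4 * K * C * r * (1/2) ^ n))"
      proof (intro mult_left_mono order_trans[OF Suc.IH[OF p]] mult_right_mono)
        show "norm (x - x0) \<le> r" using Suc.prems by (simp add: dist_norm norm_minus_commute)
      qed (use K C0 in auto)
      also have "\<dots> = (K * r) * c" by (simp add: c_def mult_ac)
      also have "\<dots> \<le> 1/8 * c" by (rule mult_right_mono[OF r(3) c0])
      finally have 2: "norm (\<Omega> ?p h (err (S n) ?p (x - x0))) \<le> 1/8 * c" .
      have "norm (?J t) \<le> norm (\<Omega> ?p (x - x0) (err (S n) ?p h) - \<Omega> ?p h (err (S n) ?p (x - x0)))"
        using t mult_left_le_one_le[of "norm (\<Omega> ?p (x - x0) (err (S n) ?p h) - \<Omega> ?p h (err (S n) ?p (x - x0)))" t]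
        by simp
      also have "\<dots> \<le> 1/8 * c + 1/8 * c" by (intro norm_triangle_le_diff add_mono 1 2)
      finally show ?thesis by simp
    qed
    then have "norm (integral {0..1} ?J) \<le> (1/4 * c) * (1 - 0)"
      by (intro integral_bound Iop_err(2)[OF sub S_C1 Suc.prems]) auto
    moreover have "err (S (Suc n)) x h = integral {0..1} ?J - \<Omega> x h (s n x)"
    proof -
      have "linear (\<Omega> x h)" using lin sub Suc.prems by blast
      moreover have "S (Suc n) x = S n x + s n x" by (simp add: S_def)
      ultimately show ?thesis
        using Iop_err(1)[OF sub S_C1 Suc.prems, of n h] DSS[OF Suc.prems, of n h]
        by (simp add: err_def linear_add algebra_simps)
    qed
    moreover have "norm (\<Omega> x h (s n x)) \<le> 1/4 * c"
    proof -
      have "norm (\<Omega> x h (s n x)) \<le> K * (norm h * norm (s n x))" by (rule b\<Omega>[OF Suc.prems])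
      also have "\<dots> \<le> K * (norm h * (C * (1/2) ^ n))"
        using K bs[OF Suc.prems] by (intro mult_left_mono) auto
      finally show ?thesis by (simp add: c_def mult_ac)
    qed
    ultimately have "norm (err (S (Suc n)) x h) \<le> 1/4 * c + 1/4 * c"
      by (metis (no_types, lifting) add_mono diff_zero mult.right_neutral norm_triangle_le_diff)
    then show ?case by (simp add: c_def)
  qed
  have eq: "d\<sigma> x h = \<Omega> x h (\<sigma> x)" if x: "x \<in> ?B" for x h
  proof -
    have l: "linear (\<Omega> x h)" using lin sub x by blast
    have "(\<lambda>n. S n x - \<sigma> x) \<longlonglongrightarrow> 0" by (rule Lim_null_comparison[OF _ lim0[of "2 * C"]]) (use bs'[OF x] in auto)
    then have "(\<lambda>n. S n x) \<longlonglongrightarrow> \<sigma> x" using LIM_zero_iff by blast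
    then have 1: "(\<lambda>n. \<Omega> x h (S n x)) \<longlonglongrightarrow> \<Omega> x h (\<sigma> x)"
      using bounded_linear.tendsto[of "\<Omega> x h"] l by (auto simp: linear_conv_bounded_linear)
    have "(\<lambda>n. D (S n) x h - d\<sigma> x h) \<longlonglongrightarrow> 0"
      by (rule Lim_null_comparison[OF _ lim0[of "2 * (8 * K * C * norm h)"]]) (use bd'[OF x] DS[OF x] in auto)
    then have "(\<lambda>n. D (S n) x h) \<longlonglongrightarrow> d\<sigma> x h" using LIM_zero_iff by blast
    from tendsto_diff[OF this 1] have "(\<lambda>n. err (S n) x h) \<longlonglongrightarrow> d\<sigma> x h - \<Omega> x h (\<sigma> x)"
      by (simp add: err_def)
    moreover have "(\<lambda>n. err (S n) x h) \<longlonglongrightarrow> 0"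
      by (rule Lim_null_comparison[OF _ lim0[of "4 * K * C * norm h"]]) (use err[OF x] in auto)
    ultimately show ?thesis using LIMSEQ_unique by fastforce
  qed
  have D\<sigma>: "D \<sigma> x h = \<Omega> x h (\<sigma> x)" if "x \<in> ?B" for x h
    using D_eq[OF der[OF that]] eq[OF that] by simp
  \<comment> \<open>Bootstrapping: the equation expresses the derivative of \<sigma> through
    \<sigma>, so every order gives one more.\<close>
  have "Ck_on k \<sigma> ?B" for k
  proof (induction k)
    case 0
    show ?case using der by (auto intro!: continuous_at_imp_continuous_on has_derivative_continuous)
  next
    case (Suc k)
    have "Ck_on k (\<lambda>x. \<Sum>b\<in>Basis. (\<sigma> x \<bullet> b) *\<^sub>R \<Omega> x h b) ?B" for h
      by (intro Ck_on_sum open_ball Ck_on_bounded_bilinear[OF open_ball bounded_bilinear_scaleR]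
        Ck_on_bounded_linear[OF open_ball Suc bounded_linear_inner_left] Ck_on_subset[OF smooth_onD[OF sm] sub])
    then have "Ck_on k (\<lambda>x. \<Omega> x h (\<sigma> x)) ?B" for h
      by (rule Ck_on_cong[OF open_ball, rotated]) (rule linear_expand[symmetric], use lin sub in blast)
    then have "Ck_on k (\<lambda>x. d\<sigma> x h) ?B" for h
      by (rule Ck_on_cong[OF open_ball, rotated]) (simp add: eq)
    with der show ?case by (rule Ck_on_SucI[OF open_ball])
  qed
  then have "smooth_on ?B \<sigma>" by (rule smooth_onI)
  moreover have "\<sigma> x0 = v0"
  proof -
    \<comment> \<open>The ray from \<open>x0\<close> to itself is constant, so only the zeroth term
      of the series survives there.\<close>
    have z: "s (Suc k) x0 = 0" for k
    proof -
      have "\<Omega> x0 0 u = 0" for u using linear_0[OF lin(2)[OF x0]] .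
      then show ?thesis by (simp add: sS Iop_def pth_def)
    qed
    have "s k x0 = 0" if "k \<notin> {0}" for k using z[of "k - 1"] that by simp
    then have "\<sigma> x0 = (\<Sum>k\<in>{0}. s k x0)" unfolding \<sigma>_def by (intro suminf_finite) auto
    then show ?thesis by (simp add: s0)
  qed
  ultimately show ?thesis using that[OF r(1) sub] D\<sigma> by blast
qed

end

section \<open>The exterior derivative of a 1-form\<close>

text \<open>The vectors \<open>u\<close>, \<open>v\<close> stand for constant fields; their bracket
  is zero, which removes the third term of the invariant formula.\<close>

definition dform :: "('e::euclidean_space \<Rightarrow> 'e \<Rightarrow> real) \<Rightarrow> 'e \<Rightarrow> 'e \<Rightarrow> 'e \<Rightarrow> real" where
  "dform \<alpha> x u v = D (\<lambda>y. \<alpha> y v) x u - D (\<lambda>y. \<alpha> y u) x v"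

lemma dform_cong:
  assumes "open S" "x \<in> S" "\<And>y u. y \<in> S \<Longrightarrow> \<alpha> y u = \<beta> y u"
  shows "dform \<alpha> x u v = dform \<beta> x u v"
  using D_cong[OF assms(1,2), of "\<lambda>y. \<alpha> y v" "\<lambda>y. \<beta> y v"] D_cong[OF assms(1,2), of "\<lambda>y. \<alpha> y u" "\<lambda>y. \<beta> y u"] assms(3)
  by (simp add: dform_def)

lemma dform_mult:
  assumes "open S" "x \<in> S" "smooth_on S f" "\<And>u. smooth_on S (\<lambda>y. \<alpha> y u)"
  shows "dform (\<lambda>y u. f y * \<alpha> y u) x u v = D f x u * \<alpha> x v - D f x v * \<alpha> x u + f x * dform \<alpha> x u v"
proof -
  note d = has_derivative_mult[OF smooth_on_has_derivative[OF assms(3,2)] smooth_on_has_derivative[OF assms(4,2)]]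
  show ?thesis unfolding dform_def D_eq[OF d] by (simp add: algebra_simps)
qed

lemma dform_minus:
  assumes "x \<in> S" "\<And>u. smooth_on S (\<lambda>y. \<alpha> y u)"
  shows "dform (\<lambda>y u. - \<alpha> y u) x u v = - dform \<alpha> x u v"
  unfolding dform_def D_eq[OF has_derivative_minus[OF smooth_on_has_derivative[OF assms(2,1)]]] by simp

text \<open>Pullback commutes with d: the terms with second derivatives of \<open>p\<close> cancel
  by symmetry.\<close>

lemma dform_pullback:
  fixes p :: "'a::euclidean_space \<Rightarrow> 'b::euclidean_space"
  assumes S: "open S" "x \<in> S" "smooth_on S p" and T: "open T" "p ` S \<subseteq> T"
    and \<alpha>: "\<And>y. y \<in> T \<Longrightarrow> linear (\<alpha> y)" "\<And>u. smooth_on T (\<lambda>y. \<alpha> y u)"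
  shows "dform (\<lambda>y u. \<alpha> (p y) (D p y u)) x u v = dform \<alpha> (p x) (D p x u) (D p x v)"
proof -
  have 1: "smooth_on S (\<lambda>y. \<alpha> (p y) w)" for w
    by (rule smooth_on_compose[OF S(1) T(1) S(3) \<alpha>(2) T(2)])
  have px: "p x \<in> T" using S(2) T(2) by blast
  have "D (\<lambda>y. \<alpha> (p y) (D p y v)) x u = D (\<lambda>y. \<alpha> y (D p x v)) (p x) (D p x u) + \<alpha> (p x) (D (\<lambda>y. D p y v) x u)" for u v
  proof -
    have "((\<lambda>y. \<alpha> (p y) (D p y v)) has_derivative
      (\<lambda>u. D (\<lambda>y. \<alpha> (p y) (D p x v)) x u + \<alpha> (p x) (D (\<lambda>y. D p y v) x u))) (at x)"
      by (rule has_derivative_apply_linear[where L="\<lambda>y. \<alpha> (p y)", OF S(1,2) _ smooth_on_differentiable[OF 1 S(2)]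
         smooth_on_differentiable[OF smooth_on_D[OF S(3)] S(2)]]) (use T(2) \<alpha>(1) in blast)
    note e = D_eq[OF this]
    have h: "((\<lambda>y. \<alpha> (p y) w) has_derivative (\<lambda>u. D (\<lambda>y. \<alpha> y w) (p x) (D p x u))) (at x)" for w
      by (rule has_derivative_compose[OF smooth_on_has_derivative[OF S(3,2)] smooth_on_has_derivative[OF \<alpha>(2) px]])
    show ?thesis unfolding e D_eq[OF h] ..
  qed
  then show ?thesis
    unfolding dform_def using second_derivative_symmetric[OF S(1,3,2), of u v] by simp
qed

section \<open>The Levi-Civita connection\<close>

locale coord_metric =
  fixes S :: "'e::euclidean_space set" and G :: "'e \<Rightarrow> 'e \<Rightarrow> 'e \<Rightarrow> real"
  assumes M: "metric_on S G"
begin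

lemmas openS = metric_onD(1)[OF M]
lemmas bilG = metric_onD(2)[OF M]
lemmas symG = metric_onD(3)[OF M]
lemmas smG = metric_onD(5)[OF M]
lemmas Gs = metric_on_simps[OF M]
lemmas G_eqI = metric_on_eqI[OF M]

abbreviation \<Gamma> where "\<Gamma> \<equiv> christoffel G"

lemma linear_DG: "x \<in> S \<Longrightarrow> linear (\<lambda>w. D (\<lambda>y. G y v w) x u)"
  "x \<in> S \<Longrightarrow> linear (\<lambda>v. D (\<lambda>y. G y v w) x u)"  "x \<in> S \<Longrightarrow> linear (D (\<lambda>y. G y v w) x)"
  using linear_D_param[where L="\<lambda>y. G y v", OF openS _ metric_onD(6)[OF M] smG]
    linear_D_param[where L="\<lambda>y v. G y v w", OF openS _ metric_onD(7)[OF M] smG]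
    smooth_on_linear_D[OF smG] by blast+

lemma sym_DG: "x \<in> S \<Longrightarrow> D (\<lambda>y. G y v w) x = D (\<lambda>y. G y w v) x"
  by (rule D_cong[OF openS]) (auto simp: symG)

text \<open>The Koszul expression is linear in \<open>u\<close>, so the definite description in
  \<open>christoffel\<close> is attained by nondegeneracy of the metric.\<close>

lemma christoffel:
  assumes x: "x \<in> S"
  shows "G x (\<Gamma> x v w) u =
    (D (\<lambda>y. G y w u) x v + D (\<lambda>y. G y v u) x w - D (\<lambda>y. G y v w) x u) / 2"
proof -
  let ?\<alpha> = "\<lambda>u. (D (\<lambda>y. G y w u) x v + D (\<lambda>y. G y v u) x w - D (\<lambda>y. G y v w) x u) / 2"
  have "linear ?\<alpha>"
    by (rule linearI)
      (simp_all add: linear_add[OF linear_DG(1)[OF x]] linear_add[OF linear_DG(3)[OF x]]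
        linear_scale[OF linear_DG(1)[OF x]] linear_scale[OF linear_DG(3)[OF x]] algebra_simps add_divide_distrib diff_divide_distrib)
  from theI'[OF metric_on_sharp_exists[OF M x this]] show ?thesis
    unfolding christoffel_def by blast
qed

lemma christoffel_sym:
  assumes x: "x \<in> S" shows "\<Gamma> x v w = \<Gamma> x w v"
  by (rule G_eqI[OF x]) (simp add: christoffel[OF x] sym_DG[OF x, of v w] add.commute)

lemma linear_christoffel:
  assumes x: "x \<in> S" shows "linear (\<Gamma> x v)" "linear (\<lambda>v. \<Gamma> x v w)"
proof -
  show *: "linear (\<Gamma> x v)" for v
  proof (rule linearI)
    show "\<Gamma> x v (a + b) = \<Gamma> x v a + \<Gamma> x v b" for a b
      by (rule G_eqI[OF x])
        (simp add: christoffel[OF x] Gs[OF x] linear_add[OF linear_DG(1)[OF x]] linear_add[OF linear_DG(2)[OF x]]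
          linear_add[OF linear_DG(3)[OF x]] add_divide_distrib diff_divide_distrib)
    show "\<Gamma> x v (c *\<^sub>R b) = c *\<^sub>R \<Gamma> x v b" for c b
      by (rule G_eqI[OF x])
        (simp add: christoffel[OF x] Gs[OF x] linear_scale[OF linear_DG(1)[OF x]] linear_scale[OF linear_DG(2)[OF x]]
          linear_scale[OF linear_DG(3)[OF x]] algebra_simps add_divide_distrib diff_divide_distrib)
  qed
  show "linear (\<lambda>v. \<Gamma> x v w)" using *[of w] by (simp add: christoffel_sym[OF x, of _ w])
qed

lemmas \<Gamma>s = linear_add[OF linear_christoffel(1)] linear_add[OF linear_christoffel(2)]
  linear_scale[OF linear_christoffel(1)] linear_scale[OF linear_christoffel(2)]

lemma smooth_christoffel: "smooth_on S (\<lambda>x. \<Gamma> x v w)"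
proof (rule smooth_on_sharp[OF M])
  show "G x (\<Gamma> x v w) u = (D (\<lambda>y. G y w u) x v + D (\<lambda>y. G y v u) x w - D (\<lambda>y. G y v w) x u) * (1/2)"
    if "x \<in> S" for x u using christoffel[OF that] by simp
  show "smooth_on S (\<lambda>x. (D (\<lambda>y. G y w u) x v + D (\<lambda>y. G y v u) x w - D (\<lambda>y. G y v w) x u) * (1/2))" for u
    by (intro smooth_on_mult smooth_on_add smooth_on_diff smooth_on_const smooth_on_D smG openS)
qed

text \<open>Metric compatibility: in the sum of the two Koszul expressions all but one derivative of
  the metric cancel.\<close>

lemma DG: "x \<in> S \<Longrightarrow> D (\<lambda>y. G y v w) x u = G x (\<Gamma> x u v) w + G x v (\<Gamma> x u w)"
  unfolding symG[of x v "\<Gamma> x u w"] by (simp add: christoffel sym_DG[of x w v] field_simps)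

lemma smooth_cov_deriv:
  assumes "open T" "T \<subseteq> S" "smooth_on T X"
  shows "smooth_on T (\<lambda>x. cov_deriv G X x u)"
  unfolding cov_deriv_def
  by (rule smooth_on_add[OF assms(1) smooth_on_D[OF assms(3)] smooth_on_apply_linear[where L="\<lambda>x. \<Gamma> x u",
    OF assms(1) _ smooth_on_subset[OF smooth_christoffel assms(2)] assms(3)]])
    (use linear_christoffel assms(2) in blast)

lemma linear_cov_deriv: "x \<in> S \<Longrightarrow> X differentiable (at x) \<Longrightarrow> linear (cov_deriv G X x)"
  unfolding cov_deriv_def[abs_def]
  by (intro linear_compose_add linear_frechet_derivative linear_christoffel)

lemma G_derivative:
  assumes x: "x \<in> S" and X: "X differentiable (at x)" "Y differentiable (at x)"
  shows "((\<lambda>y. G y (X y) (Y y)) has_derivative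
    (\<lambda>u. G x (cov_deriv G X x u) (Y x) + G x (X x) (cov_deriv G Y x u))) (at x)"
proof -
  note d = has_derivative_apply_bilinear[where B=G, OF openS x bilG smooth_on_differentiable[OF smG x] X]
  show ?thesis using d by (simp add: DG[OF x] cov_deriv_def Gs[OF x] algebra_simps)
qed

section \<open>Curvature\<close>

lemma curvature_christoffel:
  "curvature G x u v w = D (\<lambda>y. \<Gamma> y v w) x u - D (\<lambda>y. \<Gamma> y u w) x v + \<Gamma> x u (\<Gamma> x v w) - \<Gamma> x v (\<Gamma> x u w)"
  by (simp add: curvature_def cov_deriv_def)

lemma curvature_skew: "curvature G x u v w = - curvature G x v u w"
  by (simp add: curvature_def)

lemma linear_D\<Gamma>: "x \<in> S \<Longrightarrow> linear (\<lambda>w. D (\<lambda>y. \<Gamma> y v w) x u)"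
  "x \<in> S \<Longrightarrow> linear (\<lambda>v. D (\<lambda>y. \<Gamma> y v w) x u)" "x \<in> S \<Longrightarrow> linear (D (\<lambda>y. \<Gamma> y v w) x)"
  using linear_D_param[where L="\<lambda>y. \<Gamma> y v", OF openS _ linear_christoffel(1) smooth_christoffel]
    linear_D_param[where L="\<lambda>y v. \<Gamma> y v w", OF openS _ linear_christoffel(2) smooth_christoffel]
    smooth_on_linear_D[OF smooth_christoffel] by blast+

lemma linear_curvature:
  assumes x: "x \<in> S"
  shows "linear (curvature G x u v)" "linear (\<lambda>u. curvature G x u v w)" "linear (\<lambda>v. curvature G x u v w)"
proof -
  note a = linear_add[OF linear_D\<Gamma>(1)[OF x]] linear_add[OF linear_D\<Gamma>(2)[OF x]] linear_add[OF linear_D\<Gamma>(3)[OF x]]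
    linear_scale[OF linear_D\<Gamma>(1)[OF x]] linear_scale[OF linear_D\<Gamma>(2)[OF x]] linear_scale[OF linear_D\<Gamma>(3)[OF x]] \<Gamma>s[OF x]
  show "linear (curvature G x u v)"
    by (rule linearI) (simp_all add: curvature_christoffel a algebra_simps)
  show *: "linear (\<lambda>u. curvature G x u v w)" for v
    by (rule linearI) (simp_all add: curvature_christoffel a algebra_simps)
  show "linear (\<lambda>v. curvature G x u v w)"
    using linear_compose_neg[OF *[of u]] by (simp add: curvature_skew[of x u])
qed

lemma curvature_bianchi:
  assumes x: "x \<in> S"
  shows "curvature G x u v w + curvature G x v w u + curvature G x w u v = 0"
proof -
  have "D (\<lambda>y. \<Gamma> y a b) x = D (\<lambda>y. \<Gamma> y b a) x" for a b
    by (rule D_cong[OF openS x]) (rule christoffel_sym)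
  then show ?thesis
    by (simp add: curvature_christoffel christoffel_sym[OF x, of w v] christoffel_sym[OF x, of u v]
      christoffel_sym[OF x, of u w] algebra_simps)
qed

text \<open>\<open>curvature\<close> is defined through constant fields. For a variable field
  \<open>Z\<close>, its second derivatives cancel by symmetry and its first derivatives cancel in
  pairs, so the commutator is tensorial in \<open>Z\<close>. This makes it applicable to frame
  fields.\<close>

lemma curvature_field:
  assumes T: "open T" "x \<in> T" "T \<subseteq> S" and Z: "smooth_on T Z"
  shows "curvature G x u v (Z x) =
    cov_deriv G (\<lambda>y. cov_deriv G Z y v) x u - cov_deriv G (\<lambda>y. cov_deriv G Z y u) x v"
proof -
  have x: "x \<in> S" using T by blast
  have "D (\<lambda>y. cov_deriv G Z y v) x u =
    D (\<lambda>y. D Z y v) x u + (D (\<lambda>y. \<Gamma> y v (Z x)) x u + \<Gamma> x v (D Z x u))" for u v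
  proof -
    have l: "linear (\<Gamma> y v)" if "y \<in> T" for y using linear_christoffel that T by blast
    have d: "(\<lambda>y. \<Gamma> y v w) differentiable at x" for w by (rule smooth_on_differentiable[OF smooth_christoffel x])
    have "((\<lambda>y. D Z y v + \<Gamma> y v (Z y)) has_derivative
      (\<lambda>u. D (\<lambda>y. D Z y v) x u + (D (\<lambda>y. \<Gamma> y v (Z x)) x u + \<Gamma> x v (D Z x u)))) (at x)"
      by (rule has_derivative_add[OF smooth_on_has_derivative[OF smooth_on_D[OF Z] T(2)]
        has_derivative_apply_linear[where L="\<lambda>y. \<Gamma> y v", OF T(1,2) l d smooth_on_differentiable[OF Z T(2)]]])
    then show ?thesis unfolding cov_deriv_def using D_eq by fastforce
  qed
  note d = this
  show ?thesis
    unfolding cov_deriv_def[of G "\<lambda>y. cov_deriv G Z y v" for v] d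
    using second_derivative_symmetric[OF T(1) Z T(2), of u v]
    by (simp add: curvature_christoffel cov_deriv_def \<Gamma>s[OF x] christoffel_sym[OF x, of v "D Z x u"] christoffel_sym[OF x, of u "D Z x v"])
qed

section \<open>Connection forms of an orthonormal frame\<close>

context
  fixes T n and E :: "nat \<Rightarrow> 'e \<Rightarrow> 'e"
  assumes T: "open T" "T \<subseteq> S" and n: "n = DIM('e)" and F: "frame_on T G n E"
begin

definition \<theta> :: "nat \<Rightarrow> 'e \<Rightarrow> 'e \<Rightarrow> real" where "\<theta> i x u = G x u (E i x)"
definition \<omega> :: "nat \<Rightarrow> nat \<Rightarrow> 'e \<Rightarrow> 'e \<Rightarrow> real" where "\<omega> i j x u = G x (cov_deriv G (E i) x u) (E j x)"

lemma frameT: "x \<in> T \<Longrightarrow> i < n \<Longrightarrow> j < n \<Longrightarrow> G x (E i x) (E j x) = (if i = j then 1 else 0)"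
  using F by (auto simp: frame_on_def)

lemma frame_smooth: "i < n \<Longrightarrow> smooth_on T (E i)"
  using F by (auto simp: frame_on_def)

lemma frame_diff: "x \<in> T \<Longrightarrow> i < n \<Longrightarrow> E i differentiable (at x)"
  using smooth_on_differentiable[OF frame_smooth] by blast

lemma frame_expand: "x \<in> T \<Longrightarrow> v = (\<Sum>i<n. \<theta> i x v *\<^sub>R E i x)"
  unfolding \<theta>_def n by (rule frame_on_expand[OF metric_on_subset[OF M T] F[unfolded n]])

lemma frame_expand_G:
  assumes x: "x \<in> T"
  shows "G x v w = (\<Sum>i<n. \<theta> i x v * \<theta> i x w)"
proof -
  have xS: "x \<in> S" using x T by blast
  have "G x v w = G x v (\<Sum>i<n. \<theta> i x w *\<^sub>R E i x)" using frame_expand[OF x, of w] by simp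
  then show ?thesis by (simp add: Gs[OF xS] \<theta>_def mult.commute)
qed

lemma linear_\<theta>: "x \<in> T \<Longrightarrow> linear (\<theta> i x)"
  unfolding \<theta>_def using metric_onD(7)[OF M] T by blast

lemma linear_\<omega>: "x \<in> T \<Longrightarrow> i < n \<Longrightarrow> linear (\<omega> i j x)"
  unfolding \<omega>_def
  using linear_compose[OF linear_cov_deriv[of x "E i"] metric_onD(7)[OF M, of x "E j x"]] T frame_diff[of x i]
  by (auto simp: o_def)

lemma smooth_\<theta>: "i < n \<Longrightarrow> smooth_on T (\<lambda>x. \<theta> i x u)"
  unfolding \<theta>_def by (rule smooth_on_metric[OF M T(2,1) smooth_on_const frame_smooth])

lemma smooth_\<omega>: "i < n \<Longrightarrow> j < n \<Longrightarrow> smooth_on T (\<lambda>x. \<omega> i j x u)"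
  unfolding \<omega>_def by (rule smooth_on_metric[OF M T(2,1) smooth_cov_deriv[OF T frame_smooth] frame_smooth])

lemma \<theta>_frame: "x \<in> T \<Longrightarrow> i < n \<Longrightarrow> j < n \<Longrightarrow> \<theta> i x (E j x) = (if i = j then 1 else 0)"
  using frameT by (simp add: \<theta>_def)

lemma \<omega>_skew:
  assumes x: "x \<in> T" and ij: "i < n" "j < n"
  shows "\<omega> i j x u = - \<omega> j i x u"
proof -
  have xS: "x \<in> S" using x T by blast
  have "((\<lambda>y. if i = j then 1 else 0::real) has_derivative
     (\<lambda>u. G x (cov_deriv G (E i) x u) (E j x) + G x (E i x) (cov_deriv G (E j) x u))) (at x)"
    by (rule has_derivative_transform_within_open[OF G_derivative[OF xS frame_diff frame_diff] T(1)])
      (use x ij frameT in auto)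
  from has_derivative_unique[OF this has_derivative_const]
  have "G x (cov_deriv G (E i) x u) (E j x) + G x (E i x) (cov_deriv G (E j) x u) = 0" by metis
  then show ?thesis using symG[OF xS] by (simp add: \<omega>_def)
qed

lemma cov_deriv_frame:
  assumes x: "x \<in> T" shows "G x (cov_deriv G (E i) x u) v = (\<Sum>j<n. \<omega> i j x u * \<theta> j x v)"
  using frame_expand_G[OF x, of "cov_deriv G (E i) x u" v] by (simp add: \<omega>_def \<theta>_def)

text \<open>Metric compatibility produces a Christoffel term, which is symmetric in the two
  arguments since there is no torsion and drops out of the exterior derivative.\<close>

lemma first_structure_equation:
  assumes x: "x \<in> T" and i: "i < n"
  shows "dform (\<theta> i) x u v = (\<Sum>j<n. \<omega> i j x u * \<theta> j x v - \<omega> i j x v * \<theta> j x u)"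
proof -
  have xS: "x \<in> S" using x T by blast
  have "D (\<lambda>y. \<theta> i y v) x u = G x (\<Gamma> x u v) (E i x) + G x v (cov_deriv G (E i) x u)" for u v
    using D_eq[OF G_derivative[OF xS differentiable_const frame_diff[OF x i], of v]]
    by (simp add: \<theta>_def cov_deriv_def[of G "\<lambda>_. v"])
  then show ?thesis
    unfolding dform_def sum_subtractf cov_deriv_frame[OF x, symmetric]
    by (simp add: christoffel_sym[OF xS, of u v] symG[OF xS, of v] symG[OF xS, of u])
qed

text \<open>Differentiating \<open>\<omega> i j y v\<close> by metric compatibility gives a second
  covariant derivative plus the inner product of the covariant derivatives of \<open>E i\<close> and
  \<open>E j\<close>. The first antisymmetrizes to the curvature; the second, expanded in the frame,
  is the quadratic sum.\<close>

lemma second_structure_equation: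
  assumes x: "x \<in> T" and ij: "i < n" "j < n"
  shows "G x (curvature G x u v (E i x)) (E j x) = dform (\<omega> i j) x u v -
    (\<Sum>k<n. \<omega> i k x v * \<omega> j k x u - \<omega> i k x u * \<omega> j k x v)"
proof -
  have xS: "x \<in> S" using x T by blast
  have d: "D (\<lambda>y. \<omega> i j y v) x u = G x (cov_deriv G (\<lambda>y. cov_deriv G (E i) y v) x u) (E j x)
     + (\<Sum>k<n. \<omega> i k x v * \<omega> j k x u)" for u v
  proof -
    have "D (\<lambda>y. \<omega> i j y v) x u = G x (cov_deriv G (\<lambda>y. cov_deriv G (E i) y v) x u) (E j x)
      + G x (cov_deriv G (E i) x v) (cov_deriv G (E j) x u)"
      unfolding \<omega>_def
      by (simp add: D_eq[OF G_derivative[OF xS smooth_on_differentiable[OF smooth_cov_deriv[OF T frame_smooth[OF ij(1)]] x] frame_diff[OF x ij(2)]]])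
    then show ?thesis unfolding cov_deriv_frame[OF x] by (simp add: \<omega>_def \<theta>_def)
  qed
  show ?thesis
    unfolding curvature_field[OF T(1) x T(2) frame_smooth[OF ij(1)]] dform_def d
    by (simp add: Gs[OF xS] sum_subtractf)
qed

text \<open>Independence of the trace from the basis: the curvature vector is expanded in the frame
  and the two sums are exchanged.\<close>

lemma ricci_frame:
  assumes x: "x \<in> T"
  shows "ricci G x v w = (\<Sum>i<n. G x (curvature G x (E i x) v w) (E i x))"
proof -
  have xS: "x \<in> S" using x T by blast
  note l = linear_curvature(2)[OF xS, of v w]
  have "ricci G x v w = (\<Sum>b\<in>Basis. \<Sum>i<n. \<theta> i x (curvature G x b v w) * (E i x \<bullet> b))"
    unfolding ricci_def
  proof (rule sum.cong)
    fix b :: 'e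
    have "curvature G x b v w \<bullet> b = (\<Sum>i<n. \<theta> i x (curvature G x b v w) *\<^sub>R E i x) \<bullet> b"
      using frame_expand[OF x, of "curvature G x b v w"] by simp
    then show "curvature G x b v w \<bullet> b = (\<Sum>i<n. \<theta> i x (curvature G x b v w) * (E i x \<bullet> b))"
      by (simp add: inner_sum_left)
  qed simp
  also have "\<dots> = (\<Sum>i<n. \<Sum>b\<in>Basis. \<theta> i x (curvature G x b v w) * (E i x \<bullet> b))" by (rule sum.swap)
  also have "\<dots> = (\<Sum>i<n. \<theta> i x (curvature G x (E i x) v w))"
  proof (rule sum.cong)
    fix i
    have "\<theta> i x (curvature G x (E i x) v w) = \<theta> i x (\<Sum>b\<in>Basis. (E i x \<bullet> b) *\<^sub>R curvature G x b v w)"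
      using linear_expand[OF l, of "E i x"] by simp
    then show "(\<Sum>b\<in>Basis. \<theta> i x (curvature G x b v w) * (E i x \<bullet> b)) = \<theta> i x (curvature G x (E i x) v w)"
      by (simp add: linear_sum[OF linear_\<theta>[OF x]] linear_scale[OF linear_\<theta>[OF x]] mult.commute)
  qed simp
  finally show ?thesis by (simp add: \<theta>_def)
qed

end
end

lemma sum4: "(\<Sum>k<(4::nat). f k) = f 0 + f 1 + f 2 + f 3"
  by (simp add: eval_nat_numeral add.assoc)

lemma sum2: "(\<Sum>k<(2::nat). f k) = f 0 + f 1"
  by (simp add: eval_nat_numeral)

section \<open>Surfaces of constant curvature\<close>

context coord_metric
begin

text \<open>Inherited from the skewness of \<omega> through the second structure equation, with no
  second derivatives of the metric.\<close>

lemma curvature_form_skew: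
  assumes T: "open T" "T \<subseteq> S" and n: "n = DIM('e)" and F: "frame_on T G n E" and x: "x \<in> T" and ij: "i < n" "j < n"
  shows "G x (curvature G x u v (E i x)) (E j x) = - G x (curvature G x u v (E j x)) (E i x)"
proof -
  have "dform (\<omega> E i j) x u v = dform (\<lambda>y u. - \<omega> E j i y u) x u v"
    by (rule dform_cong[OF T(1) x]) (rule \<omega>_skew[OF T n F _ ij])
  also have "\<dots> = - dform (\<omega> E j i) x u v"
    by (rule dform_minus[OF x smooth_\<omega>[OF T n F ij(2,1)]])
  finally have d: "dform (\<omega> E i j) x u v = - dform (\<omega> E j i) x u v" .
  show ?thesis
    unfolding second_structure_equation[OF T n F x ij] second_structure_equation[OF T n F x ij(2,1)] d
    by (simp add: sum_subtractf mult.commute)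
qed

text \<open>For two indices each quadratic term contains a factor \<open>\<omega> E 0 0\<close> or
  \<open>\<omega> E 1 1\<close>, and these vanish by skewness.\<close>

lemma curvature_form_surface:
  assumes T: "open T" "T \<subseteq> S" and n: "2 = DIM('e)" and F: "frame_on T G 2 E" and x: "x \<in> T"
  shows "G x (curvature G x u v (E 0 x)) (E 1 x) = dform (\<omega> E 0 1) x u v"
proof -
  have "\<omega> E i i x w = 0" if "i < 2" for i w using \<omega>_skew[OF T n F x that that, of w] by simp
  then show ?thesis
    using second_structure_equation[OF T n F x, of 0 1 u v] by (simp add: sum2)
qed

text \<open>Let \<open>d\<close> be the oriented area of \<open>v\<close>, \<open>w\<close> in the
  frame. The denominator is its square, and the numerator is c times its square; the minus sign in
  \<open>K\<close> disappears because the curvature form pairs the image of \<open>E 0\<close> with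
  \<open>E 1\<close>, in the opposite order to the numerator. Independence makes \<open>d\<close>
  nonzero.\<close>

lemma sectional_curvature_surface:
  assumes T: "open T" "T \<subseteq> S" and n: "2 = DIM('e)" and F: "frame_on T G 2 E" and x: "x \<in> T"
    and K: "\<And>u v. dform (\<omega> E 0 1) x u v = - c * (\<theta> E 0 x u * \<theta> E 1 x v - \<theta> E 0 x v * \<theta> E 1 x u)"
    and ind: "v \<noteq> w" "independent {v, w}"
  shows "sectional_curvature G x v w = c"
proof -
  have xS: "x \<in> S" using x T by blast
  define a where "a i = \<theta> E i x v" for i
  define b where "b i = \<theta> E i x w" for i
  define d where "d = a 0 * b 1 - b 0 * a 1"
  have w: "w = (\<Sum>i<2. b i *\<^sub>R E i x)" and v: "v = (\<Sum>i<2. a i *\<^sub>R E i x)"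
    unfolding a_def b_def using frame_expand[OF T n F x] by blast+
  have s: "G x (curvature G x v w (E i x)) (E i x) = 0" if "i < 2" for i
    using curvature_form_skew[OF T n F x that that, of v w] by simp
  have one2: "(1::nat) < 2" by simp
  have K1: "G x (curvature G x v w (E 0 x)) (E 1 x) = - c * d"
    unfolding curvature_form_surface[OF T n F x] K by (simp add: a_def b_def d_def)
  then have K2: "G x (curvature G x v w (E 1 x)) (E 0 x) = c * d"
    using curvature_form_skew[OF T n F x, of 0 1 v w] by simp
  have "curvature G x v w w = (\<Sum>i<2. b i *\<^sub>R curvature G x v w (E i x))"
    using linear_sum[OF linear_curvature(1)[OF xS, of v w], of "\<lambda>i. b i *\<^sub>R E i x" "{..<2}"]
      linear_scale[OF linear_curvature(1)[OF xS, of v w]] w by simp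
  then have c1: "G x (curvature G x v w w) z = (\<Sum>i<2. b i * G x (curvature G x v w (E i x)) z)" for z
    by (simp add: Gs[OF xS])
  have c2: "G x z v = (\<Sum>j<2. a j * G x z (E j x))" for z
    using arg_cong[OF v, of "G x z"] by (simp add: Gs[OF xS])
  have "G x (curvature G x v w w) v = (\<Sum>i<2. b i * (\<Sum>j<2. a j * G x (curvature G x v w (E i x)) (E j x)))"
    unfolding c1[of v] unfolding c2 ..
  also have "\<dots> = c * d\<^sup>2"
    unfolding sum2 s[OF zero_less_numeral] s[OF one2] K1 K2 d_def
    by (simp add: power2_eq_square algebra_simps)
  finally have num: "G x (curvature G x v w w) v = c * d\<^sup>2" .
  have den: "G x v v * G x w w - (G x v w)\<^sup>2 = d\<^sup>2"
    unfolding frame_expand_G[OF T n F x] a_def[symmetric] b_def[symmetric] sum2 d_def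
    by (simp add: power2_eq_square algebra_simps)
  have "d \<noteq> 0"
  proof
    assume d: "d = 0"
    have "w \<noteq> 0" using ind dependent_zero by blast
    then have "b 0 \<noteq> 0 \<or> b 1 \<noteq> 0" using w by (auto simp: sum2)
    then obtain k where "v = k *\<^sub>R w"
    proof
      assume b0: "b 0 \<noteq> 0"
      then have "a 1 = (a 0 / b 0) * b 1" using d by (simp add: d_def field_simps)
      then have "v = (a 0 / b 0) *\<^sub>R w" using b0 v w by (simp add: sum2 scaleR_add_right)
      then show ?thesis using that by blast
    next
      assume b0: "b 1 \<noteq> 0"
      then have "a 0 = (a 1 / b 1) * b 0" using d by (simp add: d_def field_simps)
      then have "v = (a 1 / b 1) *\<^sub>R w" using b0 v w by (simp add: sum2 scaleR_add_right)
      then show ?thesis using that by blast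
    qed
    then have "v \<in> span {w}" by (metis span_base span_scale singletonI)
    then show False using ind by (simp add: independent_insert)
  qed
  then show ?thesis unfolding sectional_curvature_def num den by simp
qed

end

section \<open>Developing maps\<close>

text \<open>\<open>cc_metric c\<close> is the metric of curvature \<open>c\<close> in the coordinates \<open>f\<^sub>1, f\<^sub>2\<close> given by the linear
  functions \<open>x\<^sub>1, x\<^sub>2\<close> on the quadric \<open>x\<^sub>0\<^sup>2 + c (x\<^sub>1\<^sup>2 + x\<^sub>2\<^sup>2) = 1\<close>.\<close>

definition cc_metric :: "real \<Rightarrow> real \<times> real \<Rightarrow> real \<times> real \<Rightarrow> real" where
  "cc_metric c f v = ((1 - c * (snd f)\<^sup>2) * (fst v)\<^sup>2 + 2 * c * fst f * snd f * fst v * snd v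
     + (1 - c * (fst f)\<^sup>2) * (snd v)\<^sup>2) / (1 - c * ((fst f)\<^sup>2 + (snd f)\<^sup>2))"

text \<open>Here (t, s) is to be recovered from its images under the two rows (a1, b1), (a2, b2).
  Cramer's rule shows that its squared length depends on the rows only through their Gram matrix
  \<open>P\<close>, \<open>R\<close>, \<open>Q\<close>, which the hypotheses express by f1 and f2;
  the determinant becomes the denominator of \<open>cc_metric\<close>.\<close>

lemma cc_metric_eq:
  fixes a1 a2 b1 b2 f1 f2 c t s :: real
  assumes "a1 * a1 + b1 * b1 = 1 - c * f1 * f1" "a2 * a2 + b2 * b2 = 1 - c * f2 * f2"
    "a1 * a2 + b1 * b2 = - c * f1 * f2" and nz: "1 - c * (f1\<^sup>2 + f2\<^sup>2) \<noteq> 0"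
  shows "t\<^sup>2 + s\<^sup>2 = cc_metric c (f1, f2) (a1 * t + b1 * s, a2 * t + b2 * s)"
proof -
  define P where "P = a1 * a1 + b1 * b1"
  define Q where "Q = a2 * a2 + b2 * b2"
  define R where "R = a1 * a2 + b1 * b2"
  have 1: "P = 1 - c * f1\<^sup>2" "Q = 1 - c * f2\<^sup>2" "R = - c * f1 * f2"
    using assms by (simp_all add: P_def Q_def R_def power2_eq_square mult.assoc)
  have 2: "P * Q - R * R = 1 - c * (f1\<^sup>2 + f2\<^sup>2)"
    unfolding 1 by (simp add: power2_eq_square algebra_simps)
  have "(t\<^sup>2 + s\<^sup>2) * (P * Q - R * R) =
    Q * (a1 * t + b1 * s)\<^sup>2 - 2 * R * (a1 * t + b1 * s) * (a2 * t + b2 * s) + P * (a2 * t + b2 * s)\<^sup>2"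
    unfolding P_def Q_def R_def by algebra
  then have "(t\<^sup>2 + s\<^sup>2) * (1 - c * (f1\<^sup>2 + f2\<^sup>2)) = (1 - c * f2\<^sup>2) * (a1 * t + b1 * s)\<^sup>2
     + 2 * c * f1 * f2 * (a1 * t + b1 * s) * (a2 * t + b2 * s) + (1 - c * f1\<^sup>2) * (a2 * t + b2 * s)\<^sup>2"
    unfolding 2 unfolding 1 by simp
  then show ?thesis using nz unfolding cc_metric_def fst_conv snd_conv by (metis nonzero_eq_divide_eq)
qed

text \<open>The three hypotheses on d are exactly what makes \<Omega> flat, and pointwise
  independence of \<theta> and \<eta> is not involved. The lemma thus serves both the base, where
  the forms are a coframe, and the vertical forms on the total space.\<close>

lemma developing_map:
  fixes \<theta> \<eta> \<omega> :: "'e::euclidean_space \<Rightarrow> 'e \<Rightarrow> real"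
  assumes S: "open S" "x0 \<in> S"
    and lin: "\<And>x. x \<in> S \<Longrightarrow> linear (\<theta> x)" "\<And>x. x \<in> S \<Longrightarrow> linear (\<eta> x)" "\<And>x. x \<in> S \<Longrightarrow> linear (\<omega> x)"
    and sm: "\<And>u. smooth_on S (\<lambda>x. \<theta> x u)" "\<And>u. smooth_on S (\<lambda>x. \<eta> x u)" "\<And>u. smooth_on S (\<lambda>x. \<omega> x u)"
    and d\<theta>: "\<And>x u v. x \<in> S \<Longrightarrow> dform \<theta> x u v = \<omega> x u * \<eta> x v - \<omega> x v * \<eta> x u"
    and d\<eta>: "\<And>x u v. x \<in> S \<Longrightarrow> dform \<eta> x u v = \<omega> x v * \<theta> x u - \<omega> x u * \<theta> x v"
    and d\<omega>: "\<And>x u v. x \<in> S \<Longrightarrow> dform \<omega> x u v = - c * (\<theta> x u * \<eta> x v - \<theta> x v * \<eta> x u)"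
  obtains W F where "open W" "x0 \<in> W" "W \<subseteq> S" "smooth_on W F" "F x0 = (0, 0)"
    "\<And>x u. x \<in> W \<Longrightarrow> (\<theta> x u)\<^sup>2 + (\<eta> x u)\<^sup>2 = cc_metric c (F x) (D F x u)"
proof -
  define \<Omega> :: "'e \<Rightarrow> 'e \<Rightarrow> real \<times> real \<times> real \<Rightarrow> real \<times> real \<times> real" where
    "\<Omega> x u s = (fst (snd s) * \<theta> x u + snd (snd s) * \<eta> x u,
       snd (snd s) * \<omega> x u - c * fst s * \<theta> x u, - (fst (snd s) * \<omega> x u) - c * fst s * \<eta> x u)" for x u s
  interpret flat_connection S \<Omega>
  proof
    show "open S" by fact
    show "bilinear (\<Omega> x)" if x: "x \<in> S" for x
      unfolding bilinear_def
    proof (intro conjI allI)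
      show "linear (\<Omega> x u)" for u
        by (rule linearI) (simp_all add: \<Omega>_def algebra_simps)
      show "linear (\<lambda>u. \<Omega> x u s)" for s
        by (rule linearI) (simp_all add: \<Omega>_def algebra_simps linear_add[OF lin(1)[OF x]] linear_add[OF lin(2)[OF x]]
          linear_add[OF lin(3)[OF x]] linear_scale[OF lin(1)[OF x]] linear_scale[OF lin(2)[OF x]] linear_scale[OF lin(3)[OF x]])
    qed
    show "smooth_on S (\<lambda>x. \<Omega> x u s)" for u s
      unfolding \<Omega>_def
      by (intro smooth_on_Pair smooth_on_add smooth_on_diff smooth_on_minus smooth_on_mult smooth_on_const sm S(1))
    fix x u v and s :: "real \<times> real \<times> real"
    assume x: "x \<in> S"
    note h = smooth_on_has_derivative[OF sm(1) x] smooth_on_has_derivative[OF sm(2) x] smooth_on_has_derivative[OF sm(3) x]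
    have "((\<lambda>y. \<Omega> y v s) has_derivative (\<lambda>u. (fst (snd s) * D (\<lambda>y. \<theta> y v) x u + snd (snd s) * D (\<lambda>y. \<eta> y v) x u,
       snd (snd s) * D (\<lambda>y. \<omega> y v) x u - c * fst s * D (\<lambda>y. \<theta> y v) x u, - (fst (snd s) * D (\<lambda>y. \<omega> y v) x u) - c * fst s * D (\<lambda>y. \<eta> y v) x u))) (at x)" for v
      unfolding \<Omega>_def
      by (intro has_derivative_Pair has_derivative_add has_derivative_diff has_derivative_minus has_derivative_mult_right h)
    note e = D_eq[OF this]
    have f: "D (\<lambda>y. \<theta> y v) x u = D (\<lambda>y. \<theta> y u) x v + (\<omega> x u * \<eta> x v - \<omega> x v * \<eta> x u)"
       "D (\<lambda>y. \<eta> y v) x u = D (\<lambda>y. \<eta> y u) x v + (\<omega> x v * \<theta> x u - \<omega> x u * \<theta> x v)"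
       "D (\<lambda>y. \<omega> y v) x u = D (\<lambda>y. \<omega> y u) x v - c * (\<theta> x u * \<eta> x v - \<theta> x v * \<eta> x u)"
      using d\<theta>[OF x, of u v] d\<eta>[OF x, of u v] d\<omega>[OF x, of u v] by (simp_all add: dform_def)
    show "D (\<lambda>y. \<Omega> y v s) x u + \<Omega> x v (\<Omega> x u s) = D (\<lambda>y. \<Omega> y u s) x v + \<Omega> x u (\<Omega> x v s)"
      unfolding e f by (simp add: \<Omega>_def algebra_simps)
  qed
  \<comment> \<open>A section is a triple (f, a, b). The two initial values make F vanish at
    \<open>x0\<close> with differential (\<theta>, \<eta>) there.\<close>
  obtain r1 s1 where 1: "r1 > 0" "ball x0 r1 \<subseteq> S" "smooth_on (ball x0 r1) s1" "s1 x0 = (0, 1, 0)"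
    "\<And>x u. x \<in> ball x0 r1 \<Longrightarrow> D s1 x u = \<Omega> x u (s1 x)"
    using parallel_section_exists[OF S(2), of "(0,1,0)"] by blast
  obtain r2 s2 where 2: "r2 > 0" "ball x0 r2 \<subseteq> S" "smooth_on (ball x0 r2) s2" "s2 x0 = (0, 0, 1)"
    "\<And>x u. x \<in> ball x0 r2 \<Longrightarrow> D s2 x u = \<Omega> x u (s2 x)"
    using parallel_section_exists[OF S(2), of "(0,0,1)"] by blast
  define r where "r = min r1 r2"
  let ?B = "ball x0 r"
  have r: "r > 0" "?B \<subseteq> ball x0 r1" "?B \<subseteq> ball x0 r2" using 1(1) 2(1) by (auto simp: r_def)
  have h1: "(s1 has_derivative (\<lambda>u. \<Omega> x u (s1 x))) (at x)" if "x \<in> ?B" for x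
    using smooth_on_has_derivative[OF 1(3), of x] 1(5)[of x] that r(2) by (metis (no_types, lifting) ext subsetD)
  have h2: "(s2 has_derivative (\<lambda>u. \<Omega> x u (s2 x))) (at x)" if "x \<in> ?B" for x
    using smooth_on_has_derivative[OF 2(3), of x] 2(5)[of x] that r(3) by (metis (no_types, lifting) ext subsetD)
  \<comment> \<open>\<Omega> is skew with respect to this bilinear form, so it is constant on pairs
    of solutions. Its values at \<open>x0\<close> yield the Gram relations required by
    \<open>cc_metric_eq\<close>.\<close>
  define q where "q s t = fst (snd s) * fst (snd t) + snd (snd s) * snd (snd t) + c * fst s * fst t" for s t :: "real \<times> real \<times> real"
  have const: "q (s x) (t x) = q (s x0) (t x0)"
    if s: "\<And>x. x \<in> ?B \<Longrightarrow> (s has_derivative (\<lambda>u. \<Omega> x u (s x))) (at x)"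
      and t: "\<And>x. x \<in> ?B \<Longrightarrow> (t has_derivative (\<lambda>u. \<Omega> x u (t x))) (at x)" and x: "x \<in> ?B" for s t x
  proof -
    have "((\<lambda>y. q (s y) (t y)) has_derivative (\<lambda>u. 0)) (at y)" if y: "y \<in> ?B" for y
    proof -
      note ds = has_derivative_fst[OF s[OF y]] has_derivative_fst[OF has_derivative_snd[OF s[OF y]]]
        has_derivative_snd[OF has_derivative_snd[OF s[OF y]]]
      note dt = has_derivative_fst[OF t[OF y]] has_derivative_fst[OF has_derivative_snd[OF t[OF y]]]
        has_derivative_snd[OF has_derivative_snd[OF t[OF y]]]
      have "((\<lambda>y. q (s y) (t y)) has_derivative (\<lambda>u.
         (fst (snd (s y)) * fst (snd (\<Omega> y u (t y))) + fst (snd (\<Omega> y u (s y))) * fst (snd (t y)))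
         + (snd (snd (s y)) * snd (snd (\<Omega> y u (t y))) + snd (snd (\<Omega> y u (s y))) * snd (snd (t y)))
         + (c * fst (s y) * fst (\<Omega> y u (t y)) + c * fst (\<Omega> y u (s y)) * fst (t y)))) (at y)"
        unfolding q_def
        by (intro has_derivative_add has_derivative_mult has_derivative_mult_right ds dt)
      then show ?thesis by (simp add: \<Omega>_def algebra_simps)
    qed
    from has_derivative_zero_constant[OF convex_ball has_derivative_at_withinI[OF this]]
    have "\<exists>k. \<forall>y\<in>?B. q (s y) (t y) = k" by blast
    then show ?thesis using x r(1) by (metis centre_in_ball)
  qed
  \<comment> \<open>The denominator of \<open>cc_metric\<close> along F; it equals 1 at
    \<open>x0\<close>, and the domain is cut down to where it is nonzero.\<close>
  define g where "g x = 1 - c * ((fst (s1 x))\<^sup>2 + (fst (s2 x))\<^sup>2)" for x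
  have sm12: "smooth_on ?B s1" "smooth_on ?B s2" using 1(3) 2(3) r smooth_on_subset by blast+
  have "continuous_on ?B g" unfolding g_def
    by (intro continuous_intros smooth_on_continuous sm12)
  then have oW: "open (?B \<inter> g -` (-{0}))" by (rule continuous_open_preimage) auto
  define F where "F x = (fst (s1 x), fst (s2 x))" for x
  show ?thesis
  proof (rule that[OF oW])
    show "x0 \<in> ?B \<inter> g -` (-{0})" using r(1) 1(4) 2(4) by (simp add: g_def)
    show "?B \<inter> g -` (-{0}) \<subseteq> S" using 1(2) r by blast
    show "smooth_on (?B \<inter> g -` (-{0})) F"
      unfolding F_def
      by (rule smooth_on_subset[of ?B]) (intro smooth sm12 open_ball, blast)
    show "F x0 = (0, 0)" using 1(4) 2(4) by (simp add: F_def)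
    fix x u assume "x \<in> ?B \<inter> g -` (-{0})"
    then have x: "x \<in> ?B" "g x \<noteq> 0" by auto
    have DF: "D F x u = (fst (snd (s1 x)) * \<theta> x u + snd (snd (s1 x)) * \<eta> x u, fst (snd (s2 x)) * \<theta> x u + snd (snd (s2 x)) * \<eta> x u)"
      unfolding F_def[abs_def] D_eq[OF has_derivative_Pair[OF has_derivative_fst[OF h1[OF x(1)]] has_derivative_fst[OF h2[OF x(1)]]]]
      by (simp add: \<Omega>_def)
    show "(\<theta> x u)\<^sup>2 + (\<eta> x u)\<^sup>2 = cc_metric c (F x) (D F x u)"
      unfolding DF unfolding F_def
      using const[OF h1 h1 x(1)] const[OF h2 h2 x(1)] const[OF h1 h2 x(1)] x(2)
      by (intro cc_metric_eq) (auto simp: q_def 1(4) 2(4) g_def algebra_simps)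
  qed
qed

section \<open>Vanishing of O'Neill's tensor\<close>

text \<open>Indices 0 and 1 are horizontal, 2 and 3 vertical. By \<open>lift\<close> the form dual
  to \<open>E i\<close> is the pullback of the form dual to \<open>\<epsilon> i\<close>; in
  particular it annihilates the kernel of \<open>D p x\<close>. That \<open>E 2\<close> and
  \<open>E 3\<close> are vertical then follows from orthonormality.\<close>

locale submersion_frame =
  fixes S :: "'e::euclidean_space set" and G Q and H :: "'f::euclidean_space \<Rightarrow> 'f \<Rightarrow> 'f \<Rightarrow> real" and p and l :: real and E \<epsilon>
  assumes MG: "metric_on S G" and MH: "metric_on Q H"
    and dim: "4 = DIM('e)" "2 = DIM('f)"
    and smp: "smooth_on S p" and pS: "p ` S \<subseteq> Q"
    and FE: "frame_on S G 4 E" and F\<epsilon>: "frame_on Q H 2 \<epsilon>"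
    and lift: "\<And>x i u. x \<in> S \<Longrightarrow> i < 2 \<Longrightarrow> G x u (E i x) = H (p x) (D p x u) (\<epsilon> i (p x))"
    and geodesic: "\<And>x a u. x \<in> S \<Longrightarrow> a = 2 \<or> a = 3 \<Longrightarrow> D p x u = 0 \<Longrightarrow> D p x (cov_deriv G (E a) x u) = 0"
    and einstein: "\<And>x v w. x \<in> S \<Longrightarrow> ricci G x v w = l * G x v w"
begin

sublocale g: coord_metric S G by unfold_locales (rule MG)
sublocale h: coord_metric Q H by unfold_locales (rule MH)

abbreviation \<theta> where "\<theta> \<equiv> g.\<theta> E"
abbreviation \<omega> where "\<omega> \<equiv> g.\<omega> E"
abbreviation \<theta>' where "\<theta>' \<equiv> h.\<theta> \<epsilon>"
abbreviation \<omega>' where "\<omega>' \<equiv> h.\<omega> \<epsilon>"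

lemmas gT = g.openS order.refl dim(1) FE
lemmas hT = h.openS order.refl dim(2) F\<epsilon>
lemmas lin\<theta> = g.linear_\<theta>[OF gT]
lemmas \<theta>E = g.\<theta>_frame[OF gT]
lemmas skew = g.\<omega>_skew[OF gT]

lemma px: "x \<in> S \<Longrightarrow> p x \<in> Q" using pS by blast

lemma \<theta>_lift: "x \<in> S \<Longrightarrow> i < 2 \<Longrightarrow> \<theta> i x u = \<theta>' i (p x) (D p x u)"
  unfolding g.\<theta>_def[OF gT] h.\<theta>_def[OF hT] by (rule lift)

lemma expand:
  assumes "x \<in> S" "linear L"
  shows "L u = \<theta> 0 x u *\<^sub>R L (E 0 x) + \<theta> 1 x u *\<^sub>R L (E 1 x) + \<theta> 2 x u *\<^sub>R L (E 2 x) + \<theta> 3 x u *\<^sub>R L (E 3 x)"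
  using g.frame_expand[OF gT assms(1), of u] linear_sum[OF assms(2), of "\<lambda>i. \<theta> i x u *\<^sub>R E i x" "{..<4}"]
    linear_scale[OF assms(2)] by (simp only: sum4)

lemma vertical: "x \<in> S \<Longrightarrow> \<theta> 0 x u = 0 \<Longrightarrow> \<theta> 1 x u = 0 \<Longrightarrow> D p x u = 0"
  using h.frame_expand[OF hT px, of x "D p x u"] \<theta>_lift[of x 0 u] \<theta>_lift[of x 1 u] by (simp add: sum2)

lemma DpE: "x \<in> S \<Longrightarrow> a = 2 \<or> a = 3 \<Longrightarrow> D p x (E a x) = 0"
  by (rule vertical) (auto simp: \<theta>E)

lemma DpE': "x \<in> S \<Longrightarrow> i < 2 \<Longrightarrow> D p x (E i x) = \<epsilon> i (p x)"
  using h.frame_expand[OF hT px, of x "D p x (E i x)"] \<theta>_lift[of x 0 "E i x"] \<theta>_lift[of x 1 "E i x"]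
    \<theta>E[of x 0 i] \<theta>E[of x 1 i]
  by (auto simp: sum2 less_2_cases_iff)

lemma \<omega>_vertical: "x \<in> S \<Longrightarrow> a = 2 \<or> a = 3 \<Longrightarrow> b = 2 \<or> b = 3 \<Longrightarrow> i < 2 \<Longrightarrow> \<omega> a i x (E b x) = 0"
  unfolding g.\<omega>_def[OF gT] using lift[of x i] geodesic[of x a "E b x"] DpE[of x b] h.Gs(9)[OF px] by simp

text \<open>The horizontal coframe is pulled back from the base, and so is its differential, which
  therefore vanishes as soon as one argument is vertical.\<close>

lemma dform_\<theta>:
  assumes x: "x \<in> S" and i: "i < 2"
  shows "dform (\<theta> i) x u v = (\<Sum>j<2. \<omega>' i j (p x) (D p x u) * \<theta> j x v - \<omega>' i j (p x) (D p x v) * \<theta> j x u)"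
proof -
  have "dform (\<theta> i) x u v = dform (\<lambda>y u. \<theta>' i (p y) (D p y u)) x u v"
    by (rule dform_cong[OF g.openS x]) (rule \<theta>_lift[OF _ i])
  also have "\<dots> = dform (\<theta>' i) (p x) (D p x u) (D p x v)"
    by (rule dform_pullback[OF g.openS x smp h.openS pS h.linear_\<theta>[OF hT] h.smooth_\<theta>[OF hT i]])
  also have "\<dots> = (\<Sum>j<2. \<omega>' i j (p x) (D p x u) * \<theta> j x v - \<omega>' i j (p x) (D p x v) * \<theta> j x u)"
    unfolding h.first_structure_equation[OF hT px[OF x] i]
    by (intro sum.cong) (auto simp: \<theta>_lift[OF x])
  finally show ?thesis .
qed

lemma dform_\<theta>_vertical: 
  assumes x: "x \<in> S" and i: "i < 2" and a: "a = 2 \<or> a = 3"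
  shows "dform (\<theta> i) x u (E a x) = 0"
proof -
  have "\<theta> j x (E a x) = 0" if "j < 2" for j using \<theta>E[OF x, of j a] that a by auto
  moreover have "\<omega>' i j (p x) 0 = 0" for j by (rule linear_0[OF h.linear_\<omega>[OF hT px[OF x] i]])
  ultimately show ?thesis by (simp add: dform_\<theta>[OF x i] DpE[OF x a])
qed

text \<open>The first structure equation evaluated on \<open>E j\<close> and \<open>E a\<close>,
  where the left side is zero because \<theta>_i comes from the base.\<close>

lemma \<omega>_mixed:
  assumes x: "x \<in> S" and ij: "i < 2" "j < 2" and a: "a = 2 \<or> a = 3"
  shows "\<omega> i a x (E j x) = \<omega> i j x (E a x)"
proof -
  have "dform (\<theta> i) x (E j x) (E a x) = \<omega> i a x (E j x) - \<omega> i j x (E a x)"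
    using g.first_structure_equation[OF gT x, of i "E j x" "E a x"] ij a \<theta>E[OF x]
    by (auto simp: sum4 less_2_cases_iff)
  then show ?thesis using dform_\<theta>_vertical[OF x ij(1) a] by simp
qed

section \<open>O'Neill's tensor and the mixed connection forms\<close>

lemma \<omega>_diag: "x \<in> S \<Longrightarrow> i < 4 \<Longrightarrow> \<omega> i i x u = 0"
  using skew[of x i i u] by simp

text \<open>By \<open>\<omega>_mixed\<close> this is also \<open>\<omega> 1 a x (E 0 x)\<close>, the
  component along \<open>E a\<close> of the covariant derivative of \<open>E 1\<close> in direction
  \<open>E 0\<close>, i.e. of O'Neill's tensor.\<close>

definition w :: "nat \<Rightarrow> 'e \<Rightarrow> real" where "w a x = \<omega> 1 0 x (E a x)"

text \<open>The 1-form is determined by its values on the frame: it vanishes on vertical vectors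
  since the fibers are totally geodesic, and on \<open>E 0\<close> since \<open>\<omega> 0 0\<close>
  is zero; on \<open>E 1\<close> it is -w by \<open>\<omega>_mixed\<close>.\<close>

lemma \<omega>_0:
  assumes x: "x \<in> S" and a: "a = 2 \<or> a = 3"
  shows "\<omega> 0 a x u = - w a x * \<theta> 1 x u"
proof -
  have "\<omega> 0 a x (E b x) = 0" if "b = 2 \<or> b = 3" for b
    using skew[OF x, of 0 a "E b x"] \<omega>_vertical[OF x a that, of 0] a by auto
  moreover have "\<omega> 0 a x (E 0 x) = 0" using \<omega>_mixed[OF x _ _ a, of 0 0] \<omega>_diag[OF x, of 0] by simp
  moreover have "\<omega> 0 a x (E 1 x) = - w a x"
    using \<omega>_mixed[OF x _ _ a, of 0 1] skew[OF x, of 0 1 "E a x"] by (simp add: w_def)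
  ultimately show ?thesis using expand[OF x g.linear_\<omega>[OF gT x, of 0 a], of u] by simp
qed

lemma \<omega>_1:
  assumes x: "x \<in> S" and a: "a = 2 \<or> a = 3"
  shows "\<omega> 1 a x u = w a x * \<theta> 0 x u"
proof -
  have "\<omega> 1 a x (E b x) = 0" if "b = 2 \<or> b = 3" for b
    using skew[OF x, of 1 a "E b x"] \<omega>_vertical[OF x a that, of 1] a by auto
  moreover have "\<omega> 1 a x (E 1 x) = 0" using \<omega>_mixed[OF x _ _ a, of 1 1] \<omega>_diag[OF x, of 1] by simp
  moreover have "\<omega> 1 a x (E 0 x) = w a x"
    using \<omega>_mixed[OF x _ _ a, of 1 0] by (simp add: w_def)
  ultimately show ?thesis using expand[OF x g.linear_\<omega>[OF gT x, of 1 a], of u] by simp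
qed

lemma smooth_w: "a = 2 \<or> a = 3 \<Longrightarrow> smooth_on S (w a)"
  unfolding w_def
  by (rule smooth_on_apply_linear[where L="\<omega> 1 0", OF g.openS g.linear_\<omega>[OF gT] g.smooth_\<omega>[OF gT] g.frame_smooth[OF gT]]) auto

definition K :: "nat \<Rightarrow> nat \<Rightarrow> 'e \<Rightarrow> 'e \<Rightarrow> 'e \<Rightarrow> real" where
  "K i j x u v = G x (curvature G x u v (E i x)) (E j x)"

lemma K_eq: "x \<in> S \<Longrightarrow> i < 4 \<Longrightarrow> j < 4 \<Longrightarrow> K i j x u v = dform (\<omega> i j) x u v -
    (\<Sum>k<4. \<omega> i k x v * \<omega> j k x u - \<omega> i k x u * \<omega> j k x v)"
  unfolding K_def by (rule g.second_structure_equation[OF gT])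

lemma K_skew: "x \<in> S \<Longrightarrow> i < 4 \<Longrightarrow> j < 4 \<Longrightarrow> K i j x u v = - K j i x u v"
  unfolding K_def by (rule g.curvature_form_skew[OF gT])

lemma K_skew': "x \<in> S \<Longrightarrow> K i j x u v = - K i j x v u"
  unfolding K_def by (subst g.curvature_skew) (simp add: g.Gs)

lemma K_diag: "x \<in> S \<Longrightarrow> i < 4 \<Longrightarrow> K i i x u v = 0" "x \<in> S \<Longrightarrow> K i j x u u = 0"
  using K_skew[of x i i u v] K_skew'[of x i j u u] by auto

lemma linear_K: "x \<in> S \<Longrightarrow> linear (K i j x u)" "x \<in> S \<Longrightarrow> linear (\<lambda>u. K i j x u v)"
  unfolding K_def
  by (rule linearI; simp add: g.Gs linear_add[OF g.linear_curvature(3)] linear_scale[OF g.linear_curvature(3)]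
      linear_add[OF g.linear_curvature(2)] linear_scale[OF g.linear_curvature(2)])+

lemma ricci_K: "x \<in> S \<Longrightarrow> K b 0 x (E 0 x) v + K b 1 x (E 1 x) v + K b 2 x (E 2 x) v + K b 3 x (E 3 x) v = l * G x v (E b x)"
  using g.ricci_frame[OF gT, of x v "E b x"] einstein[of x v "E b x"] by (simp only: sum4 K_def)

text \<open>No derivative of \<open>w\<close> survives: \<theta>_1 is zero on \<open>E 0\<close> and
  \<open>E a\<close>, \<theta>_0 on \<open>E 1\<close> and \<open>E a\<close>, and their
  differentials vanish on vertical arguments. What remains is a single quadratic term of the second
  structure equation, the one through the other horizontal index.\<close>

lemma K_mixed:
  assumes x: "x \<in> S" and a: "a = 2 \<or> a = 3" and b: "b = 2 \<or> b = 3"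
  shows "K b 0 x (E 0 x) (E a x) = w a x * w b x" "K b 1 x (E 1 x) (E a x) = w a x * w b x"
proof -
  have sm\<theta>: "smooth_on S (\<lambda>y. \<theta> 0 y u)" "smooth_on S (\<lambda>y. \<theta> 1 y u)" for u
    using g.smooth_\<theta>[OF gT] by simp_all
  have 0: "\<omega> b 0 y u = w b y * \<theta> 1 y u" if "y \<in> S" for y u
    using \<omega>_0[OF that b] skew[OF that, of b 0 u] b by auto
  have 1: "\<omega> b 1 y u = - w b y * \<theta> 0 y u" if "y \<in> S" for y u
    using \<omega>_1[OF that b] skew[OF that, of b 1 u] b by auto
  have "dform (\<omega> b 0) x (E 0 x) (E a x) = dform (\<lambda>y u. w b y * \<theta> 1 y u) x (E 0 x) (E a x)"
    by (rule dform_cong[OF g.openS x 0])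
  also have "\<dots> = 0"
    unfolding dform_mult[OF g.openS x smooth_w[OF b] sm\<theta>(2)]
    using dform_\<theta>_vertical[OF x _ a, of 1] \<theta>E[OF x, of 1 a] \<theta>E[OF x, of 1 0] a by auto
  finally have d0: "dform (\<omega> b 0) x (E 0 x) (E a x) = 0" .
  have "dform (\<omega> b 1) x (E 1 x) (E a x) = dform (\<lambda>y u. - w b y * \<theta> 0 y u) x (E 1 x) (E a x)"
    by (rule dform_cong[OF g.openS x 1])
  also have "\<dots> = 0"
    unfolding dform_mult[OF g.openS x smooth_on_minus[OF g.openS smooth_w[OF b]] sm\<theta>(1)]
    using dform_\<theta>_vertical[OF x _ a, of 0] \<theta>E[OF x, of 0 a] \<theta>E[OF x, of 0 1] a by auto
  finally have d1: "dform (\<omega> b 1) x (E 1 x) (E a x) = 0" .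
  have v: "\<omega> 1 0 x (E a x) = w a x" "\<omega> 0 1 x (E a x) = - w a x"
    using skew[OF x, of 0 1 "E a x"] by (simp_all add: w_def)
  have b4: "b < 4" using b by auto
  have one4: "(1::nat) < 4" by simp
  show "K b 0 x (E 0 x) (E a x) = w a x * w b x"
    unfolding K_eq[OF x b4 zero_less_numeral] d0 sum4 
    using a b by (auto simp: 0[OF x] 1[OF x] \<theta>E[OF x] \<omega>_diag[OF x] v \<omega>_0[OF x] simp del: One_nat_def)
  show "K b 1 x (E 1 x) (E a x) = w a x * w b x"
    unfolding K_eq[OF x b4 one4] d1 sum4
    using a b by (auto simp: 0[OF x] 1[OF x] \<theta>E[OF x] \<omega>_diag[OF x] v \<omega>_1[OF x] simp del: One_nat_def)
qed

text \<open>On the two-dimensional fibers the Einstein condition makes the rank one form \<open>w \<otimes> w\<close> a multiple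
  of the metric.\<close>

lemma w_zero:
  assumes x: "x \<in> S" and a: "a = 2 \<or> a = 3"
  shows "w a x = 0"
proof -
  have G: "G x (E i x) (E j x) = (if i = j then 1 else 0)" if "i < 4" "j < 4" for i j
    using g.frameT[OF gT x that] .
  have "2 * (w 2 x * w 3 x) = 0"
    using ricci_K[OF x, of 3 "E 2 x"] K_mixed[OF x, of 2 3] K_diag[OF x] G[of 2 3] by simp
  moreover have "2 * (w 2 x)\<^sup>2 + K 2 3 x (E 3 x) (E 2 x) = l"
    using ricci_K[OF x, of 2 "E 2 x"] K_mixed[OF x, of 2 2] K_diag[OF x] G[of 2 2] by (simp add: power2_eq_square)
  moreover have "2 * (w 3 x)\<^sup>2 + K 3 2 x (E 2 x) (E 3 x) = l"
    using ricci_K[OF x, of 3 "E 3 x"] K_mixed[OF x, of 3 3] K_diag[OF x] G[of 3 3] by (simp add: power2_eq_square)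
  moreover have "K 3 2 x (E 2 x) (E 3 x) = K 2 3 x (E 3 x) (E 2 x)"
    using K_skew[OF x, of 3 2 "E 2 x" "E 3 x"] K_skew'[OF x, of 2 3 "E 2 x" "E 3 x"] by simp
  ultimately have "w 2 x = 0 \<or> w 3 x = 0" "(w 2 x)\<^sup>2 = (w 3 x)\<^sup>2" by auto
  then show ?thesis using a by auto
qed

section \<open>The parallel splitting and the curvature of its two planes\<close>

lemma \<omega>_zero:
  assumes "x \<in> S" "i < 2" "a = 2 \<or> a = 3" shows "\<omega> i a x u = 0" "\<omega> a i x u = 0"
proof -
  show "\<omega> i a x u = 0" using assms \<omega>_0[of x a u] \<omega>_1[of x a u] w_zero by (auto simp: less_2_cases_iff)
  then show "\<omega> a i x u = 0" using skew[of x a i u] assms by auto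
qed

lemma K_zero:
  assumes x: "x \<in> S" and i: "i < 2" and a: "a = 2 \<or> a = 3" shows "K i a x u v = 0" "K a i x u v = 0"
proof -
  have "dform (\<omega> i a) x u v = dform (\<lambda>y u. 0) x u v"
    by (rule dform_cong[OF g.openS x \<omega>_zero(1)[OF _ i a]])
  then have "dform (\<omega> i a) x u v = 0" by (simp add: dform_def)
  then show "K i a x u v = 0"
    using K_eq[OF x, of i a u v] i a \<omega>_zero[OF x _ a] \<omega>_zero[OF x i] by (auto simp: sum4)
  then show "K a i x u v = 0" using K_skew[OF x, of a i u v] i a by auto
qed

lemma bianchi:
  "x \<in> S \<Longrightarrow> K k j x (E i x) (E m x) + K i j x (E m x) (E k x) + K m j x (E k x) (E i x) = 0"
  unfolding K_def
  using arg_cong[OF g.curvature_bianchi, of x "\<lambda>z. G x z (E j x)" "E i x" "E m x" "E k x"]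
  by (simp add: g.Gs)

text \<open>With the mixed curvature forms gone, the Ricci equation for \<open>E 2\<close> contains
  only the plane of \<open>E 2\<close>, \<open>E 3\<close> and fixes its curvature as
  \<open>l\<close>. The remaining entries, with a horizontal argument, are removed by the first
  Bianchi identity, in place of the pair symmetry of the curvature tensor.\<close>

lemma K_vertical:
  assumes x: "x \<in> S"
  shows "K 2 3 x u v = dform (\<omega> 2 3) x u v" "K 2 3 x u v = - l * (\<theta> 2 x u * \<theta> 3 x v - \<theta> 2 x v * \<theta> 3 x u)"
proof -
  show "K 2 3 x u v = dform (\<omega> 2 3) x u v"
    using K_eq[OF x, of 2 3 u v] \<omega>_zero[OF x, of _ 2] \<omega>_diag[OF x] by (simp add: sum4)
  have G: "G x (E i x) (E j x) = (if i = j then 1 else 0)" if "i < 4" "j < 4" for i j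
    using g.frameT[OF gT x that] .
  have 32: "K 2 3 x (E 3 x) (E 2 x) = l"
    using ricci_K[OF x, of 2 "E 2 x"] K_zero[OF x, of _ 2] K_diag[OF x] G[of 2 2] by simp
  then have 23: "K 2 3 x (E 2 x) (E 3 x) = - l" using K_skew'[OF x] by metis
  have h: "K 2 3 x (E i x) (E j x) = 0" if i: "i < 2" and j: "j < 4" for i j
  proof -
    consider "j < 2" | "j = 2" | "j = 3" using j by linarith
    then show ?thesis
    proof cases
      case 1
      then show ?thesis using bianchi[OF x, of 2 3 i j] K_zero[OF x, of _ 3] i by simp
    next
      case 2
      then have "K 3 2 x (E i x) (E j x) = 0"
        using bianchi[OF x, of 3 2 i 2] K_zero[OF x i, of 2] K_diag[OF x, of 2] by simp
      then show ?thesis using K_skew[OF x, of 2 3] by simp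
    next
      case 3
      then show ?thesis
        using bianchi[OF x, of 2 3 i 3] K_zero[OF x i, of 3] K_diag[OF x, of 3] by simp
    qed
  qed
  then have h': "K 2 3 x (E j x) (E i x) = 0" if "i < 2" "j < 4" for i j
    using K_skew'[OF x, of 2 3 "E j x"] that by simp
  have "K 2 3 x (E k x) v = \<theta> 2 x v * K 2 3 x (E k x) (E 2 x) + \<theta> 3 x v * K 2 3 x (E k x) (E 3 x)" if "k < 4" for k
    using expand[OF x linear_K(1)[OF x], of 2 3 "E k x" v] h'[OF _ that, of 0] h'[OF _ that, of 1] by simp
  then have "K 2 3 x (E 2 x) v = - l * \<theta> 3 x v" "K 2 3 x (E 3 x) v = l * \<theta> 2 x v"
     "K 2 3 x (E 0 x) v = 0" "K 2 3 x (E 1 x) v = 0"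
    using 23 32 K_diag(2)[OF x] h by auto
  then show "K 2 3 x u v = - l * (\<theta> 2 x u * \<theta> 3 x v - \<theta> 2 x v * \<theta> 3 x u)"
    using expand[OF x linear_K(2)[OF x], of 2 3 u v] by (simp add: algebra_simps)
qed

text \<open>These are the structure equations of a surface of curvature \<open>l\<close>, holding on
  the whole four-dimensional domain, in the form expected by \<open>developing_map\<close>.\<close>

lemma vertical_structure:
  assumes x: "x \<in> S"
  shows "dform (\<theta> 2) x u v = \<omega> 2 3 x u * \<theta> 3 x v - \<omega> 2 3 x v * \<theta> 3 x u"
    "dform (\<theta> 3) x u v = \<omega> 2 3 x v * \<theta> 2 x u - \<omega> 2 3 x u * \<theta> 2 x v"
    "dform (\<omega> 2 3) x u v = - l * (\<theta> 2 x u * \<theta> 3 x v - \<theta> 2 x v * \<theta> 3 x u)"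
proof -
  show "dform (\<theta> 2) x u v = \<omega> 2 3 x u * \<theta> 3 x v - \<omega> 2 3 x v * \<theta> 3 x u"
    using g.first_structure_equation[OF gT x, of 2 u v] \<omega>_zero[OF x, of _ 2] \<omega>_diag[OF x] by (simp add: sum4)
  show "dform (\<theta> 3) x u v = \<omega> 2 3 x v * \<theta> 2 x u - \<omega> 2 3 x u * \<theta> 2 x v"
    using g.first_structure_equation[OF gT x, of 3 u v] \<omega>_zero[OF x, of _ 3] \<omega>_diag[OF x]
      skew[OF x, of 3 2] by (simp add: sum4)
qed (use K_vertical[OF x] in metis)

text \<open>Cartan's lemma: comparing the two first structure equations, the difference of the two
  connection forms has zero wedge product with both \<theta>_0 and \<theta>_1. As these are
  independent, it vanishes.\<close>

lemma \<omega>_base: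
  assumes x: "x \<in> S"
  shows "\<omega> 0 1 x u = \<omega>' 0 1 (p x) (D p x u)"
proof -
  define \<eta> where "\<eta> u = \<omega> 0 1 x u - \<omega>' 0 1 (p x) (D p x u)" for u
  have diag': "\<omega>' i i (p x) u = 0" if "i < 2" for i u using h.\<omega>_skew[OF hT px[OF x] that that, of u] by simp
  have 0: "\<eta> u * \<theta> 1 x v = \<eta> v * \<theta> 1 x u" for u v
    using g.first_structure_equation[OF gT x, of 0 u v] dform_\<theta>[OF x, of 0 u v] \<omega>_zero[OF x, of 0] \<omega>_diag[OF x, of 0]
      diag'[of 0] by (simp add: sum4 sum2 \<eta>_def algebra_simps)
  have 1: "\<eta> u * \<theta> 0 x v = \<eta> v * \<theta> 0 x u" for u v
    using g.first_structure_equation[OF gT x, of 1 u v] dform_\<theta>[OF x, of 1 u v] \<omega>_zero[OF x, of 1] \<omega>_diag[OF x, of 1]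
      diag'[of 1] skew[OF x, of 1 0] h.\<omega>_skew[OF hT px[OF x], of 1 0] by (simp add: sum4 sum2 \<eta>_def algebra_simps)
  have "\<eta> (E 1 x) = 0" using 1[of "E 1 x" "E 0 x"] \<theta>E[OF x, of 0 0] \<theta>E[OF x, of 0 1] by simp
  then have "\<eta> u = 0" using 0[of u "E 1 x"] \<theta>E[OF x, of 1 1] by simp
  then show ?thesis by (simp add: \<eta>_def)
qed

text \<open>An alternating form on a plane is determined by one value. On the pair of base frame
  vectors it is computed upstairs: the connection form is a pullback, \<open>E 0\<close> and
  \<open>E 1\<close> project to the base frame, and the Ricci equation for \<open>E 0\<close> gives
  \<open>l\<close>.\<close>

lemma base_curvature:
  assumes x: "x \<in> S"
  shows "dform (\<omega>' 0 1) (p x) u v = - l * (\<theta>' 0 (p x) u * \<theta>' 1 (p x) v - \<theta>' 0 (p x) v * \<theta>' 1 (p x) u)"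
proof -
  let ?y = "p x"
  have G: "G x (E 0 x) (E 0 x) = 1" using g.frameT[OF gT x, of 0 0] by simp
  have K': "K 0 1 x u v = dform (\<omega> 0 1) x u v" for u v
    using K_eq[OF x, of 0 1 u v] \<omega>_zero[OF x, of _ 2] \<omega>_zero[OF x, of _ 3] \<omega>_diag[OF x] by (simp add: sum4)
  have K10: "K 0 1 x (E 1 x) (E 0 x) = l"
    using ricci_K[OF x, of 0 "E 0 x"] K_zero[OF x, of 0] K_diag[OF x] G by simp
  have pull: "dform (\<omega> 0 1) x u v = dform (\<omega>' 0 1) ?y (D p x u) (D p x v)" for u v
  proof -
    have "dform (\<omega> 0 1) x u v = dform (\<lambda>y u. \<omega>' 0 1 (p y) (D p y u)) x u v"
      by (rule dform_cong[OF g.openS x \<omega>_base])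
    also have "\<dots> = dform (\<omega>' 0 1) ?y (D p x u) (D p x v)"
      by (rule dform_pullback[OF g.openS x smp h.openS pS h.linear_\<omega>[OF hT] h.smooth_\<omega>[OF hT]]) auto
    finally show ?thesis .
  qed
  have l: "dform (\<omega>' 0 1) ?y (\<epsilon> 1 ?y) (\<epsilon> 0 ?y) = l"
    using DpE'[OF x, of 0] DpE'[OF x, of 1] K'[of "E 1 x" "E 0 x"] K10 pull[of "E 1 x" "E 0 x"] by simp
  define B where "B u v = dform (\<omega>' 0 1) ?y u v" for u v
  have BG: "B u v = H ?y (curvature H ?y u v (\<epsilon> 0 ?y)) (\<epsilon> 1 ?y)" for u v
    unfolding B_def using h.curvature_form_surface[OF hT px[OF x]] by simp
  have bs: "B (a + b) c = B a c + B b c" "B c (a + b) = B c a + B c b" "B (k *\<^sub>R a) c = k * B a c" "B c (k *\<^sub>R a) = k * B c a"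
    for a b c k
    unfolding BG
    by (simp_all add: h.Gs[OF px[OF x]] linear_add[OF h.linear_curvature(2)[OF px[OF x]]]
      linear_add[OF h.linear_curvature(3)[OF px[OF x]]]
      linear_scale[OF h.linear_curvature(2)[OF px[OF x]]] linear_scale[OF h.linear_curvature(3)[OF px[OF x]]])
  have alt: "B a b = - B b a" for a b unfolding B_def dform_def by simp
  have aa: "B a a = 0" for a using alt[of a a] by simp
  have e: "v = \<theta>' 0 ?y v *\<^sub>R \<epsilon> 0 ?y + \<theta>' 1 ?y v *\<^sub>R \<epsilon> 1 ?y" for v
    using h.frame_expand[OF hT px[OF x], of v] by (simp add: sum2)
  have "B (\<epsilon> 1 ?y) (\<epsilon> 0 ?y) = l" "B (\<epsilon> 0 ?y) (\<epsilon> 1 ?y) = - l" using l alt[of "\<epsilon> 0 ?y"] by (simp_all add: B_def)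
  then have "B (a *\<^sub>R \<epsilon> 0 ?y + b *\<^sub>R \<epsilon> 1 ?y) (c *\<^sub>R \<epsilon> 0 ?y + d *\<^sub>R \<epsilon> 1 ?y) = - l * (a * d - c * b)" for a b c d
    by (simp add: bs aa algebra_simps)
  then show ?thesis using e[of u] e[of v] unfolding B_def by metis
qed

end

section \<open>Local splitting\<close>

text \<open>With \<open>L\<close> the adjoint of \<open>P\<close>, the isometry condition says that \<open>P \<circ> L\<close> is an injective projection.\<close>

lemma horizontal_lift_projects:
  fixes G :: "'e::euclidean_space \<Rightarrow> 'e \<Rightarrow> 'e \<Rightarrow> real" and H :: "'f::euclidean_space \<Rightarrow> 'f \<Rightarrow> 'f \<Rightarrow> real"
  assumes MG: "metric_on S G" "x \<in> S" and MH: "metric_on Q H" "y \<in> Q"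
    and P: "linear P" "surj P"
    and iso: "\<And>v w. (\<forall>u. P u = 0 \<longrightarrow> G x v u = 0) \<Longrightarrow> (\<forall>u. P u = 0 \<longrightarrow> G x w u = 0) \<Longrightarrow> G x v w = H y (P v) (P w)"
    and z: "\<And>u. G x z u = H y (P u) \<xi>"
  shows "P z = \<xi>"
proof -
  have "\<exists>z. \<forall>u. G x z u = H y (P u) \<eta>" for \<eta>
    using metric_on_sharp_exists[OF MG linear_compose[OF P(1) metric_onD(7)[OF MH], unfolded o_def]] by blast
  then obtain L where L: "\<And>\<eta> u. G x (L \<eta>) u = H y (P u) \<eta>" by metis
  note gs = metric_on_simps[OF MG] and hs = metric_on_simps[OF MH]
  have "linear L"
    by (rule linearI; rule metric_on_eqI[OF MG]) (simp_all add: gs L hs)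
  then have linA: "linear (P \<circ> L)" using linear_compose P(1) by blast
  have hor: "\<forall>u. P u = 0 \<longrightarrow> G x (L \<eta>) u = 0" for \<eta> by (simp add: L hs)
  have GL: "G x (L \<eta>) (L \<xi>) = H y (P (L \<eta>)) (P (L \<xi>))" for \<eta> \<xi> by (rule iso[OF hor hor])
  have A: "H y (P (L \<eta>)) (P (L \<xi>) - \<xi>) = 0" for \<eta> \<xi>
    using GL[of \<xi> \<eta>] L[of \<xi> "L \<eta>"] metric_onD(3)[OF MH] by (simp add: hs)
  have "inj (P \<circ> L)"
    unfolding linear_injective_0[OF linA]
  proof (intro allI impI)
    fix \<eta> assume "(P \<circ> L) \<eta> = 0"
    then have "G x (L \<eta>) (L \<eta>) = 0" by (simp add: GL hs)
    then have "L \<eta> = 0" using metric_onD(4)[OF MG] by (metis less_irrefl)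
    then have "H y (P u) \<eta> = 0" for u using L[of \<eta> u] by (simp add: gs)
    moreover obtain u where "P u = \<eta>" using P(2) by (metis surjD)
    ultimately have "H y \<eta> \<eta> = 0" by metis
    then show "\<eta> = 0" using metric_onD(4)[OF MH] by (metis less_irrefl)
  qed
  then have "surj (P \<circ> L)" using linA linear_injective_imp_surjective by blast
  then obtain \<eta> where "P (L \<eta>) = P (L \<xi>) - \<xi>" by (metis comp_apply surjD)
  then have "H y (P (L \<xi>) - \<xi>) (P (L \<xi>) - \<xi>) = 0" using A[of \<eta> \<xi>] by simp
  then have "P (L \<xi>) - \<xi> = 0" using metric_onD(4)[OF MH] by (metis less_irrefl)
  moreover have "z = L \<xi>" by (rule metric_on_eqI[OF MG]) (simp add: z L)
  ultimately show ?thesis by simp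
qed

text \<open>The geometric hypotheses read in one pair of charts. \<open>geodesic\<close> speaks of
  fields that are vertical on an open set, hence tangent to all the fibers that meet it.\<close>

locale local_submersion =
  fixes S :: "'e::euclidean_space set" and G Q and H :: "'f::euclidean_space \<Rightarrow> 'f \<Rightarrow> 'f \<Rightarrow> real" and p and l :: real
  assumes MG: "metric_on S G" and MH: "metric_on Q H"
    and dim: "DIM('e) = 4" "DIM('f) = 2"
    and smp: "smooth_on S p" and pS: "p ` S \<subseteq> Q"
    and surj: "\<And>x. x \<in> S \<Longrightarrow> surj (D p x)"
    and iso: "\<And>x v w. x \<in> S \<Longrightarrow> (\<forall>u. D p x u = 0 \<longrightarrow> G x v u = 0) \<Longrightarrow> (\<forall>u. D p x u = 0 \<longrightarrow> G x w u = 0)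
        \<Longrightarrow> G x v w = H (p x) (D p x v) (D p x w)"
    and geodesic: "\<And>W V x u. open W \<Longrightarrow> x \<in> W \<Longrightarrow> W \<subseteq> S \<Longrightarrow> smooth_on W V \<Longrightarrow> (\<forall>y\<in>W. D p y (V y) = 0)
        \<Longrightarrow> D p x u = 0 \<Longrightarrow> D p x (cov_deriv G V x u) = 0"
    and einstein: "\<And>x v w. x \<in> S \<Longrightarrow> ricci G x v w = l * G x v w"
begin

text \<open>The adjoint of \<open>D p x\<close> lifts a base frame to fields \<open>e i\<close>,
  which project back to it by \<open>horizontal_lift_projects\<close> and are therefore orthonormal.
  Gram-Schmidt completes them; the new fields are orthogonal to the \<open>e i\<close>, so their
  projections have no components in the base frame and they are vertical.\<close>

lemma adapted_frame:
  assumes x0: "x0 \<in> S"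
  obtains S' Q' E \<epsilon> where "submersion_frame S' G Q' H p l E \<epsilon>" "x0 \<in> S'" "S' \<subseteq> S" "Q' \<subseteq> Q"
proof -
  have oS: "open S" by (rule metric_onD(1)[OF MG])
  obtain Q' \<epsilon> where Q: "open Q'" "p x0 \<in> Q'" "Q' \<subseteq> Q" "frame_on Q' H 2 \<epsilon>"
    using frame_on_exists[OF MH, of "p x0"] x0 pS unfolding dim by blast
  note MQ = metric_on_subset[OF MH Q(1,3)]
  define S1 where "S1 = S \<inter> p -` Q'"
  have oS1: "open S1" unfolding S1_def
    by (rule continuous_open_preimage[OF smooth_on_continuous[OF smp] oS Q(1)])
  have S1: "S1 \<subseteq> S" "x0 \<in> S1" "p ` S1 \<subseteq> Q'" using x0 Q(2) by (auto simp: S1_def)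
  note M1 = metric_on_subset[OF MG oS1 S1(1)]
  have pQ: "p x \<in> Q'" if "x \<in> S1" for x using that by (simp add: S1_def)
  have linp: "linear (D p x)" if "x \<in> S1" for x using smooth_on_linear_D[OF smp] S1 that by blast
  define e where "e i x = (THE z. \<forall>u. G x z u = H (p x) (D p x u) (\<epsilon> i (p x)))" for i x
  have e: "G x (e i x) u = H (p x) (D p x u) (\<epsilon> i (p x))" if x: "x \<in> S1" for x i u
    using theI'[OF metric_on_sharp_exists[OF M1 x linear_compose[OF linp[OF x] metric_onD(7)[OF MQ pQ[OF x]], unfolded o_def]]]
    unfolding e_def by blast
  have sm\<epsilon>: "smooth_on S1 (\<lambda>x. \<epsilon> i (p x))" if "i < 2" for i
    using Q(4) that S1 by (intro smooth_on_compose[OF oS1 Q(1) smooth_on_subset[OF smp S1(1)]]) (auto simp: frame_on_def)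
  have sm1: "smooth_on S1 (\<lambda>x. H (p x) v w)" for v w
    by (rule smooth_on_compose[OF oS1 Q(1) smooth_on_subset[OF smp S1(1)] metric_onD(5)[OF MQ] S1(3)])
  have sm2: "smooth_on S1 (\<lambda>x. H (p x) v (\<epsilon> i (p x)))" if "i < 2" for v i
    by (rule smooth_on_apply_linear[where L="\<lambda>x. H (p x) v", OF oS1 metric_onD(6)[OF MQ pQ] sm1 sm\<epsilon>[OF that]])
  have sm3: "smooth_on S1 (\<lambda>x. H (p x) (D p x u) (\<epsilon> i (p x)))" if "i < 2" for u i
    by (rule smooth_on_apply_linear[where L="\<lambda>x v. H (p x) v (\<epsilon> i (p x))", OF oS1 metric_onD(7)[OF MQ pQ] sm2[OF that]
       smooth_on_D[OF smooth_on_subset[OF smp S1(1)]]])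
  have sme: "smooth_on S1 (e i)" if "i < 2" for i
    by (rule smooth_on_sharp[OF M1 e sm3[OF that]])
  have De: "D p x (e i x) = \<epsilon> i (p x)" if x: "x \<in> S1" for x i
  proof (rule horizontal_lift_projects[OF M1 x MQ pQ[OF x] linp[OF x]])
    show "surj (D p x)" using surj x S1 by blast
  qed (use iso x S1 e in blast)+
  have Fe: "frame_on S1 G 2 e"
    unfolding frame_on_def
  proof (intro conjI allI impI ballI)
    show "smooth_on S1 (e i)" if "i < 2" for i by (rule sme[OF that])
    show "G x (e i x) (e j x) = (if i = j then 1 else 0)" if "x \<in> S1" "i < 2" "j < 2" for x i j
      unfolding e[OF that(1)] De[OF that(1)] using Q(4) pQ[OF that(1)] that by (auto simp: frame_on_def)
  qed
  obtain S2 E where S2: "open S2" "x0 \<in> S2" "S2 \<subseteq> S1" "frame_on S2 G 4 E" "\<And>i. i < 2 \<Longrightarrow> E i = e i"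
    by (rule frame_on_complete[OF M1 Fe _ S1(2), unfolded dim]) (simp, blast)
  have S2S: "S2 \<subseteq> S" using S2 S1 by blast
  have vert: "D p x (E a x) = 0" if x: "x \<in> S2" and a: "a = 2 \<or> a = 3" for x a
  proof -
    have x1: "x \<in> S1" using x S2 by blast
    have "H (p x) (D p x (E a x)) (\<epsilon> i (p x)) = 0" if "i < 2" for i
    proof -
      have "H (p x) (D p x (E a x)) (\<epsilon> i (p x)) = G x (E i x) (E a x)" using e[OF x1, of i] S2(5)[OF that] by simp
      then show ?thesis using S2(4) x a that by (auto simp: frame_on_def)
    qed
    moreover have "D p x (E a x) = (\<Sum>i<DIM('f). H (p x) (D p x (E a x)) (\<epsilon> i (p x)) *\<^sub>R \<epsilon> i (p x))"
      by (rule frame_on_expand[OF MQ _ pQ[OF x1]]) (use Q(4) dim in simp)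
    ultimately show ?thesis by (simp add: dim)
  qed
  have "submersion_frame S2 G Q' H p l E \<epsilon>"
  proof
    show "metric_on S2 G" by (rule metric_on_subset[OF MG S2(1) S2S])
    show "metric_on Q' H" "4 = DIM('e)" "2 = DIM('f)" "frame_on S2 G 4 E" "frame_on Q' H 2 \<epsilon>"
      by (simp_all add: dim MQ S2 Q)
    show "smooth_on S2 p" by (rule smooth_on_subset[OF smp S2S])
    show "p ` S2 \<subseteq> Q'" using S2 S1 by blast
    show "G x u (E i x) = H (p x) (D p x u) (\<epsilon> i (p x))" if "x \<in> S2" "i < 2" for x i u
      using e[of x i u] that S2(3,5) metric_onD(3)[OF M1, of x u "e i x"] by auto
    show "D p x (cov_deriv G (E a) x u) = 0" if "x \<in> S2" "a = 2 \<or> a = 3" "D p x u = 0" for x a u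
    proof (rule geodesic[OF S2(1) that(1) S2S _ _ that(3)])
      show "smooth_on S2 (E a)" using S2(4) that(2) by (auto simp: frame_on_def)
      show "\<forall>y\<in>S2. D p y (E a y) = 0" using vert that(2) by blast
    qed
    show "ricci G x v w = l * G x v w" if "x \<in> S2" for x v w using einstein that S2S by blast
  qed
  then show ?thesis using that S2(2) S2S Q(3) by blast
qed

lemma base_sectional_curvature:
  assumes x: "x \<in> S" and vw: "v \<noteq> w" "independent {v, w}"
  shows "sectional_curvature H (p x) v w = l"
proof -
  obtain S' Q' E \<epsilon> where *: "submersion_frame S' G Q' H p l E \<epsilon>" "x \<in> S'"
    using adapted_frame[OF x] by metis
  interpret submersion_frame S' G Q' H p l E \<epsilon> by (rule *(1))
  show ?thesis
    by (rule h.sectional_curvature_surface[OF hT px[OF *(2)] base_curvature[OF *(2)] vw])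
qed

text \<open>Squares of the dual forms are summed: the horizontal pair gives the length of the
  projection, and the vertical pair is expressed by F. The base metric is expressed by F' through
  the same function \<open>cc_metric l\<close>.\<close>

lemma local_developing_maps:
  assumes x0: "x0 \<in> S"
  obtains W F R F' where "open W" "x0 \<in> W" "W \<subseteq> S" "smooth_on W F" "F x0 = (0, 0)"
    "open R" "p x0 \<in> R" "R \<subseteq> Q" "smooth_on R F'" "F' (p x0) = (0, 0)"
    "\<And>x u. x \<in> W \<Longrightarrow> G x u u = H (p x) (D p x u) (D p x u) + cc_metric l (F x) (D F x u)"
    "\<And>y u. y \<in> R \<Longrightarrow> H y u u = cc_metric l (F' y) (D F' y u)"
proof -
  obtain S' Q' E \<epsilon> where *: "submersion_frame S' G Q' H p l E \<epsilon>" "x0 \<in> S'" "S' \<subseteq> S" "Q' \<subseteq> Q"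
    using adapted_frame[OF x0] by metis
  interpret f: submersion_frame S' G Q' H p l E \<epsilon> by (rule *(1))
  obtain W F where W: "open W" "x0 \<in> W" "W \<subseteq> S'" "smooth_on W F" "F x0 = (0, 0)"
    "\<And>x u. x \<in> W \<Longrightarrow> (f.\<theta> 2 x u)\<^sup>2 + (f.\<theta> 3 x u)\<^sup>2 = cc_metric l (F x) (D F x u)"
    by (rule developing_map[OF f.g.openS *(2) f.lin\<theta> f.lin\<theta> f.g.linear_\<omega>[OF f.gT]
      f.g.smooth_\<theta>[OF f.gT] f.g.smooth_\<theta>[OF f.gT] f.g.smooth_\<omega>[OF f.gT] f.vertical_structure]) auto
  \<comment> \<open>The curvature of the base is known only at points \<open>p x\<close>, so F' is
    developed on the interior of the image; \<open>p x0\<close> is interior because the differential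
    of \<open>p\<close> is surjective.\<close>
  define R where "R = interior (p ` S')"
  have RQ: "R \<subseteq> Q'" using interior_subset f.pS by (auto simp: R_def)
  have "p x0 \<in> interior (p ` S')"
  proof -
    have lin: "linear (D p x0)" by (rule smooth_on_linear_D[OF smp x0])
    then obtain k where k: "linear k" "D p x0 \<circ> k = id"
      using linear_surjective_right_inverse[OF lin surj[OF x0]] by blast
    show ?thesis
      by (rule sussmann_open_mapping[OF f.g.openS smooth_on_continuous[OF f.smp] *(2) smooth_on_has_derivative[OF smp x0] _ k(2) order.refl])
        (use k(1) *(2) f.g.openS in \<open>auto simp: linear_conv_bounded_linear interior_open\<close>)
  qed
  then have y0: "p x0 \<in> R" by (simp add: R_def)
  have oR: "open R" by (simp add: R_def)
  have diag: "f.\<omega>' i i y u = 0" if "y \<in> Q'" "i < 2" for i y u using f.h.\<omega>_skew[OF f.hT that(1) that(2) that(2), of u] by simp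
  have RQ': "y \<in> Q'" if "y \<in> R" for y using RQ that by blast
  obtain R' F' where R': "open R'" "p x0 \<in> R'" "R' \<subseteq> R" "smooth_on R' F'" "F' (p x0) = (0, 0)"
    "\<And>y u. y \<in> R' \<Longrightarrow> (f.\<theta>' 0 y u)\<^sup>2 + (f.\<theta>' 1 y u)\<^sup>2 = cc_metric l (F' y) (D F' y u)"
  proof (rule developing_map[OF oR y0, of "f.\<theta>' 0" "f.\<theta>' 1" "f.\<omega>' 0 1" l])
    show "linear (f.\<theta>' 0 y)" "linear (f.\<theta>' 1 y)" "linear (f.\<omega>' 0 1 y)" if "y \<in> R" for y
      using RQ'[OF that] f.h.linear_\<theta>[OF f.hT] f.h.linear_\<omega>[OF f.hT] by auto
    show "smooth_on R (\<lambda>y. f.\<theta>' 0 y u)" "smooth_on R (\<lambda>y. f.\<theta>' 1 y u)" "smooth_on R (\<lambda>y. f.\<omega>' 0 1 y u)" for u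
      using f.h.smooth_\<theta>[OF f.hT] f.h.smooth_\<omega>[OF f.hT] by (auto intro: smooth_on_subset[OF _ RQ])
    show "dform (f.\<theta>' 0) y u v = f.\<omega>' 0 1 y u * f.\<theta>' 1 y v - f.\<omega>' 0 1 y v * f.\<theta>' 1 y u" if "y \<in> R" for y u v
      using f.h.first_structure_equation[OF f.hT RQ'[OF that], of 0 u v] diag[OF RQ'[OF that], of 0] by (simp add: sum2)
    show "dform (f.\<theta>' 1) y u v = f.\<omega>' 0 1 y v * f.\<theta>' 0 y u - f.\<omega>' 0 1 y u * f.\<theta>' 0 y v" if "y \<in> R" for y u v
      using f.h.first_structure_equation[OF f.hT RQ'[OF that], of 1 u v] diag[OF RQ'[OF that], of 1]
        f.h.\<omega>_skew[OF f.hT RQ'[OF that], of 1 0] by (simp add: sum2)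
    show "dform (f.\<omega>' 0 1) y u v = - l * (f.\<theta>' 0 y u * f.\<theta>' 1 y v - f.\<theta>' 0 y v * f.\<theta>' 1 y u)" if "y \<in> R" for y u v
    proof -
      have "y \<in> p ` S'" using that interior_subset unfolding R_def by blast
      then obtain x where x: "x \<in> S'" "y = p x" by blast
      show ?thesis unfolding x(2) by (rule f.base_curvature[OF x(1)])
    qed
  qed blast
  have HH: "H y u u = (f.\<theta>' 0 y u)\<^sup>2 + (f.\<theta>' 1 y u)\<^sup>2" if "y \<in> Q'" for y u
    using f.h.frame_expand_G[OF f.hT that, of u u] by (simp add: sum2 power2_eq_square)
  have q1: "G x u u = H (p x) (D p x u) (D p x u) + cc_metric l (F x) (D F x u)" if x: "x \<in> W" for x u
  proof -
    have xS: "x \<in> S'" using x W by blast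
    have "G x u u = (f.\<theta> 0 x u)\<^sup>2 + (f.\<theta> 1 x u)\<^sup>2 + ((f.\<theta> 2 x u)\<^sup>2 + (f.\<theta> 3 x u)\<^sup>2)"
      using f.g.frame_expand_G[OF f.gT xS, of u u] by (simp add: sum4 power2_eq_square)
    then show ?thesis unfolding W(6)[OF x] HH[OF f.px[OF xS]]
      using f.\<theta>_lift[OF xS, of 0 u] f.\<theta>_lift[OF xS, of 1 u] by simp
  qed
  have q2: "H y u u = cc_metric l (F' y) (D F' y u)" if "y \<in> R'" for y u
    using HH[of y u] R'(6)[OF that] that R'(3) RQ by auto
  have sub: "R' \<subseteq> Q" "W \<subseteq> S" using R'(3) RQ *(3,4) W(3) by blast+
  show ?thesis
    by (rule that[OF W(1,2) sub(2) W(4,5) R'(1,2) sub(1) R'(4,5) q1 q2])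
qed

text \<open>Positivity of the metrics makes the differentials of F' and of (p, F) injective, so both
  maps are locally invertible. Setting \<sigma> to be F followed by the inverse of F' gives F = F' o
  \<sigma>, which turns the vertical part of the metric into the base metric pulled back by
  \<sigma>.\<close>

theorem local_splitting:
  assumes x0: "x0 \<in> S"
  obtains W Y1 Y2 \<sigma> \<Psi> where "open W" "x0 \<in> W" "W \<subseteq> S" "open Y1" "open Y2" "Y1 \<subseteq> Q" "Y2 \<subseteq> Q"
    "smooth_on W \<sigma>" "smooth_on (Y1 \<times> Y2) \<Psi>"
    "\<And>x. x \<in> W \<Longrightarrow> p x \<in> Y1 \<and> \<sigma> x \<in> Y2 \<and> \<Psi> (p x, \<sigma> x) = x"
    "\<And>y z. y \<in> Y1 \<Longrightarrow> z \<in> Y2 \<Longrightarrow> \<Psi> (y, z) \<in> W \<and> p (\<Psi> (y, z)) = y \<and> \<sigma> (\<Psi> (y, z)) = z"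
    "\<And>x u v. x \<in> W \<Longrightarrow> G x u v = H (p x) (D p x u) (D p x v) + H (\<sigma> x) (D \<sigma> x u) (D \<sigma> x v)"
proof -
  obtain A F R F' where A: "open A" "x0 \<in> A" "A \<subseteq> S" "smooth_on A F" "F x0 = (0, 0)"
    and R: "open R" "p x0 \<in> R" "R \<subseteq> Q" "smooth_on R F'" "F' (p x0) = (0, 0)"
    and GF: "\<And>x u. x \<in> A \<Longrightarrow> G x u u = H (p x) (D p x u) (D p x u) + cc_metric l (F x) (D F x u)"
    and HF: "\<And>y u. y \<in> R \<Longrightarrow> H y u u = cc_metric l (F' y) (D F' y u)"
    using local_developing_maps[OF x0] by metis
  have cc0: "cc_metric l f (0, 0) = 0" for f by (simp add: cc_metric_def)
  have "inj (D F' (p x0))"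
    unfolding linear_injective_0[OF smooth_on_linear_D[OF R(4,2)]]
  proof (intro allI impI)
    fix u assume "D F' (p x0) u = 0"
    then have "H (p x0) u u = 0" using HF[OF R(2), of u] cc0 by (simp add: zero_prod_def)
    then show "u = 0" using metric_onD(4)[OF MH, of "p x0" u] R by force
  qed
  moreover have "DIM('f) = DIM(real \<times> real)" by (simp add: dim)
  ultimately obtain R1 V1 g1 where R1: "open R1" "R1 \<subseteq> R" "p x0 \<in> R1" "open V1" "homeomorphism R1 V1 F' g1" "smooth_on V1 g1"
    using smooth_inverse_function_theorem[OF _ R(1,4,2)] by metis
  define \<Theta> where "\<Theta> x = (p x, F x)" for x
  have smA: "smooth_on A p" by (rule smooth_on_subset[OF smp A(3)])
  have sm\<Theta>: "smooth_on A \<Theta>" unfolding \<Theta>_def by (rule smooth_on_Pair[OF A(1) smA A(4)])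
  have D\<Theta>: "D \<Theta> x u = (D p x u, D F x u)" if "x \<in> A" for x u
    unfolding \<Theta>_def[abs_def]
    using D_eq[OF has_derivative_Pair[OF smooth_on_has_derivative[OF smA that] smooth_on_has_derivative[OF A(4) that]]] by simp
  have "inj (D \<Theta> x0)"
    unfolding linear_injective_0[OF smooth_on_linear_D[OF sm\<Theta> A(2)]]
  proof (intro allI impI)
    fix u assume "D \<Theta> x0 u = 0"
    then have "D p x0 u = 0" "D F x0 u = (0, 0)" by (auto simp: D\<Theta>[OF A(2)] zero_prod_def)
    moreover have "p x0 \<in> Q" using R by blast
    ultimately have "G x0 u u = 0" using GF[OF A(2), of u] cc0 metric_on_simps(9)[OF MH] by simp
    then show "u = 0" using metric_onD(4)[OF MG x0, of u] by force
  qed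
  moreover have "DIM('e) = DIM('f \<times> real \<times> real)" by (simp add: dim)
  ultimately obtain A1 V2 g2 where A1: "open A1" "A1 \<subseteq> A" "x0 \<in> A1" "open V2" "homeomorphism A1 V2 \<Theta> g2" "smooth_on V2 g2"
    using smooth_inverse_function_theorem[OF _ A(1) sm\<Theta> A(2)] by metis
  have h1: "F' y \<in> V1" "g1 (F' y) = y" if "y \<in> R1" for y using R1(5) that by (auto simp: homeomorphism_def)
  have h1': "g1 z \<in> R1" "F' (g1 z) = z" if "z \<in> V1" for z using R1(5) that by (auto simp: homeomorphism_def)
  have h2: "\<Theta> x \<in> V2" "g2 (\<Theta> x) = x" if "x \<in> A1" for x using A1(5) that by (auto simp: homeomorphism_def)
  have h2': "g2 z \<in> A1" "\<Theta> (g2 z) = z" if "z \<in> V2" for z using A1(5) that by (auto simp: homeomorphism_def)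
  have "open (V2 \<inter> (R \<times> V1))" by (intro open_Int open_Times A1(4) R(1) R1(4))
  moreover have "(p x0, F x0) \<in> V2 \<inter> (R \<times> V1)"
    using h2(1)[OF A1(3)] h1(1)[OF R1(3)] A(5) R(2,5) by (simp add: \<Theta>_def)
  \<comment> \<open>A box inside the image of \<open>\<Theta>\<close> makes \<open>W\<close>
    correspond to a full product; its second side is moved into the base by the inverse of
    F'.\<close>
  ultimately obtain Y1 Z where Y: "open Y1" "open Z" "(p x0, F x0) \<in> Y1 \<times> Z" "Y1 \<times> Z \<subseteq> V2 \<inter> (R \<times> V1)"
    by (rule open_prod_elim)
  define W where "W = A1 \<inter> \<Theta> -` (Y1 \<times> Z)"
  define Y2 where "Y2 = R1 \<inter> F' -` Z"
  define \<sigma> where "\<sigma> x = g1 (F x)" for x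
  define \<Psi> where "\<Psi> yz = g2 (fst yz, F' (snd yz))" for yz
  have oW: "open W" unfolding W_def
    by (rule continuous_open_preimage[OF continuous_on_subset[OF smooth_on_continuous[OF sm\<Theta>] A1(2)] A1(1) open_Times[OF Y(1,2)]])
  have x0W: "x0 \<in> W" using A1(3) Y(3) by (simp add: W_def \<Theta>_def)
  have WA: "W \<subseteq> A" using A1(2) by (auto simp: W_def)
  have oY2: "open Y2" unfolding Y2_def
    by (rule continuous_open_preimage[OF continuous_on_subset[OF smooth_on_continuous[OF R(4)] R1(2)] R1(1) Y(2)])
  have Z: "Z \<subseteq> V1" "Y1 \<subseteq> R" using Y(3,4) by auto
  have FW: "F ` W \<subseteq> V1" using Z by (auto simp: W_def \<Theta>_def)
  have sm\<sigma>: "smooth_on W \<sigma>" unfolding \<sigma>_def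
    by (rule smooth_on_compose[OF oW R1(4) smooth_on_subset[OF A(4) WA] R1(6) FW])
  have YR: "Y2 \<subseteq> R" using R1(2) by (auto simp: Y2_def)
  have oYY: "open (Y1 \<times> Y2)" by (rule open_Times[OF Y(1) oY2])
  have "smooth_on (Y1 \<times> Y2) (\<lambda>yz. (fst yz, F' (snd yz)))"
    by (intro smooth_on_Pair smooth_on_fst smooth_on_ident oYY smooth_on_compose[OF oYY R(1) smooth_on_snd[OF oYY smooth_on_ident] R(4)])
      (use YR in auto)
  then have sm\<Psi>: "smooth_on (Y1 \<times> Y2) \<Psi>" unfolding \<Psi>_def
    by (rule smooth_on_compose[OF oYY A1(4) _ A1(6)]) (use Y(4) in \<open>auto simp: Y2_def\<close>)
  have 1: "p x \<in> Y1 \<and> \<sigma> x \<in> Y2 \<and> \<Psi> (p x, \<sigma> x) = x" if x: "x \<in> W" for x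
  proof -
    have *: "p x \<in> Y1" "F x \<in> Z" "x \<in> A1" using x by (auto simp: W_def \<Theta>_def)
    then have "F x \<in> V1" using Z by blast
    then show ?thesis using * h1'[of "F x"] h2(2)[of x] by (simp add: \<sigma>_def Y2_def \<Psi>_def \<Theta>_def)
  qed
  have 2: "\<Psi> (y, z) \<in> W \<and> p (\<Psi> (y, z)) = y \<and> \<sigma> (\<Psi> (y, z)) = z" if y: "y \<in> Y1" and z: "z \<in> Y2" for y z
  proof -
    have Fz: "F' z \<in> Z" "z \<in> R1" using z by (auto simp: Y2_def)
    then have "(y, F' z) \<in> V2" using y Y(4) by auto
    from h2'[OF this] show ?thesis using y Fz h1(2)[OF Fz(2)] by (auto simp: W_def \<Psi>_def \<Theta>_def \<sigma>_def)
  qed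
  have q: "G x u u = H (p x) (D p x u) (D p x u) + H (\<sigma> x) (D \<sigma> x u) (D \<sigma> x u)" if x: "x \<in> W" for x u
  proof -
    have \<sigma>R: "\<sigma> x \<in> R" using 1[OF x] YR by blast
    have F\<sigma>: "F' (\<sigma> y) = F y" if "y \<in> W" for y using h1'(2)[of "F y"] FW that by (auto simp: \<sigma>_def)
    have "((\<lambda>y. F' (\<sigma> y)) has_derivative (\<lambda>u. D F' (\<sigma> x) (D \<sigma> x u))) (at x)"
      by (rule has_derivative_compose[OF smooth_on_has_derivative[OF sm\<sigma> x] smooth_on_has_derivative[OF R(4) \<sigma>R]])
    then have "D F x u = D F' (\<sigma> x) (D \<sigma> x u)"
      using D_cong[OF oW x, of "\<lambda>y. F' (\<sigma> y)" F] F\<sigma> D_eq by metis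
    then show ?thesis using GF[of x u] HF[OF \<sigma>R, of "D \<sigma> x u"] F\<sigma>[OF x] x WA by auto
  qed
  \<comment> \<open>The developing maps determine squared lengths only; the inner product follows by
    polarization.\<close>
  have 3: "G x u v = H (p x) (D p x u) (D p x v) + H (\<sigma> x) (D \<sigma> x u) (D \<sigma> x v)" if x: "x \<in> W" for x u v
  proof -
    have xS: "x \<in> S" using x WA A by blast
    have pQ: "p x \<in> Q" "\<sigma> x \<in> Q" using 1[OF x] YR R(3) Z by blast+
    have "linear (D p x)" "linear (D \<sigma> x)" using smooth_on_linear_D[OF smp xS] smooth_on_linear_D[OF sm\<sigma> x] by auto
    then show ?thesis
      using q[OF x, of "u + v"] q[OF x, of u] q[OF x, of v] metric_onD(3)[OF MG xS, of v u]
        metric_onD(3)[OF MH pQ(1), of "D p x v" "D p x u"] metric_onD(3)[OF MH pQ(2), of "D \<sigma> x v" "D \<sigma> x u"]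
      by (simp add: linear_add metric_on_simps[OF MG xS] metric_on_simps[OF MH pQ(1)] metric_on_simps[OF MH pQ(2)])
  qed
  have sub: "W \<subseteq> S" "Y1 \<subseteq> Q" "Y2 \<subseteq> Q" using WA A(3) Z YR R(3) by blast+
  show ?thesis
    by (rule that[OF oW x0W sub(1) Y(1) oY2 sub(2,3) sm\<sigma> sm\<Psi> 1 2 3])
qed

end

section \<open>Charts\<close>

lemma chart_onI:
  assumes A: "openin X A" "inj_on \<phi> A"
    and op: "\<And>U. openin X U \<Longrightarrow> U \<subseteq> A \<Longrightarrow> open (\<phi> ` U)"
    and cont: "\<And>V. open V \<Longrightarrow> openin X {x \<in> A. \<phi> x \<in> V}"
  shows "chart_on X A \<phi>"
proof -
  have o: "open (\<phi> ` A)" using op[OF A(1)] by simp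
  have ts: "topspace (subtopology X A) = A" using openin_subset[OF A(1)] by auto
  have "homeomorphic_map (subtopology X A) (top_of_set (\<phi> ` A)) \<phi>"
  proof (rule bijective_open_imp_homeomorphic_map)
    show "continuous_map (subtopology X A) (top_of_set (\<phi> ` A)) \<phi>"
      unfolding continuous_map_def ts
      using cont A(1) o by (auto simp: openin_open_subtopology openin_open_eq)
    show "open_map (subtopology X A) (top_of_set (\<phi> ` A)) \<phi>"
      unfolding open_map_def openin_open_subtopology[OF A(1)]
      using op o by (auto simp: openin_open_eq)
  qed (use A(2) ts in auto)
  then show ?thesis using A(1) o by (simp add: chart_on_def)
qed

context
  fixes X :: "'a topology" and A and \<phi> :: "'a \<Rightarrow> 'e::euclidean_space"
  assumes c: "chart_on X A \<phi>"
begin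

lemma chart_openin: "openin X A" and chart_open: "open (\<phi> ` A)"
  using c by (simp_all add: chart_on_def)

lemma chart_subset: "A \<subseteq> topspace X" using openin_subset[OF chart_openin] .

lemma chart_topspace: "topspace (subtopology X A) = A" using chart_subset by auto

lemma chart_inj: "inj_on \<phi> A"
  using c homeomorphic_imp_injective_map[of "subtopology X A" _ \<phi>] chart_topspace by (auto simp: chart_on_def)

lemma chart_inv: "x \<in> A \<Longrightarrow> inv_into A \<phi> (\<phi> x) = x"
  using chart_inj by simp

lemma chart_open_image: "openin X U \<Longrightarrow> U \<subseteq> A \<Longrightarrow> open (\<phi> ` U)"
  using c homeomorphic_imp_open_map[of "subtopology X A" "top_of_set (\<phi> ` A)" \<phi>]
  by (auto simp: chart_on_def open_map_def openin_open_subtopology openin_open_eq)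

lemma chart_open_preimage: "open V \<Longrightarrow> openin X {x \<in> A. \<phi> x \<in> V}"
proof -
  assume V: "open V"
  have "continuous_map (subtopology X A) (top_of_set (\<phi> ` A)) \<phi>"
    using c homeomorphic_imp_continuous_map unfolding chart_on_def by blast
  then have "openin (subtopology X A) {x \<in> topspace (subtopology X A). \<phi> x \<in> \<phi> ` A \<inter> V}"
    by (rule openin_continuous_map_preimage[OF _ openin_open_Int[OF V]])
  then have "openin X {x \<in> A. \<phi> x \<in> \<phi> ` A \<inter> V}"
    unfolding chart_topspace openin_open_subtopology[OF chart_openin] by blast
  moreover have "{x \<in> A. \<phi> x \<in> \<phi> ` A \<inter> V} = {x \<in> A. \<phi> x \<in> V}" by auto
  ultimately show ?thesis by simp
qed

end

definition smooth_atlas :: "('a, 'e::euclidean_space) riem \<Rightarrow> bool" where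
  "smooth_atlas M \<longleftrightarrow> (\<forall>(A, \<phi>)\<in>charts M. chart_on (mtop M) A \<phi>) \<and>
     (\<forall>a\<in>charts M. \<forall>b\<in>charts M. smooth_transition a b)"

text \<open>The compatibility part of \<open>riemannian_manifold\<close>, isolated so that it can be
  carried over to \<open>riem_product\<close>, the target of the splitting isometry.\<close>

definition metric_atlas :: "('a, 'e::euclidean_space) riem \<Rightarrow> bool" where
  "metric_atlas M \<longleftrightarrow> smooth_atlas M \<and>
     (\<forall>(A, \<phi>)\<in>charts M. \<forall>(B, \<psi>)\<in>charts M. \<forall>p\<in>A \<inter> B. \<forall>v w.
        riem_metric M \<phi> p v w =
        riem_metric M \<psi> p (coord_diff A \<phi> \<psi> id p v) (coord_diff A \<phi> \<psi> id p w))"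

lemma riemannian_manifold_metric_atlas: "riemannian_manifold M \<Longrightarrow> metric_atlas M"
  unfolding riemannian_manifold_def metric_atlas_def smooth_atlas_def smooth_manifold_def
  by (elim conjE, intro conjI; assumption)

lemma metric_atlasD:
  assumes "metric_atlas M"
  shows "smooth_atlas M" "(A, \<phi>) \<in> charts M \<Longrightarrow> (B, \<psi>) \<in> charts M \<Longrightarrow> p \<in> A \<Longrightarrow> p \<in> B \<Longrightarrow>
    riem_metric M \<phi> p v w = riem_metric M \<psi> p (coord_diff A \<phi> \<psi> id p v) (coord_diff A \<phi> \<psi> id p w)"
proof -
  show "smooth_atlas M" using assms by (simp add: metric_atlas_def)
  assume a: "(A, \<phi>) \<in> charts M" and b: "(B, \<psi>) \<in> charts M" and p: "p \<in> A" "p \<in> B"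
  note 1 = assms[unfolded metric_atlas_def, THEN conjunct2]
  note 2 = bspec[OF 1 a, unfolded prod.case]
  note 3 = bspec[OF 2 b, unfolded prod.case]
  show "riem_metric M \<phi> p v w = riem_metric M \<psi> p (coord_diff A \<phi> \<psi> id p v) (coord_diff A \<phi> \<psi> id p w)"
    using 3 p by simp
qed

lemma metric_atlasI:
  assumes "smooth_atlas M" "\<And>A \<phi> B \<psi> p v w. (A, \<phi>) \<in> charts M \<Longrightarrow> (B, \<psi>) \<in> charts M \<Longrightarrow> p \<in> A \<Longrightarrow> p \<in> B \<Longrightarrow>
    riem_metric M \<phi> p v w = riem_metric M \<psi> p (coord_diff A \<phi> \<psi> id p v) (coord_diff A \<phi> \<psi> id p w)"
  shows "metric_atlas M"
  unfolding metric_atlas_def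
proof (intro conjI assms(1), clarify)
  fix A \<phi> B \<psi> p v w
  assume "(A, \<phi>) \<in> charts M" "(B, \<psi>) \<in> charts M" "p \<in> A" "p \<in> B"
  then show "riem_metric M \<phi> p v w = riem_metric M \<psi> p (coord_diff A \<phi> \<psi> id p v) (coord_diff A \<phi> \<psi> id p w)"
    using assms(2) by blast
qed

lemma smooth_atlasD:
  assumes "smooth_atlas M" "(A, \<phi>) \<in> charts M"
  shows "chart_on (mtop M) A \<phi>"
    "(B, \<psi>) \<in> charts M \<Longrightarrow> smooth_on (\<phi> ` (A \<inter> B)) (\<lambda>x. \<psi> (inv_into A \<phi> x))"
  using assms unfolding smooth_atlas_def smooth_transition_def by (fastforce simp: o_def)+

lemma chart_overlap_open:
  assumes "smooth_atlas M" "(A, \<phi>) \<in> charts M" "(B, \<psi>) \<in> charts M"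
  shows "open (\<phi> ` (A \<inter> B))"
  using assms chart_openin smooth_atlasD(1) by (intro chart_open_image[of "mtop M"]) blast+

section \<open>Maps given in charts\<close>

lemma continuous_map_from_chart:
  assumes X: "chart_on X A \<phi>" and Y: "chart_on Y C \<psi>"
    and U: "openin X U" "U \<subseteq> A" "f ` U \<subseteq> C"
    and c: "continuous_on (\<phi> ` U) (\<psi> \<circ> f \<circ> inv_into A \<phi>)"
  shows "continuous_map (subtopology X U) Y f"
proof -
  have ts: "topspace (subtopology X U) = U" using openin_subset[OF U(1)] by auto
  have "openin (subtopology X U) {x \<in> U. f x \<in> W}" if W: "openin Y W" for W
  proof -
    have "open (\<psi> ` (C \<inter> W))" by (rule chart_open_image[OF Y]) (use W chart_openin[OF Y] in auto)
    then have "open (\<phi> ` U \<inter> (\<psi> \<circ> f \<circ> inv_into A \<phi>) -` (\<psi> ` (C \<inter> W)))"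
      by (rule continuous_open_preimage[OF c chart_open_image[OF X U(1,2)]])
    from chart_open_preimage[OF X this]
    have "openin X {x \<in> A. \<phi> x \<in> \<phi> ` U \<inter> (\<psi> \<circ> f \<circ> inv_into A \<phi>) -` (\<psi> ` (C \<inter> W))}" .
    moreover have "{x \<in> A. \<phi> x \<in> \<phi> ` U \<inter> (\<psi> \<circ> f \<circ> inv_into A \<phi>) -` (\<psi> ` (C \<inter> W))} = {x \<in> U. f x \<in> W}"
    proof (intro set_eqI iffI)
      fix x assume "x \<in> {x \<in> A. \<phi> x \<in> \<phi> ` U \<inter> (\<psi> \<circ> f \<circ> inv_into A \<phi>) -` (\<psi> ` (C \<inter> W))}"
      then have x: "x \<in> A" "\<phi> x \<in> \<phi> ` U" "\<psi> (f (inv_into A \<phi> (\<phi> x))) \<in> \<psi> ` (C \<inter> W)" by auto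
      then have xU: "x \<in> U" using chart_inj[OF X] U(2) by (auto simp: inj_on_def)
      have "\<psi> (f x) \<in> \<psi> ` (C \<inter> W)" using x(3) chart_inv[OF X x(1)] by simp
      moreover have "f x \<in> C" using U xU by auto
      ultimately show "x \<in> {x \<in> U. f x \<in> W}" using xU chart_inj[OF Y] by (auto simp: inj_on_def)
    next
      fix x assume "x \<in> {x \<in> U. f x \<in> W}"
      then show "x \<in> {x \<in> A. \<phi> x \<in> \<phi> ` U \<inter> (\<psi> \<circ> f \<circ> inv_into A \<phi>) -` (\<psi> ` (C \<inter> W))}"
        using U chart_inv[OF X, of x] subsetD[OF U(2), of x] by auto
    qed
    ultimately show ?thesis unfolding openin_open_subtopology[OF U(1)] by auto
  qed
  then show ?thesis unfolding continuous_map_def ts using U(3) chart_subset[OF Y] by auto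
qed

text \<open>In the new charts the map is \<open>k\<close> after \<open>r\<close> after
  \<open>t\<close>, with \<open>t\<close> and \<open>k\<close> transition maps, so both claims
  follow from the chain rule.\<close>

lemma smooth_change_charts:
  assumes X: "smooth_atlas X" "(A, \<phi>) \<in> charts X" "(A', \<phi>') \<in> charts X"
    and Y: "smooth_atlas Y" "(C, \<psi>) \<in> charts Y" "(C', \<psi>') \<in> charts Y"
    and U: "openin (mtop X) U" "U \<subseteq> A \<inter> A'" "f ` U \<subseteq> C \<inter> C'"
    and s: "smooth_on (\<phi> ` U) (\<psi> \<circ> f \<circ> inv_into A \<phi>)"
  shows "smooth_on (\<phi>' ` U) (\<psi>' \<circ> f \<circ> inv_into A' \<phi>')"
    and "p \<in> U \<Longrightarrow> coord_diff A' \<phi>' \<psi>' f p v =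
      coord_diff C \<psi> \<psi>' id (f p) (coord_diff A \<phi> \<psi> f p (coord_diff A' \<phi>' \<phi> id p v))"
proof -
  note cX = smooth_atlasD(1)[OF X(1,2)] smooth_atlasD(1)[OF X(1,3)]
  note cY = smooth_atlasD(1)[OF Y(1,2)] smooth_atlasD(1)[OF Y(1,3)]
  have o: "open (\<phi> ` U)" "open (\<phi>' ` U)" using chart_open_image[OF cX(1) U(1)] chart_open_image[OF cX(2) U(1)] U(2) by auto
  have oC: "open (\<psi> ` (C \<inter> C'))" by (rule chart_overlap_open[OF Y])
  have invA: "inv_into A \<phi> (\<phi> x) = x" "inv_into A' \<phi>' (\<phi>' x) = x" if "x \<in> U" for x
    using chart_inv[OF cX(1)] chart_inv[OF cX(2)] that U(2) by auto
  have invC: "inv_into C \<psi> (\<psi> (f x)) = f x" if "x \<in> U" for x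
    using chart_inv[OF cY(1)] that U(3) by auto
  define t where "t x = \<phi> (inv_into A' \<phi>' x)" for x
  define r where "r x = \<psi> (f (inv_into A \<phi> x))" for x
  define k where "k x = \<psi>' (inv_into C \<psi> x)" for x
  have st: "smooth_on (\<phi>' ` U) t"
    unfolding t_def by (rule smooth_on_subset[OF smooth_atlasD(2)[OF X(1,3,2)]]) (use U(2) in auto)
  have sr: "smooth_on (\<phi> ` U) r" using s by (simp add: r_def[abs_def] o_def)
  have sk: "smooth_on (\<psi> ` (C \<inter> C')) k" unfolding k_def by (rule smooth_atlasD(2)[OF Y])
  have tU: "t ` (\<phi>' ` U) \<subseteq> \<phi> ` U" using invA by (auto simp: t_def)
  have rU: "r ` (\<phi> ` U) \<subseteq> \<psi> ` (C \<inter> C')" using invA U(3) by (force simp: r_def)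
  have eq: "k (r (t x)) = (\<psi>' \<circ> f \<circ> inv_into A' \<phi>') x" if "x \<in> \<phi>' ` U" for x
    using that invA invC by (auto simp: k_def r_def t_def)
  have srt: "smooth_on (\<phi>' ` U) (\<lambda>x. r (t x))" by (rule smooth_on_compose[OF o(2,1) st sr tU])
  have "smooth_on (\<phi>' ` U) (\<lambda>x. k (r (t x)))"
    by (rule smooth_on_compose[OF o(2) oC srt sk]) (use tU rU in blast)
  then show "smooth_on (\<phi>' ` U) (\<psi>' \<circ> f \<circ> inv_into A' \<phi>')"
    by (rule smooth_on_cong[OF o(2)]) (rule eq)
  assume p: "p \<in> U"
  have tp: "t (\<phi>' p) = \<phi> p" and rp: "r (\<phi> p) = \<psi> (f p)" using invA[OF p] by (simp_all add: t_def r_def)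
  have "((\<lambda>x. k (r (t x))) has_derivative (\<lambda>v. D k (\<psi> (f p)) (D r (\<phi> p) (D t (\<phi>' p) v)))) (at (\<phi>' p))"
  proof -
    have 1: "(t has_derivative D t (\<phi>' p)) (at (\<phi>' p))" by (rule smooth_on_has_derivative[OF st]) (use p in auto)
    have 2: "(r has_derivative D r (\<phi> p)) (at (t (\<phi>' p)))" unfolding tp by (rule smooth_on_has_derivative[OF sr]) (use p in auto)
    have 3: "(k has_derivative D k (\<psi> (f p))) (at (r (t (\<phi>' p))))" unfolding tp rp
      by (rule smooth_on_has_derivative[OF sk]) (use p U(3) in auto)
    show ?thesis by (rule has_derivative_compose[OF has_derivative_compose[OF 1 2] 3])
  qed
  then have "D (\<lambda>x. k (r (t x))) (\<phi>' p) v = D k (\<psi> (f p)) (D r (\<phi> p) (D t (\<phi>' p) v))" by (simp add: D_eq)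
  moreover have "D (\<lambda>x. k (r (t x))) (\<phi>' p) = D (\<psi>' \<circ> f \<circ> inv_into A' \<phi>') (\<phi>' p)"
    by (rule D_cong[OF o(2) _ eq]) (use p in auto)
  ultimately show "coord_diff A' \<phi>' \<psi>' f p v =
      coord_diff C \<psi> \<psi>' id (f p) (coord_diff A \<phi> \<psi> f p (coord_diff A' \<phi>' \<phi> id p v))"
    by (simp add: coord_diff_def k_def[abs_def] r_def[abs_def] t_def[abs_def] o_def)
qed

lemma smooth_map_onI_chart:
  assumes X: "smooth_atlas X" "(A, \<phi>) \<in> charts X" and Y: "smooth_atlas Y" "(C, \<psi>) \<in> charts Y"
    and U: "openin (mtop X) U" "U \<subseteq> A" "f ` U \<subseteq> C"
    and s: "smooth_on (\<phi> ` U) (\<psi> \<circ> f \<circ> inv_into A \<phi>)"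
  shows "smooth_map_on X U Y f" 
    and "(A', \<phi>') \<in> charts X \<Longrightarrow> (C', \<psi>') \<in> charts Y \<Longrightarrow> openin (mtop X) (U \<inter> A' \<inter> f -` C')"
proof -
  note cX = smooth_atlasD(1)[OF X] and cY = smooth_atlasD(1)[OF Y]
  have c: "continuous_map (subtopology (mtop X) U) (mtop Y) f"
    by (rule continuous_map_from_chart[OF cX cY U smooth_on_continuous[OF s]])
  have op: "openin (mtop X) (U \<inter> A' \<inter> f -` C')" if "(A', \<phi>') \<in> charts X" "(C', \<psi>') \<in> charts Y" for A' \<phi>' C' \<psi>'
  proof -
    have "openin (subtopology (mtop X) U) {x \<in> topspace (subtopology (mtop X) U). f x \<in> C'}"
      by (rule openin_continuous_map_preimage[OF c chart_openin[OF smooth_atlasD(1)[OF Y(1) that(2)]]])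
    moreover have "{x \<in> topspace (subtopology (mtop X) U). f x \<in> C'} = U \<inter> f -` C'"
      using openin_subset[OF U(1)] by auto
    ultimately have "openin (mtop X) (U \<inter> f -` C')" using openin_open_subtopology[OF U(1)] by simp
    moreover have "openin (mtop X) A'" by (rule chart_openin[OF smooth_atlasD(1)[OF X(1) that(1)]])
    moreover have "U \<inter> A' \<inter> f -` C' = (U \<inter> f -` C') \<inter> A'" by blast
    ultimately show ?thesis by (simp add: openin_Int)
  qed
  then show "(A', \<phi>') \<in> charts X \<Longrightarrow> (C', \<psi>') \<in> charts Y \<Longrightarrow> openin (mtop X) (U \<inter> A' \<inter> f -` C')" .
  have "smooth_on (\<phi>' ` (U \<inter> A' \<inter> f -` C')) (\<psi>' \<circ> f \<circ> inv_into A' \<phi>')"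
    if "(A', \<phi>') \<in> charts X" "(C', \<psi>') \<in> charts Y" for A' \<phi>' C' \<psi>'
    by (rule smooth_change_charts(1)[OF X that(1) Y that(2) op[OF that] _ _ smooth_on_subset[OF s]]) (use U in auto)
  then show "smooth_map_on X U Y f" using U(1) c unfolding smooth_map_on_def by blast
qed

text \<open>\<open>isometry_on\<close> quantifies over all pairs of charts. Coordinate derivatives
  and both metrics transform compatibly, so one pair covering \<open>U\<close> and \<open>V\<close>
  decides.\<close>

lemma isometry_onI_chart:
  assumes X: "metric_atlas X" "(A, \<phi>) \<in> charts X" and Y: "metric_atlas Y" "(C, \<psi>) \<in> charts Y"
    and U: "openin (mtop X) U" "U \<subseteq> A" and V: "openin (mtop Y) V" "V \<subseteq> C"
    and f: "bij_betw f U V"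
    and s: "smooth_on (\<phi> ` U) (\<psi> \<circ> f \<circ> inv_into A \<phi>)"
    and s': "smooth_on (\<psi> ` V) (\<phi> \<circ> inv_into U f \<circ> inv_into C \<psi>)"
    and m: "\<And>p v w. p \<in> U \<Longrightarrow> riem_metric X \<phi> p v w = riem_metric Y \<psi> (f p) (coord_diff A \<phi> \<psi> f p v) (coord_diff A \<phi> \<psi> f p w)"
  shows "isometry_on X U Y V f"
proof -
  note aX = metric_atlasD(1)[OF X(1)] and aY = metric_atlasD(1)[OF Y(1)]
  have fU: "f ` U = V" using f by (simp add: bij_betw_def)
  have gV: "inv_into U f ` V = U" using bij_betw_inv_into[OF f] by (simp add: bij_betw_def)
  have fC: "f ` U \<subseteq> C" and gA: "inv_into U f ` V \<subseteq> A" using fU gV U V by auto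
  have "riem_metric X \<phi>' p v w = riem_metric Y \<psi>' (f p) (coord_diff A' \<phi>' \<psi>' f p v) (coord_diff A' \<phi>' \<psi>' f p w)"
    if c: "(A', \<phi>') \<in> charts X" "(C', \<psi>') \<in> charts Y" and p: "p \<in> U \<inter> A' \<inter> f -` C'" for A' \<phi>' C' \<psi>' p v w
  proof -
    let ?U = "U \<inter> A' \<inter> f -` C'"
    have o: "openin (mtop X) ?U" by (rule smooth_map_onI_chart(2)[OF aX X(2) aY Y(2) U fC s c])
    have ch: "coord_diff A' \<phi>' \<psi>' f p v =
      coord_diff C \<psi> \<psi>' id (f p) (coord_diff A \<phi> \<psi> f p (coord_diff A' \<phi>' \<phi> id p v))" for v
      by (rule smooth_change_charts(2)[OF aX X(2) c(1) aY Y(2) c(2) o _ _ smooth_on_subset[OF s] p]) (use U(2) fC in auto)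
    have "riem_metric X \<phi>' p v w = riem_metric X \<phi> p (coord_diff A' \<phi>' \<phi> id p v) (coord_diff A' \<phi>' \<phi> id p w)"
      by (rule metric_atlasD(2)[OF X(1) c(1) X(2)]) (use p U(2) in auto)
    also have "\<dots> = riem_metric Y \<psi> (f p) (coord_diff A \<phi> \<psi> f p (coord_diff A' \<phi>' \<phi> id p v))
       (coord_diff A \<phi> \<psi> f p (coord_diff A' \<phi>' \<phi> id p w))"
      by (rule m) (use p in auto)
    also have "\<dots> = riem_metric Y \<psi>' (f p) (coord_diff A' \<phi>' \<psi>' f p v) (coord_diff A' \<phi>' \<psi>' f p w)"
      unfolding ch by (rule metric_atlasD(2)[OF Y c(2)]) (use p fC in auto)
    finally show ?thesis .
  qed
  then show ?thesis
    unfolding isometry_on_def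
    using f smooth_map_onI_chart(1)[OF aX X(2) aY Y(2) U fC s] smooth_map_onI_chart(1)[OF aY Y(2) aX X(2) V gA s']
    by blast
qed

section \<open>Products\<close>

lemma chart_on_product:
  assumes X: "chart_on X A \<phi>" and Y: "chart_on Y C \<psi>"
  shows "chart_on (prod_topology X Y) (A \<times> C) (map_prod \<phi> \<psi>)"
proof (rule chart_onI)
  show "openin (prod_topology X Y) (A \<times> C)"
    using chart_openin[OF X] chart_openin[OF Y] by (simp add: openin_prod_Times_iff)
  show "inj_on (map_prod \<phi> \<psi>) (A \<times> C)"
    using chart_inj[OF X] chart_inj[OF Y] by (auto simp: inj_on_def)
  show "open (map_prod \<phi> \<psi> ` U)" if U: "openin (prod_topology X Y) U" "U \<subseteq> A \<times> C" for U
  proof (rule Topological_Spaces.openI)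
    fix z assume "z \<in> map_prod \<phi> \<psi> ` U"
    then obtain a b where ab: "(a, b) \<in> U" "z = (\<phi> a, \<psi> b)" by auto
    then obtain P Q where PQ: "openin X P" "openin Y Q" "a \<in> P" "b \<in> Q" "P \<times> Q \<subseteq> U"
      using U(1)[unfolded openin_prod_topology_alt, rule_format, OF ab(1)] by blast
    have "a \<in> A" "b \<in> C" using ab U(2) by auto
    then have "P \<subseteq> A" "Q \<subseteq> C" using PQ U(2) by auto
    then have "open (\<phi> ` P \<times> \<psi> ` Q)"
      using chart_open_image[OF X PQ(1)] chart_open_image[OF Y PQ(2)] open_Times by blast
    moreover have "\<phi> ` P \<times> \<psi> ` Q \<subseteq> map_prod \<phi> \<psi> ` U" using PQ(5) by force
    ultimately show "\<exists>T. open T \<and> z \<in> T \<and> T \<subseteq> map_prod \<phi> \<psi> ` U" using ab(2) PQ(3,4) by blast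
  qed
  show "openin (prod_topology X Y) {x \<in> A \<times> C. map_prod \<phi> \<psi> x \<in> V}" if V: "open V" for V
    unfolding openin_prod_topology_alt
  proof (intro allI impI)
    fix a b assume "(a, b) \<in> {x \<in> A \<times> C. map_prod \<phi> \<psi> x \<in> V}"
    then have ab: "a \<in> A" "b \<in> C" "(\<phi> a, \<psi> b) \<in> V" by auto
    then obtain P Q where PQ: "open P" "open Q" "(\<phi> a, \<psi> b) \<in> P \<times> Q" "P \<times> Q \<subseteq> V"
      using open_prod_elim[OF V] by metis
    show "\<exists>U W. openin X U \<and> openin Y W \<and> a \<in> U \<and> b \<in> W \<and> U \<times> W \<subseteq> {x \<in> A \<times> C. map_prod \<phi> \<psi> x \<in> V}"
      by (rule exI[of _ "{x \<in> A. \<phi> x \<in> P}"], rule exI[of _ "{x \<in> C. \<psi> x \<in> Q}"])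
        (use chart_open_preimage[OF X PQ(1)] chart_open_preimage[OF Y PQ(2)] PQ ab in auto)
  qed
qed

lemma inv_into_map_prod:
  assumes "inj_on \<phi> A" "inj_on \<psi> C" "x \<in> \<phi> ` A" "y \<in> \<psi> ` C"
  shows "inv_into (A \<times> C) (map_prod \<phi> \<psi>) (x, y) = (inv_into A \<phi> x, inv_into C \<psi> y)"
proof -
  have "inj_on (map_prod \<phi> \<psi>) (A \<times> C)" using assms by (auto simp: inj_on_def)
  then have "inv_into (A \<times> C) (map_prod \<phi> \<psi>) (map_prod \<phi> \<psi> (a, b)) = (a, b)" if "a \<in> A" "b \<in> C" for a b
    using that by (intro inv_into_f_f) auto
  then show ?thesis using assms by auto
qed

text \<open>Transition maps of product charts act on the two components separately, hence so do
  their derivatives, and the two summands of the metric transform independently.\<close>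

lemma metric_atlas_product:
  assumes M: "metric_atlas M" and N: "metric_atlas N"
  shows "metric_atlas (riem_product M N)"
proof -
  note aM = metric_atlasD(1)[OF M] and aN = metric_atlasD(1)[OF N]
  have ch: "charts (riem_product M N) = {(A \<times> B, map_prod \<phi> \<psi>) | A \<phi> B \<psi>. (A, \<phi>) \<in> charts M \<and> (B, \<psi>) \<in> charts N}"
    and top: "mtop (riem_product M N) = prod_topology (mtop M) (mtop N)"
    by (simp_all add: riem_product_def)
  have rep: "smooth_on (map_prod \<phi> \<psi> ` (A \<times> B \<inter> A' \<times> B')) (map_prod \<phi>' \<psi>' \<circ> inv_into (A \<times> B) (map_prod \<phi> \<psi>))
     \<and> (\<forall>a\<in>A \<inter> A'. \<forall>b\<in>B \<inter> B'. \<forall>v v'. coord_diff (A \<times> B) (map_prod \<phi> \<psi>) (map_prod \<phi>' \<psi>') id (a, b) (v, v')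
         = (coord_diff A \<phi> \<phi>' id a v, coord_diff B \<psi> \<psi>' id b v'))"
    if c: "(A, \<phi>) \<in> charts M" "(A', \<phi>') \<in> charts M" "(B, \<psi>) \<in> charts N" "(B', \<psi>') \<in> charts N" for A \<phi> A' \<phi>' B \<psi> B' \<psi>'
  proof -
    define t where "t x = \<phi>' (inv_into A \<phi> x)" for x
    define s where "s x = \<psi>' (inv_into B \<psi> x)" for x
    let ?P = "\<phi> ` (A \<inter> A')" and ?Q = "\<psi> ` (B \<inter> B')"
    have im: "map_prod \<phi> \<psi> ` (A \<times> B \<inter> A' \<times> B') = ?P \<times> ?Q" by force
    have oPQ: "open (?P \<times> ?Q)" "open ?P" "open ?Q"
      using chart_overlap_open[OF aM c(1,2)] chart_overlap_open[OF aN c(3,4)] open_Times by blast+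
    have st: "smooth_on ?P t" "smooth_on ?Q s"
      using smooth_atlasD(2)[OF aM c(1,2)] smooth_atlasD(2)[OF aN c(3,4)] by (simp_all add: t_def[abs_def] s_def[abs_def])
    have eq: "(t (fst z), s (snd z)) = (map_prod \<phi>' \<psi>' \<circ> inv_into (A \<times> B) (map_prod \<phi> \<psi>)) z" if z: "z \<in> ?P \<times> ?Q" for z
      using inv_into_map_prod[OF chart_inj[OF smooth_atlasD(1)[OF aM c(1)]] chart_inj[OF smooth_atlasD(1)[OF aN c(3)]], of "fst z" "snd z"] z
      by (auto simp: t_def s_def)
    have "smooth_on (?P \<times> ?Q) (\<lambda>z. (t (fst z), s (snd z)))"
      by (intro smooth_on_Pair oPQ smooth_on_compose[OF oPQ(1,2) smooth_on_fst[OF oPQ(1) smooth_on_ident] st(1)]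
        smooth_on_compose[OF oPQ(1,3) smooth_on_snd[OF oPQ(1) smooth_on_ident] st(2)]) auto
    then have 1: "smooth_on (?P \<times> ?Q) (map_prod \<phi>' \<psi>' \<circ> inv_into (A \<times> B) (map_prod \<phi> \<psi>))"
      by (rule smooth_on_cong[OF oPQ(1)]) (rule eq)
    have "coord_diff (A \<times> B) (map_prod \<phi> \<psi>) (map_prod \<phi>' \<psi>') id (a, b) (v, v')
         = (coord_diff A \<phi> \<phi>' id a v, coord_diff B \<psi> \<psi>' id b v')" if ab: "a \<in> A \<inter> A'" "b \<in> B \<inter> B'" for a b v v'
    proof -
      let ?z = "(\<phi> a, \<psi> b)"
      have f: "((\<lambda>z. t (fst z)) has_derivative (\<lambda>h. D t (\<phi> a) (fst h))) (at ?z)"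
        using has_derivative_compose[OF has_derivative_fst[OF has_derivative_ident], of t "D t (\<phi> a)" ?z UNIV]
          smooth_on_has_derivative[OF st(1), of "\<phi> a"] ab by auto
      have g: "((\<lambda>z. s (snd z)) has_derivative (\<lambda>h. D s (\<psi> b) (snd h))) (at ?z)"
        using has_derivative_compose[OF has_derivative_snd[OF has_derivative_ident], of s "D s (\<psi> b)" ?z UNIV]
          smooth_on_has_derivative[OF st(2), of "\<psi> b"] ab by auto
      have "D (\<lambda>z. (t (fst z), s (snd z))) ?z = D (map_prod \<phi>' \<psi>' \<circ> inv_into (A \<times> B) (map_prod \<phi> \<psi>)) ?z"
        by (rule D_cong[OF oPQ(1) _ eq]) (use ab in auto)
      then show ?thesis
        using D_eq[OF has_derivative_Pair[OF f g]] by (simp add: coord_diff_def t_def[abs_def] s_def[abs_def] o_def)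
    qed
    then show ?thesis using 1 im by auto
  qed
  have "smooth_atlas (riem_product M N)"
    unfolding smooth_atlas_def ch top
    using chart_on_product[OF smooth_atlasD(1)[OF aM] smooth_atlasD(1)[OF aN]] rep
    by (auto simp: smooth_transition_def)
  moreover have met: "riem_metric (riem_product M N) (map_prod \<phi> \<psi>) p v w = riem_metric (riem_product M N) (map_prod \<phi>' \<psi>') p
     (coord_diff (A \<times> B) (map_prod \<phi> \<psi>) (map_prod \<phi>' \<psi>') id p v) (coord_diff (A \<times> B) (map_prod \<phi> \<psi>) (map_prod \<phi>' \<psi>') id p w)"
    if c: "(A, \<phi>) \<in> charts M" "(A', \<phi>') \<in> charts M" "(B, \<psi>) \<in> charts N" "(B', \<psi>') \<in> charts N"
      and p: "p \<in> A \<times> B" "p \<in> A' \<times> B'" for A \<phi> A' \<phi>' B \<psi> B' \<psi>' p v w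
  proof -
    obtain a b v1 v2 w1 w2 where e: "p = (a, b)" "v = (v1, v2)" "w = (w1, w2)" by (metis surj_pair)
    then have "a \<in> A \<inter> A'" "b \<in> B \<inter> B'" using p by auto
    then show ?thesis
      using rep[OF c] metric_atlasD(2)[OF M c(1,2), of a v1 w1] metric_atlasD(2)[OF N c(3,4), of b v2 w2]
      unfolding e by (simp add: riem_product_metric)
  qed
  ultimately show ?thesis
  proof (rule_tac metric_atlasI)
    fix P \<xi> P' \<xi>' p v w
    assume "(P, \<xi>) \<in> charts (riem_product M N)" "(P', \<xi>') \<in> charts (riem_product M N)" and p: "p \<in> P" "p \<in> P'"
    then obtain A \<phi> B \<psi> A' \<phi>' B' \<psi>' where "P = A \<times> B" "\<xi> = map_prod \<phi> \<psi>" "P' = A' \<times> B'" "\<xi>' = map_prod \<phi>' \<psi>'"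
      and c: "(A, \<phi>) \<in> charts M" "(B, \<psi>) \<in> charts N" "(A', \<phi>') \<in> charts M" "(B', \<psi>') \<in> charts N"
      unfolding ch by blast
    then show "riem_metric (riem_product M N) \<xi> p v w = riem_metric (riem_product M N) \<xi>' p
      (coord_diff P \<xi> \<xi>' id p v) (coord_diff P \<xi> \<xi>' id p w)"
      using met[OF c(1,3,2,4)] p by simp
  qed
qed

section \<open>Tangent spaces of the fibers\<close>

text \<open>The diffeomorphism \<open>x \<mapsto> x + k (R x - R x0 - D R x0 (x - x0))\<close>, where \<open>k\<close> is a right inverse of
  \<open>D R x0\<close>, turns \<open>R\<close> into its linearization.\<close>

lemma implicit_curve:
  fixes R :: "'e::euclidean_space \<Rightarrow> 'k::euclidean_space"
  assumes S: "open S" "smooth_on S R" "x0 \<in> S" "surj (D R x0)" and v: "D R x0 v = 0"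
  obtains \<epsilon> c where "\<epsilon> > (0::real)" "smooth_on {-\<epsilon><..<\<epsilon>} c" "c 0 = x0" "(c has_vector_derivative v) (at 0)"
    "\<And>t. t \<in> {-\<epsilon><..<\<epsilon>} \<Longrightarrow> c t \<in> S \<and> R (c t) = R x0"
proof -
  let ?P = "D R x0"
  have linP: "linear ?P" by (rule smooth_on_linear_D[OF S(2,3)])
  obtain k where k: "linear k" "?P \<circ> k = id" using linear_surjective_right_inverse[OF linP S(4)] by blast
  have Pk: "?P (k z) = z" for z using k(2) by (metis comp_apply id_apply)
  define \<Psi> where "\<Psi> x = x + k (R x - R x0 - ?P (x - x0))" for x
  have sm\<Psi>: "smooth_on S \<Psi>" unfolding \<Psi>_def
    by (rule smooth_on_add[OF S(1) smooth_on_ident], rule smooth_on_linear[OF S(1) k(1)])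
      (rule smooth_on_diff[OF S(1) smooth_on_diff[OF S(1,2) smooth_on_const]
        smooth_on_linear[OF S(1) linP smooth_on_diff[OF S(1) smooth_on_ident smooth_on_const]]])
  have bl: "bounded_linear k" "bounded_linear ?P" using k(1) linP by (simp_all add: linear_conv_bounded_linear)
  have "(\<Psi> has_derivative (\<lambda>u. u + k (?P u - 0 - ?P (u - 0)))) (at x0)"
    unfolding \<Psi>_def
    by (intro has_derivative_add has_derivative_ident bounded_linear.has_derivative[OF bl(1)]
      bounded_linear.has_derivative[OF bl(2)] has_derivative_diff has_derivative_const smooth_on_has_derivative[OF S(2,3)])
  then have d\<Psi>: "(\<Psi> has_derivative (\<lambda>u. u)) (at x0)" by (simp add: linear_0[OF k(1)])
  have "inj (D \<Psi> x0)" unfolding D_eq[OF d\<Psi>] by (simp add: inj_def)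
  then obtain U V g where U: "open U" "U \<subseteq> S" "x0 \<in> U" "open V" "homeomorphism U V \<Psi> g" "smooth_on V g"
    using smooth_inverse_function_theorem[OF refl S(1) sm\<Psi> S(3)] by metis
  have \<Psi>0: "\<Psi> x0 = x0" by (simp add: \<Psi>_def linear_0[OF linP] linear_0[OF k(1)])
  have h: "\<Psi> x \<in> V" "g (\<Psi> x) = x" if "x \<in> U" for x using U(5) that by (auto simp: homeomorphism_def)
  have h': "g z \<in> U" "\<Psi> (g z) = z" if "z \<in> V" for z using U(5) that by (auto simp: homeomorphism_def)
  have x0V: "x0 \<in> V" and g0: "g x0 = x0" using h[OF U(3)] \<Psi>0 by auto
  have "open ((\<lambda>t. x0 + t *\<^sub>R v) -` V)" by (intro open_vimage U(4) continuous_intros)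
  then obtain \<epsilon> where \<epsilon>: "\<epsilon> > 0" "ball 0 \<epsilon> \<subseteq> (\<lambda>t::real. x0 + t *\<^sub>R v) -` V"
    by (rule openE[of _ "0::real"]) (use x0V in auto)
  have tV: "x0 + t *\<^sub>R v \<in> V" if "t \<in> {-\<epsilon><..<\<epsilon>}" for t using \<epsilon>(2) that by (auto simp: dist_norm subset_iff)
  define c where "c t = g (x0 + t *\<^sub>R v)" for t
  have "smooth_on {-\<epsilon><..<\<epsilon>} (\<lambda>t. x0 + t *\<^sub>R v)"
    by (rule smooth_on_add[OF open_greaterThanLessThan smooth_on_const smooth_on_scaleR[OF open_greaterThanLessThan smooth_on_ident smooth_on_const]])
  then have smc: "smooth_on {-\<epsilon><..<\<epsilon>} c" unfolding c_def
    by (rule smooth_on_compose[OF open_greaterThanLessThan U(4) _ U(6)]) (use tV in auto)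
  have "D g x0 = (\<lambda>u. u)"
  proof -
    have "((\<lambda>z. \<Psi> (g z)) has_derivative D g x0) (at x0)"
      using has_derivative_compose[OF smooth_on_has_derivative[OF U(6) x0V], of \<Psi> "\<lambda>u. u"] d\<Psi> g0 by simp
    moreover have "((\<lambda>z. \<Psi> (g z)) has_derivative (\<lambda>u. u)) (at x0)"
      by (rule has_derivative_transform_within_open[OF has_derivative_ident U(4) x0V]) (simp add: h')
    ultimately show ?thesis using has_derivative_unique by metis
  qed
  then have dg: "(g has_derivative (\<lambda>u. u)) (at (x0 + 0 *\<^sub>R v))"
    using smooth_on_has_derivative[OF U(6) x0V] by simp
  have "((\<lambda>t::real. x0 + t *\<^sub>R v) has_derivative (\<lambda>t. t *\<^sub>R v)) (at 0)"
    by (auto intro!: derivative_eq_intros)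
  from has_derivative_compose[OF this dg] have dc: "(c has_vector_derivative v) (at 0)"
    by (simp add: c_def[abs_def] has_vector_derivative_def)
  have cS: "c t \<in> S \<and> R (c t) = R x0" if t: "t \<in> {-\<epsilon><..<\<epsilon>}" for t
  proof -
    have "\<Psi> (c t) = x0 + t *\<^sub>R v" "c t \<in> U" using h'[OF tV[OF t]] by (simp_all add: c_def)
    moreover have "?P (\<Psi> x - x0) = R x - R x0" for x
    proof -
      have "\<Psi> x - x0 = (x - x0) + k (R x - R x0 - ?P (x - x0))" by (simp add: \<Psi>_def)
      then show ?thesis by (simp only: linear_add[OF linP] Pk) simp
    qed
    from this[of "c t"] have "R (c t) - R x0 = ?P (\<Psi> (c t) - x0)" by simp
    ultimately show ?thesis using U(2) v by (auto simp: linear_scale[OF linP])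
  qed
  show ?thesis by (rule that[OF \<epsilon>(1) smc _ dc cS]) (simp_all add: c_def g0)
qed

text \<open>If \<open>k\<close> is a right inverse of \<open>f\<close>, then (z, x) \<mapsto> k z +
  x maps the product of the target with the kernel bijectively onto the source. This later yields
  the dimension of the base.\<close>

lemma dim_kernel_surj:
  fixes f :: "'a::euclidean_space \<Rightarrow> 'b::euclidean_space"
  assumes f: "linear f" "surj f"
  shows "dim {x. f x = 0} + DIM('b) = DIM('a)"
proof -
  let ?K = "{x. f x = 0}"
  obtain k where k: "linear k" "f \<circ> k = id" using linear_surjective_right_inverse[OF f] by blast
  have fk: "f (k z) = z" for z using k(2) by (metis comp_apply id_apply)
  have sK: "subspace ?K" unfolding subspace_def
    by (simp add: linear_0[OF f(1)] linear_add[OF f(1)] linear_scale[OF f(1)])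
  define h where "h z = k (fst z) + snd z" for z
  have lh: "linear h" unfolding h_def
    by (rule linearI) (simp_all add: linear_add[OF k(1)] linear_scale[OF k(1)] algebra_simps)
  have sub: "subspace ((UNIV::'b set) \<times> ?K)" by (rule subspace_Times[OF subspace_UNIV sK])
  have inj: "inj_on h (UNIV \<times> ?K)"
  proof (rule inj_onI)
    fix z w assume z: "z \<in> UNIV \<times> ?K" and w: "w \<in> UNIV \<times> ?K" and e: "h z = h w"
    have "f (h z) = fst z" "f (h w) = fst w" using z w by (auto simp: h_def linear_add[OF f(1)] fk)
    then have "fst z = fst w" using e by simp
    then show "z = w" using e by (simp add: h_def prod_eq_iff)
  qed
  have "x = h (f x, x - k (f x))" for x by (simp add: h_def)
  moreover have "x - k (f x) \<in> ?K" for x by (simp add: linear_diff[OF f(1)] fk)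
  ultimately have "h ` (UNIV \<times> ?K) = UNIV" by (metis (no_types, lifting) UNIV_eq_I UNIV_I image_eqI mem_Sigma_iff)
  then have "DIM('a) = dim (h ` (UNIV \<times> ?K))" by simp
  also have "\<dots> = dim ((UNIV::'b set) \<times> ?K)"
    by (rule dim_image_eq[OF lh]) (simp only: span_eq_iff[THEN iffD2, OF sub] inj)
  also have "\<dots> = DIM('b) + dim ?K" using dim_Times[OF subspace_UNIV sK] by simp
  finally show ?thesis by simp
qed

text \<open>The slice chart comes from the maximal atlas, whereas \<open>tangent_space\<close>
  refers to a given chart. The derivative \<open>L\<close> of the coordinate change maps the slice
  \<open>S\<close> onto the tangent space: lines in \<open>S\<close> are admissible curves, and
  conversely curves in \<open>F\<close> have velocity in \<open>S\<close>.\<close>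

lemma tangent_space_embedded:
  fixes M :: "('a, 'e::euclidean_space) riem"
  assumes M: "smooth_atlas M" "(A, \<phi>) \<in> charts M" and F: "embedded_submanifold M n F" and a: "a \<in> A" "a \<in> F"
  shows "dim (tangent_space A \<phi> F a) = n"
proof -
  obtain A' \<phi>' S where m: "(A', \<phi>') \<in> maximal_atlas M" "a \<in> A'" "subspace S" "dim S = n" "\<phi>' ` (A' \<inter> F) = \<phi>' ` A' \<inter> S"
    using F a(2) unfolding embedded_submanifold_def by blast
  note c = smooth_atlasD(1)[OF M]
  have c': "chart_on (mtop M) A' \<phi>'" using m(1) by (simp add: maximal_atlas_def)
  define t where "t x = \<phi> (inv_into A' \<phi>' x)" for x
  define s where "s x = \<phi>' (inv_into A \<phi> x)" for x
  have st: "smooth_on (\<phi>' ` (A' \<inter> A)) t" and ss: "smooth_on (\<phi> ` (A \<inter> A')) s"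
    using m(1) M(2) by (auto simp: maximal_atlas_def smooth_transition_def t_def[abs_def] s_def[abs_def] o_def)
  have o: "open (\<phi>' ` (A' \<inter> A))" "open (\<phi> ` (A \<inter> A'))"
    using chart_open_image[OF c'] chart_open_image[OF c] openin_Int[OF chart_openin[OF c] chart_openin[OF c']] by (simp_all add: Int_commute)
  note i = chart_inv[OF c] and i' = chart_inv[OF c']
  have ain: "\<phi>' a \<in> \<phi>' ` (A' \<inter> A)" "\<phi> a \<in> \<phi> ` (A \<inter> A')" using a m(2) by auto
  have ta: "t (\<phi>' a) = \<phi> a" "s (\<phi> a) = \<phi>' a" using i[OF a(1)] i'[OF m(2)] by (simp_all add: t_def s_def)
  define L where "L = D t (\<phi>' a)"
  define L' where "L' = D s (\<phi> a)"
  note dt = smooth_on_has_derivative[OF st ain(1)] and ds = smooth_on_has_derivative[OF ss ain(2)]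
  have linL: "linear L" unfolding L_def by (rule smooth_on_linear_D[OF st ain(1)])
  have ts: "t (s x) = x" if "x \<in> \<phi> ` (A \<inter> A')" for x using that i i' by (auto simp: t_def s_def)
  have st': "s (t x) = x" if "x \<in> \<phi>' ` (A' \<inter> A)" for x using that i i' by (auto simp: t_def s_def)
  have LL': "L (L' u) = u" for u
  proof -
    have "((\<lambda>x. t (s x)) has_derivative (\<lambda>u. L (L' u))) (at (\<phi> a))"
      unfolding L_def L'_def using has_derivative_compose[OF ds, of t] dt ta by simp
    moreover have "((\<lambda>x. t (s x)) has_derivative (\<lambda>u. u)) (at (\<phi> a))"
      by (rule has_derivative_transform_within_open[OF has_derivative_ident o(2) ain(2)]) (simp add: ts)
    ultimately show ?thesis using has_derivative_unique by metis
  qed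
  have L'L: "L' (L u) = u" for u
  proof -
    have "((\<lambda>x. s (t x)) has_derivative (\<lambda>u. L' (L u))) (at (\<phi>' a))"
      unfolding L_def L'_def using has_derivative_compose[OF dt, of s] ds ta by simp
    moreover have "((\<lambda>x. s (t x)) has_derivative (\<lambda>u. u)) (at (\<phi>' a))"
      by (rule has_derivative_transform_within_open[OF has_derivative_ident o(1) ain(1)]) (simp add: st')
    ultimately show ?thesis using has_derivative_unique by metis
  qed
  have aS: "\<phi>' a \<in> S" using a m(2,5) by blast
  have "tangent_space A \<phi> F a = L ` S"
  proof (intro equalityI subsetI)
    fix u assume "u \<in> L ` S"
    then obtain v where v: "v \<in> S" "u = L v" by blast
    have "open ((\<lambda>r::real. \<phi>' a + r *\<^sub>R v) -` (\<phi>' ` (A' \<inter> A)))" by (intro open_vimage o continuous_intros)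
    then obtain \<epsilon> where \<epsilon>: "\<epsilon> > 0" "ball 0 \<epsilon> \<subseteq> (\<lambda>r::real. \<phi>' a + r *\<^sub>R v) -` (\<phi>' ` (A' \<inter> A))"
      by (rule openE[of _ "0::real"]) (use ain(1) in auto)
    have inA: "\<phi>' a + r *\<^sub>R v \<in> \<phi>' ` (A' \<inter> A)" if "r \<in> {-\<epsilon><..<\<epsilon>}" for r
      using \<epsilon>(2) that by (auto simp: dist_norm subset_iff)
    define \<gamma> where "\<gamma> r = inv_into A' \<phi>' (\<phi>' a + r *\<^sub>R v)" for r
    have \<gamma>: "\<gamma> r \<in> F \<inter> A" if r: "r \<in> {-\<epsilon><..<\<epsilon>}" for r
    proof -
      obtain b where b: "b \<in> A'" "b \<in> A" "\<phi>' a + r *\<^sub>R v = \<phi>' b" using inA[OF r] by blast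
      then have "\<gamma> r = b" using i' by (simp add: \<gamma>_def)
      moreover have "\<phi>' b \<in> \<phi>' ` A' \<inter> S" using b aS v(1) m(3) by (metis IntI image_eqI subspace_add subspace_scale)
      then have "\<phi>' b \<in> \<phi>' ` (A' \<inter> F)" using m(5) by simp
      then have "b \<in> F" using chart_inj[OF c'] b(1) by (auto simp: inj_on_def)
      ultimately show ?thesis using b by simp
    qed
    have e: "(\<phi> \<circ> \<gamma>) = (\<lambda>r. t (\<phi>' a + r *\<^sub>R v))" by (simp add: \<gamma>_def t_def fun_eq_iff)
    have "smooth_on {-\<epsilon><..<\<epsilon>} (\<lambda>r. \<phi>' a + r *\<^sub>R v)"
      by (rule smooth_on_add[OF open_greaterThanLessThan smooth_on_const smooth_on_scaleR[OF open_greaterThanLessThan smooth_on_ident smooth_on_const]])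
    then have "smooth_on {-\<epsilon><..<\<epsilon>} (\<phi> \<circ> \<gamma>)" unfolding e
      by (rule smooth_on_compose[OF open_greaterThanLessThan o(1) _ st]) (use inA in auto)
    moreover have "((\<phi> \<circ> \<gamma>) has_vector_derivative u) (at 0)"
    proof -
      have 1: "((\<lambda>r::real. \<phi>' a + r *\<^sub>R v) has_derivative (\<lambda>r. r *\<^sub>R v)) (at 0)" by (auto intro!: derivative_eq_intros)
      have 2: "(t has_derivative L) (at (\<phi>' a + 0 *\<^sub>R v))" using dt by (simp add: L_def)
      show ?thesis unfolding e v(2) has_vector_derivative_def
        using has_derivative_compose[OF 1 2] by (simp add: linear_scale[OF linL])
    qed
    moreover have "\<gamma> 0 = a" using i'[OF m(2)] by (simp add: \<gamma>_def)
    ultimately show "u \<in> tangent_space A \<phi> F a"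
      unfolding tangent_space_def using \<epsilon>(1) \<gamma> by blast
  next
    fix u assume "u \<in> tangent_space A \<phi> F a"
    then obtain \<gamma> \<epsilon> where \<epsilon>: "\<epsilon> > (0::real)" and \<gamma>: "\<gamma> ` {-\<epsilon><..<\<epsilon>} \<subseteq> F \<inter> A" "\<gamma> 0 = a"
      and sm: "smooth_on {-\<epsilon><..<\<epsilon>} (\<phi> \<circ> \<gamma>)" and d: "((\<phi> \<circ> \<gamma>) has_vector_derivative u) (at 0)"
      unfolding tangent_space_def by blast
    have zero: "(0::real) \<in> {-\<epsilon><..<\<epsilon>}" using \<epsilon> by simp
    define T where "T = {-\<epsilon><..<\<epsilon>} \<inter> (\<phi> \<circ> \<gamma>) -` (\<phi> ` (A \<inter> A'))"
    have oT: "open T" unfolding T_def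
      by (rule continuous_open_preimage[OF smooth_on_continuous[OF sm] open_greaterThanLessThan o(2)])
    have zT: "0 \<in> T" using zero ain(2) \<gamma>(2) by (simp add: T_def)
    have inS: "s ((\<phi> \<circ> \<gamma>) r) \<in> S" if "r \<in> T" for r
    proof -
      have r: "\<gamma> r \<in> F" "\<gamma> r \<in> A" "\<phi> (\<gamma> r) \<in> \<phi> ` (A \<inter> A')" using that \<gamma>(1) by (auto simp: T_def)
      then have "\<gamma> r \<in> A'" using chart_inj[OF c] by (auto simp: inj_on_def)
      then have "\<phi>' (\<gamma> r) \<in> S" using r m(5) by blast
      then show ?thesis using i[OF r(2)] by (simp add: s_def)
    qed
    have "((\<lambda>r. s ((\<phi> \<circ> \<gamma>) r)) has_derivative (\<lambda>r. L' (r *\<^sub>R u))) (at 0)"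
      using has_derivative_compose[OF d[unfolded has_vector_derivative_def], of s L'] ds \<gamma>(2) by (simp add: L'_def)
    then have "((\<lambda>r. s ((\<phi> \<circ> \<gamma>) r)) has_vector_derivative L' u) (at 0)"
      using linear_scale[OF smooth_on_linear_D[OF ss ain(2)]] by (simp add: has_vector_derivative_def L'_def)
    then have ds': "((\<lambda>r. s ((\<phi> \<circ> \<gamma>) r)) has_derivative (\<lambda>r. r *\<^sub>R L' u)) (at 0)"
      by (simp add: has_vector_derivative_def)
    \<comment> \<open>The part \<open>z\<close> of the velocity orthogonal to \<open>S\<close> is
      zero, since the inner product of \<open>z\<close> with a curve running in \<open>S\<close>
      vanishes identically.\<close>
    obtain y z where yz: "y \<in> span S" "\<And>w. w \<in> span S \<Longrightarrow> orthogonal z w" "L' u = y + z"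
      using orthogonal_subspace_decomp_exists[of S "L' u"] by metis
    have zS: "z \<bullet> w = 0" if "w \<in> S" for w using yz(2) span_base[OF that] by (simp add: orthogonal_def)
    have "((\<lambda>r. 0) has_derivative (\<lambda>r. z \<bullet> (r *\<^sub>R L' u))) (at (0::real))"
      by (rule has_derivative_transform_within_open[OF has_derivative_inner_right[OF ds', of z] oT zT]) (simp add: zS[OF inS, unfolded o_apply])
    from fun_cong[OF has_derivative_unique[OF this has_derivative_const], of 1] have "z \<bullet> L' u = 0" by simp
    moreover have "z \<bullet> y = 0" using yz(2)[OF yz(1)] by (simp add: orthogonal_def)
    ultimately have "z \<bullet> z = 0" by (simp add: yz(3) inner_add_right)
    then have "L' u \<in> span S" using yz by simp
    then have "L' u \<in> S" using span_eq_iff[THEN iffD2, OF m(3)] by simp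
    then show "u \<in> L ` S" using LL'[of u] by (metis image_eqI)
  qed
  moreover have "inj L" by (rule inj_on_inverseI[of _ L']) (rule L'L)
  then have "inj_on L (span S)" by (rule inj_on_subset) simp
  ultimately show ?thesis using dim_image_eq[OF linL] m(4) by simp
qed

section \<open>The base manifold\<close>

lemma riemannian_manifoldI:
  assumes "smooth_manifold M" "metric_atlas M"
    and "\<And>A \<phi>. (A, \<phi>) \<in> charts M \<Longrightarrow> metric_on (\<phi> ` A) (local_metric M A \<phi>)"
  shows "riemannian_manifold M"
  unfolding riemannian_manifold_def
proof (intro conjI)
  show "smooth_manifold M" by fact
  show "\<forall>(A, \<phi>)\<in>charts M. \<forall>(B, \<psi>)\<in>charts M. \<forall>p\<in>A \<inter> B. \<forall>v w. riem_metric M \<phi> p v w =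
      riem_metric M \<psi> p (coord_diff A \<phi> \<psi> id p v) (coord_diff A \<phi> \<psi> id p w)"
    using assms(2) by (simp add: metric_atlas_def)
  show "\<forall>(A, \<phi>)\<in>charts M.
       (\<forall>p\<in>A. bilinear (riem_metric M \<phi> p) \<and> (\<forall>v w. riem_metric M \<phi> p v w = riem_metric M \<phi> p w v) \<and>
            (\<forall>v. v \<noteq> 0 \<longrightarrow> 0 < riem_metric M \<phi> p v v)) \<and>
       (\<forall>v w. smooth_on (\<phi> ` A) (\<lambda>x. riem_metric M \<phi> (inv_into A \<phi> x) v w))"
  proof (rule ballI, unfold split_paired_all prod.case)
    fix A \<phi> assume c: "(A, \<phi>) \<in> charts M"
    note m = assms(3)[OF c] and ch = smooth_atlasD(1)[OF metric_atlasD(1)[OF assms(2)] c]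
    have e: "riem_metric M \<phi> p = local_metric M A \<phi> (\<phi> p)" "\<phi> p \<in> \<phi> ` A" if "p \<in> A" for p
      using chart_inv[OF ch that] that by (simp_all add: local_metric_def)
    show "(\<forall>p\<in>A. bilinear (riem_metric M \<phi> p) \<and> (\<forall>v w. riem_metric M \<phi> p v w = riem_metric M \<phi> p w v) \<and>
            (\<forall>v. v \<noteq> 0 \<longrightarrow> 0 < riem_metric M \<phi> p v v)) \<and>
       (\<forall>v w. smooth_on (\<phi> ` A) (\<lambda>x. riem_metric M \<phi> (inv_into A \<phi> x) v w))"
    proof (intro conjI ballI allI impI)
      fix p assume p: "p \<in> A"
      show "bilinear (riem_metric M \<phi> p)" unfolding e[OF p] by (rule metric_onD(2)[OF m e(2)[OF p]])
      show "riem_metric M \<phi> p v w = riem_metric M \<phi> p w v" for v w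
        unfolding e[OF p] by (rule metric_onD(3)[OF m e(2)[OF p]])
      show "0 < riem_metric M \<phi> p v v" if "v \<noteq> 0" for v
        unfolding e[OF p] by (rule metric_onD(4)[OF m e(2)[OF p] that])
    next
      show "smooth_on (\<phi> ` A) (\<lambda>x. riem_metric M \<phi> (inv_into A \<phi> x) v w)" for v w
        using metric_onD(5)[OF m] by (simp add: local_metric_def)
    qed
  qed
qed

lemma riemannian_metric_on:
  assumes M: "riemannian_manifold M" "(A, \<phi>) \<in> charts M"
  shows "metric_on (\<phi> ` A) (local_metric M A \<phi>)"
proof -
  have c: "chart_on (mtop M) A \<phi>"
    by (rule smooth_atlasD(1)[OF metric_atlasD(1)[OF riemannian_manifold_metric_atlas[OF M(1)]] M(2)])
  have "(\<forall>p\<in>A. bilinear (riem_metric M \<phi> p) \<and> (\<forall>v w. riem_metric M \<phi> p v w = riem_metric M \<phi> p w v) \<and>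
               (\<forall>v. v \<noteq> 0 \<longrightarrow> riem_metric M \<phi> p v v > 0)) \<and>
        (\<forall>v w. smooth_on (\<phi> ` A) (\<lambda>x. riem_metric M \<phi> (inv_into A \<phi> x) v w))"
    using bspec[OF M(1)[unfolded riemannian_manifold_def, THEN conjunct2, THEN conjunct1] M(2)] by simp
  then show ?thesis
    unfolding metric_on_def local_metric_def using chart_open[OF c] chart_inv[OF c] by auto
qed

text \<open>The linear isomorphism \<open>J\<close>, with inverse \<open>J'\<close>, changes the model space of \<open>N\<close> to the one
  required of the factors.\<close>

definition open_submanifold ::
  "('b, 'k) riem \<Rightarrow> 'b set \<Rightarrow> ('k \<Rightarrow> 'l) \<Rightarrow> ('l \<Rightarrow> 'k) \<Rightarrow> ('b, 'l) riem" where
  "open_submanifold N P J J' = \<lparr>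
     mtop = subtopology (mtop N) P,
     charts = (\<lambda>(A, \<psi>). (A \<inter> P, J \<circ> \<psi>)) ` charts N,
     riem_metric = (\<lambda>\<xi> p v w. riem_metric N (J' \<circ> \<xi>) p (J' v) (J' w))\<rparr>"

locale open_submanifold_charts =
  fixes N :: "('b, 'k::euclidean_space) riem" and P and J :: "'k \<Rightarrow> 'l::euclidean_space" and J'
  assumes N: "riemannian_manifold N" and P: "openin (mtop N) P"
    and J: "linear J" "linear J'" "\<And>x. J' (J x) = x" "\<And>y. J (J' y) = y"
begin

abbreviation "B \<equiv> open_submanifold N P J J'"

lemma aN: "metric_atlas N" "smooth_atlas N"
  using riemannian_manifold_metric_atlas[OF N] metric_atlasD(1) by blast+

lemma injJ: "inj J" "surj J" "inj J'" using J(3,4) by (metis injI, metis surjI, metis injI)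

lemma chartsB: "charts B = (\<lambda>(A, \<psi>). (A \<inter> P, J \<circ> \<psi>)) ` charts N" and topB: "mtop B = subtopology (mtop N) P"
  by (simp_all add: open_submanifold_def)

text \<open>The metric of \<open>N\<close> is indexed by the coordinate maps of \<open>N\<close>; a
  coordinate map of \<open>B\<close> has to be composed with \<open>J'\<close> to recover
  one.\<close>

lemma metricB: "riem_metric B (J \<circ> \<psi>) p v w = riem_metric N \<psi> p (J' v) (J' w)"
proof -
  have "J' \<circ> (J \<circ> \<psi>) = \<psi>" using J(3) by (simp add: fun_eq_iff)
  then show ?thesis by (simp add: open_submanifold_def)
qed

lemma DJ: "(J has_derivative J) (at x)" "(J' has_derivative J') (at y)"
  using J(1,2) by (simp_all add: linear_conv_bounded_linear bounded_linear_imp_has_derivative)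

context
  fixes C \<psi> assumes c: "(C, \<psi>) \<in> charts N"
begin

lemma cN: "chart_on (mtop N) C \<psi>" by (rule smooth_atlasD(1)[OF aN(2) c])

lemma chartB_mem: "(C \<inter> P, J \<circ> \<psi>) \<in> charts B" using c by (force simp: chartsB)

lemma chartB: "chart_on (mtop B) (C \<inter> P) (J \<circ> \<psi>)"
proof (rule chart_onI)
  show "openin (mtop B) (C \<inter> P)"
    unfolding topB openin_open_subtopology[OF P] using chart_openin[OF cN] P openin_Int by blast
  show "inj_on (J \<circ> \<psi>) (C \<inter> P)"
    using chart_inj[OF cN] injJ(1) by (auto simp: inj_on_def)
  show "open ((J \<circ> \<psi>) ` U)" if "openin (mtop B) U" "U \<subseteq> C \<inter> P" for U
  proof -
    have "openin (mtop N) U" using that(1) unfolding topB openin_open_subtopology[OF P] by blast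
    then have "open (\<psi> ` U)" by (rule chart_open_image[OF cN]) (use that(2) in auto)
    then show ?thesis unfolding image_comp[symmetric] by (rule open_surjective_linear_image[OF _ J(1) injJ(2)])
  qed
  show "openin (mtop B) {x \<in> C \<inter> P. (J \<circ> \<psi>) x \<in> V}" if "open V" for V
  proof -
    have "continuous_on UNIV J" using J(1) by (simp add: linear_conv_bounded_linear linear_continuous_on)
    then have "open (J -` V)" using that open_vimage by blast
    from openin_Int[OF chart_open_preimage[OF cN this] P]
    have "openin (mtop N) ({x \<in> C. \<psi> x \<in> J -` V} \<inter> P)" .
    moreover have "{x \<in> C. \<psi> x \<in> J -` V} \<inter> P = {x \<in> C \<inter> P. (J \<circ> \<psi>) x \<in> V}" by auto
    ultimately show ?thesis unfolding topB openin_open_subtopology[OF P] by auto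
  qed
qed

lemma inv_chartB: "z \<in> (J \<circ> \<psi>) ` (C \<inter> P) \<Longrightarrow> inv_into (C \<inter> P) (J \<circ> \<psi>) z = inv_into C \<psi> (J' z)"
  using chart_inv[OF chartB] chart_inv[OF cN] J(3) by auto

lemma smooth_chartB:
  assumes "smooth_on (\<psi> ` T) f" "T \<subseteq> C" "openin (mtop N) T"
  shows "smooth_on ((J \<circ> \<psi>) ` T) (\<lambda>z. f (J' z))"
proof -
  have o: "open (\<psi> ` T)" using chart_open_image[OF cN assms(3,2)] .
  then have o': "open ((J \<circ> \<psi>) ` T)" unfolding image_comp[symmetric] by (rule open_surjective_linear_image[OF _ J(1) injJ(2)])
  show ?thesis
    by (rule smooth_on_compose[OF o' o smooth_on_linear[OF o' J(2) smooth_on_ident] assms(1)]) (use J(3) in auto)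
qed

lemma coord_diff_chartB:
  assumes f: "smooth_on (\<psi> ` T) (\<xi> \<circ> f \<circ> inv_into C \<psi>)" and T: "T \<subseteq> C \<inter> P" "openin (mtop N) T" and p: "p \<in> T"
  shows "coord_diff (C \<inter> P) (J \<circ> \<psi>) \<xi> f p v = coord_diff C \<psi> \<xi> f p (J' v)"
proof -
  have o: "open ((J \<circ> \<psi>) ` T)"
    by (rule chart_open_image[OF chartB _ T(1)]) (use T in \<open>auto simp: topB openin_open_subtopology[OF P]\<close>)
  have eq: "(\<xi> \<circ> f \<circ> inv_into C \<psi>) (J' z) = (\<xi> \<circ> f \<circ> inv_into (C \<inter> P) (J \<circ> \<psi>)) z" if "z \<in> (J \<circ> \<psi>) ` T" for z
  proof -
    have "z \<in> (J \<circ> \<psi>) ` (C \<inter> P)" using that T(1) by blast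
    then show ?thesis by (simp only: o_apply inv_chartB)
  qed
  have e1: "D (\<lambda>z. (\<xi> \<circ> f \<circ> inv_into C \<psi>) (J' z)) ((J \<circ> \<psi>) p) = D (\<xi> \<circ> f \<circ> inv_into (C \<inter> P) (J \<circ> \<psi>)) ((J \<circ> \<psi>) p)"
    by (rule D_cong[OF o _ eq]) (use p in auto)
  have h: "((\<lambda>z. (\<xi> \<circ> f \<circ> inv_into C \<psi>) (J' z)) has_derivative (\<lambda>v. D (\<xi> \<circ> f \<circ> inv_into C \<psi>) (\<psi> p) (J' v))) (at ((J \<circ> \<psi>) p))"
    using has_derivative_compose[OF DJ(2), of "\<xi> \<circ> f \<circ> inv_into C \<psi>" _ "(J \<circ> \<psi>) p"] smooth_on_has_derivative[OF f, of "\<psi> p"] p J(3) by auto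
  show ?thesis unfolding coord_diff_def e1[symmetric] D_eq[OF h] ..
qed

end

lemma riemannian_B: "riemannian_manifold B"
proof -
  have sN: "smooth_manifold N" using N by (simp add: riemannian_manifold_def)
  have cov: "\<Union> (fst ` charts N) = points N"
    using sN unfolding smooth_manifold_def by (force simp: case_prod_beta)
  have PN: "P \<subseteq> points N" by (rule openin_subset[OF P])
  have ov: "openin (mtop N) (C1 \<inter> P \<inter> (C2 \<inter> P))" if "(C1, \<psi>1) \<in> charts N" "(C2, \<psi>2) \<in> charts N" for C1 \<psi>1 C2 \<psi>2
    using chart_openin[OF cN[OF that(1)]] chart_openin[OF cN[OF that(2)]] P by (simp add: openin_Int)
  have tr: "smooth_on (\<psi>1 ` (C1 \<inter> P \<inter> (C2 \<inter> P))) (\<psi>2 \<circ> id \<circ> inv_into C1 \<psi>1)"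
    if "(C1, \<psi>1) \<in> charts N" "(C2, \<psi>2) \<in> charts N" for C1 \<psi>1 C2 \<psi>2
    using smooth_on_subset[OF smooth_atlasD(2)[OF aN(2) that], of "\<psi>1 ` (C1 \<inter> P \<inter> (C2 \<inter> P))"] by (auto simp: o_def)
  have trJ: "smooth_on (\<psi>1 ` (C1 \<inter> P \<inter> (C2 \<inter> P))) ((J \<circ> \<psi>2) \<circ> id \<circ> inv_into C1 \<psi>1)"
    if c: "(C1, \<psi>1) \<in> charts N" "(C2, \<psi>2) \<in> charts N" for C1 \<psi>1 C2 \<psi>2
  proof -
    have "open (\<psi>1 ` (C1 \<inter> P \<inter> (C2 \<inter> P)))" by (rule chart_open_image[OF cN[OF c(1)] ov[OF c]]) auto
    from smooth_on_linear[OF this J(1) tr[OF c]] show ?thesis by (simp add: o_def)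
  qed
  have sB: "smooth_manifold B"
    unfolding smooth_manifold_def
  proof (intro conjI)
    show "Hausdorff_space (mtop B)" "second_countable (mtop B)"
      using sN Hausdorff_space_subtopology second_countable_subtopology by (auto simp: topB smooth_manifold_def)
    show "\<forall>(A, \<phi>)\<in>charts B. chart_on (mtop B) A \<phi>" using chartB by (auto simp: chartsB)
    show "(\<Union>(A, \<phi>)\<in>charts B. A) = points B"
      using cov PN by (force simp: chartsB topB case_prod_beta)
    have "smooth_transition (C1 \<inter> P, J \<circ> \<psi>1) (C2 \<inter> P, J \<circ> \<psi>2)" if c: "(C1, \<psi>1) \<in> charts N" "(C2, \<psi>2) \<in> charts N" for C1 \<psi>1 C2 \<psi>2
    proof -
      let ?T = "C1 \<inter> P \<inter> (C2 \<inter> P)"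
      have "smooth_on ((J \<circ> \<psi>1) ` ?T) (\<lambda>z. ((J \<circ> \<psi>2) \<circ> id \<circ> inv_into C1 \<psi>1) (J' z))"
        by (rule smooth_chartB[OF c(1) trJ[OF c] _ ov[OF c]]) auto
      moreover have "open ((J \<circ> \<psi>1) ` ?T)"
        by (rule chart_open_image[OF chartB[OF c(1)]]) (use ov[OF c] in \<open>auto simp: topB openin_open_subtopology[OF P]\<close>)
      moreover have "((J \<circ> \<psi>2) \<circ> id \<circ> inv_into C1 \<psi>1) (J' z) = (J \<circ> \<psi>2 \<circ> inv_into (C1 \<inter> P) (J \<circ> \<psi>1)) z"
        if "z \<in> (J \<circ> \<psi>1) ` ?T" for z
      proof -
        have "z \<in> (J \<circ> \<psi>1) ` (C1 \<inter> P)" using that by blast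
        then show ?thesis by (simp only: o_apply id_apply inv_chartB[OF c(1)])
      qed
      ultimately show ?thesis
        unfolding smooth_transition_def prod.case by (rule_tac smooth_on_cong)
    qed
    then show "\<forall>a\<in>charts B. \<forall>b\<in>charts B. smooth_transition a b" by (auto simp: chartsB)
  qed
  have mB: "metric_on ((J \<circ> \<psi>) ` (C \<inter> P)) (local_metric B (C \<inter> P) (J \<circ> \<psi>))" if c: "(C, \<psi>) \<in> charts N" for C \<psi>
  proof -
    have m: "metric_on (\<psi> ` C) (local_metric N C \<psi>)" by (rule riemannian_metric_on[OF N c])
    have CP: "openin (mtop N) (C \<inter> P)" using chart_openin[OF cN[OF c]] P by (rule openin_Int)
    have o: "open ((J \<circ> \<psi>) ` (C \<inter> P))" by (rule chart_open[OF chartB[OF c]])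
    have e: "local_metric B (C \<inter> P) (J \<circ> \<psi>) z v w = local_metric N C \<psi> (J' z) (J' v) (J' w)" if "z \<in> (J \<circ> \<psi>) ` (C \<inter> P)" for z v w
      by (simp add: local_metric_def metricB inv_chartB[OF c that])
    have z: "J' z \<in> \<psi> ` C" if "z \<in> (J \<circ> \<psi>) ` (C \<inter> P)" for z using that J(3) by auto
    show ?thesis
      unfolding metric_on_def
    proof (intro conjI ballI allI impI o)
      fix z assume zz: "z \<in> (J \<circ> \<psi>) ` (C \<inter> P)"
      note f = metric_onD[OF m] z[OF zz]
      show "bilinear (local_metric B (C \<inter> P) (J \<circ> \<psi>) z)"
        unfolding bilinear_def e[OF zz]
        using linear_compose[OF J(2) f(6)[OF z[OF zz]]] linear_compose[OF J(2) f(7)[OF z[OF zz]]] by (auto simp: o_def)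
      show "local_metric B (C \<inter> P) (J \<circ> \<psi>) z v w = local_metric B (C \<inter> P) (J \<circ> \<psi>) z w v" for v w
        unfolding e[OF zz] by (rule f(3)[OF z[OF zz]])
      show "0 < local_metric B (C \<inter> P) (J \<circ> \<psi>) z v v" if "v \<noteq> 0" for v
        unfolding e[OF zz] by (rule f(4)[OF z[OF zz]]) (use that J(4)[of v] linear_0[OF J(1)] in metis)
    next
      fix v w
      have "smooth_on ((J \<circ> \<psi>) ` (C \<inter> P)) (\<lambda>z. local_metric N C \<psi> (J' z) (J' v) (J' w))"
        by (rule smooth_chartB[OF c smooth_on_subset[OF metric_onD(5)[OF m]] _ CP]) auto
      then show "smooth_on ((J \<circ> \<psi>) ` (C \<inter> P)) (\<lambda>x. local_metric B (C \<inter> P) (J \<circ> \<psi>) x v w)"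
        by (rule smooth_on_cong[OF o]) (simp add: e)
    qed
  qed
  have met: "riem_metric B (J \<circ> \<psi>1) p v w = riem_metric B (J \<circ> \<psi>2) p
      (coord_diff (C1 \<inter> P) (J \<circ> \<psi>1) (J \<circ> \<psi>2) id p v) (coord_diff (C1 \<inter> P) (J \<circ> \<psi>1) (J \<circ> \<psi>2) id p w)"
    if c: "(C1, \<psi>1) \<in> charts N" "(C2, \<psi>2) \<in> charts N" and p: "p \<in> C1 \<inter> P \<inter> (C2 \<inter> P)" for C1 \<psi>1 C2 \<psi>2 p v w
  proof -
    have 1: "coord_diff (C1 \<inter> P) (J \<circ> \<psi>1) (J \<circ> \<psi>2) id p v = coord_diff C1 \<psi>1 (J \<circ> \<psi>2) id p (J' v)" for v
      by (rule coord_diff_chartB[OF c(1) trJ[OF c] _ ov[OF c] p]) auto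
    have "((\<lambda>z. J ((\<psi>2 \<circ> id \<circ> inv_into C1 \<psi>1) z)) has_derivative (\<lambda>v. J (D (\<psi>2 \<circ> id \<circ> inv_into C1 \<psi>1) (\<psi>1 p) v))) (at (\<psi>1 p))"
      by (rule has_derivative_compose[OF smooth_on_has_derivative[OF tr[OF c]] DJ(1)]) (use p in auto)
    then have "D (\<lambda>z. J ((\<psi>2 \<circ> id \<circ> inv_into C1 \<psi>1) z)) (\<psi>1 p) v = J (D (\<psi>2 \<circ> id \<circ> inv_into C1 \<psi>1) (\<psi>1 p) v)" for v
      by (simp add: D_eq)
    then have 2: "coord_diff C1 \<psi>1 (J \<circ> \<psi>2) id p v = J (coord_diff C1 \<psi>1 \<psi>2 id p v)" for v
      by (simp add: coord_diff_def o_def)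
    show ?thesis unfolding 1 2 metricB J(3) by (rule metric_atlasD(2)[OF aN(1) c]) (use p in auto)
  qed
  have mem: "\<exists>C \<psi>. (C, \<psi>) \<in> charts N \<and> A = C \<inter> P \<and> \<phi> = J \<circ> \<psi>" if "(A, \<phi>) \<in> charts B" for A \<phi>
    using that unfolding chartsB by auto
  show ?thesis
  proof (rule riemannian_manifoldI[OF sB metric_atlasI])
    show "smooth_atlas B" using sB unfolding smooth_manifold_def smooth_atlas_def by blast
    show "metric_on (\<phi> ` A) (local_metric B A \<phi>)" if "(A, \<phi>) \<in> charts B" for A \<phi>
      using mem[OF that] mB by blast
    show "riem_metric B \<phi> p v w = riem_metric B \<phi>' p (coord_diff A \<phi> \<phi>' id p v) (coord_diff A \<phi> \<phi>' id p w)"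
      if c: "(A, \<phi>) \<in> charts B" "(A', \<phi>') \<in> charts B" and p: "p \<in> A" "p \<in> A'" for A \<phi> A' \<phi>' p v w
    proof -
      obtain C1 \<psi>1 where 1: "(C1, \<psi>1) \<in> charts N" "A = C1 \<inter> P" "\<phi> = J \<circ> \<psi>1" using mem[OF c(1)] by blast
      obtain C2 \<psi>2 where 2: "(C2, \<psi>2) \<in> charts N" "A' = C2 \<inter> P" "\<phi>' = J \<circ> \<psi>2" using mem[OF c(2)] by blast
      show ?thesis unfolding 1(2,3) 2(3) by (rule met[OF 1(1) 2(1)]) (use p 1 2 in auto)
    qed
  qed
qed

end

section \<open>Einstein manifolds with totally geodesic fibers\<close>

locale einstein_submersion =
  fixes M :: "('a, 'e::euclidean_space) riem" and N :: "('b, 'k::euclidean_space) riem"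
    and \<pi> :: "'a \<Rightarrow> 'b" and l :: real
  assumes RM: "riemannian_manifold M" and RN: "riemannian_manifold N"
    and sub: "riemannian_submersion M N \<pi>"
    and ein: "\<And>A \<phi> p v w. (A, \<phi>) \<in> charts M \<Longrightarrow> p \<in> A \<Longrightarrow>
      ricci (local_metric M A \<phi>) (\<phi> p) v w = l * riem_metric M \<phi> p v w"
    and emb: "\<And>q. q \<in> points N \<Longrightarrow> embedded_submanifold M 2 (fiber M \<pi> q)"
    and geo: "\<And>q. q \<in> points N \<Longrightarrow> totally_geodesic M (fiber M \<pi> q)"
    and dimM: "DIM('e) = 4"
begin

lemma aM: "metric_atlas M" "smooth_atlas M" and aN: "metric_atlas N" "smooth_atlas N"
  using riemannian_manifold_metric_atlas[OF RM] riemannian_manifold_metric_atlas[OF RN] metric_atlasD(1) by blast+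

lemma smooth_\<pi>: "smooth_map_on M (points M) N \<pi>"
  using sub by (simp add: riemannian_submersion_def)

lemma continuous_\<pi>: "continuous_map (mtop M) (mtop N) \<pi>"
  using smooth_\<pi> by (simp add: smooth_map_on_def)

lemma chart_at:
  "p \<in> points M \<Longrightarrow> \<exists>A \<phi>. (A, \<phi>) \<in> charts M \<and> p \<in> A"
  "q \<in> points N \<Longrightarrow> \<exists>C \<psi>. (C, \<psi>) \<in> charts N \<and> q \<in> C"
proof -
  have M: "(\<Union>(A, \<phi>)\<in>charts M. A) = points M"
    using RM unfolding riemannian_manifold_def smooth_manifold_def by (elim conjE)
  have N: "(\<Union>(C, \<psi>)\<in>charts N. C) = points N"
    using RN unfolding riemannian_manifold_def smooth_manifold_def by (elim conjE)
  show "\<exists>A \<phi>. (A, \<phi>) \<in> charts M \<and> p \<in> A" if "p \<in> points M"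
    using that unfolding M[symmetric] by auto
  show "\<exists>C \<psi>. (C, \<psi>) \<in> charts N \<and> q \<in> C" if "q \<in> points N"
    using that unfolding N[symmetric] by auto
qed

lemma \<pi>_points: "p \<in> points M \<Longrightarrow> \<pi> p \<in> points N"
  using continuous_\<pi> by (auto simp: continuous_map_def)

context
  fixes A \<phi> C \<psi>
  assumes cA: "(A, \<phi>) \<in> charts M" and cC: "(C, \<psi>) \<in> charts N"
begin

abbreviation "U \<equiv> A \<inter> \<pi> -` C"
abbreviation "R \<equiv> \<psi> \<circ> \<pi> \<circ> inv_into A \<phi>"

lemmas chA = smooth_atlasD(1)[OF aM(2) cA] and chC = smooth_atlasD(1)[OF aN(2) cC]

lemma A_points: "A \<subseteq> points M" by (rule chart_subset[OF chA])

lemma openin_U: "openin (mtop M) U"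
proof -
  have "openin (mtop M) {x \<in> points M. \<pi> x \<in> C}"
    by (rule openin_continuous_map_preimage[OF continuous_\<pi> chart_openin[OF chC]])
  from openin_Int[OF chart_openin[OF chA] this]
  have "openin (mtop M) (A \<inter> {x \<in> points M. \<pi> x \<in> C})" .
  moreover have "A \<inter> {x \<in> points M. \<pi> x \<in> C} = U" using A_points by auto
  ultimately show ?thesis by simp
qed

lemma open_U: "open (\<phi> ` U)" by (rule chart_open_image[OF chA openin_U]) auto

lemma smooth_R: "smooth_on (\<phi> ` U) R"
proof -
  have "\<forall>(A, \<phi>)\<in>charts M. \<forall>(B, \<psi>)\<in>charts N. smooth_on (\<phi> ` (points M \<inter> A \<inter> \<pi> -` B)) (\<psi> \<circ> \<pi> \<circ> inv_into A \<phi>)"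
    using smooth_\<pi> unfolding smooth_map_on_def by (elim conjE)
  from bspec[OF bspec[OF this cA, unfolded prod.case] cC, unfolded prod.case]
  have "smooth_on (\<phi> ` (points M \<inter> A \<inter> \<pi> -` C)) R" .
  moreover have "points M \<inter> A \<inter> \<pi> -` C = U" using A_points by auto
  ultimately show ?thesis by simp
qed

lemma submersion_at:
  assumes p: "p \<in> U"
  shows "surj (D R (\<phi> p))"
    "\<lbrakk>\<forall>u. D R (\<phi> p) u = 0 \<longrightarrow> riem_metric M \<phi> p v u = 0; \<forall>u. D R (\<phi> p) u = 0 \<longrightarrow> riem_metric M \<phi> p w u = 0\<rbrakk>
      \<Longrightarrow> riem_metric M \<phi> p v w = riem_metric N \<psi> (\<pi> p) (D R (\<phi> p) v) (D R (\<phi> p) w)"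
proof -
  note 1 = bspec[OF bspec[OF bspec[OF sub[unfolded riemannian_submersion_def, THEN conjunct2] cA, unfolded prod.case]
    cC, unfolded prod.case] p, unfolded Let_def coord_diff_def]
  show "surj (D R (\<phi> p))" using 1 by blast
  show "\<lbrakk>\<forall>u. D R (\<phi> p) u = 0 \<longrightarrow> riem_metric M \<phi> p v u = 0; \<forall>u. D R (\<phi> p) u = 0 \<longrightarrow> riem_metric M \<phi> p w u = 0\<rbrakk>
      \<Longrightarrow> riem_metric M \<phi> p v w = riem_metric N \<psi> (\<pi> p) (D R (\<phi> p) v) (D R (\<phi> p) w)"
    using 1 by blast
qed

text \<open>A curve in the fiber has constant image, so \<open>D R\<close> annihilates its velocity;
  conversely \<open>implicit_curve\<close> realizes every kernel vector by a curve in the fiber.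
  This translates the two hypotheses on the fibers into statements about the kernel.\<close>

lemma tangent_space_fiber:
  assumes p: "p \<in> U"
  shows "tangent_space A \<phi> (fiber M \<pi> (\<pi> p)) p = {u. D R (\<phi> p) u = 0}"
proof (intro equalityI subsetI)
  have px: "\<phi> p \<in> \<phi> ` U" using p by blast
  have Rp: "R (\<phi> p) = \<psi> (\<pi> p)" using chart_inv[OF chA] p by simp
  fix u assume "u \<in> tangent_space A \<phi> (fiber M \<pi> (\<pi> p)) p"
  then obtain \<gamma> \<epsilon> where \<epsilon>: "\<epsilon> > (0::real)" and \<gamma>: "\<gamma> ` {-\<epsilon><..<\<epsilon>} \<subseteq> fiber M \<pi> (\<pi> p) \<inter> A" "\<gamma> 0 = p"
    and d: "((\<phi> \<circ> \<gamma>) has_vector_derivative u) (at 0)"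
    unfolding tangent_space_def by blast
  have "((\<lambda>r. R ((\<phi> \<circ> \<gamma>) r)) has_derivative (\<lambda>r. D R (\<phi> p) (r *\<^sub>R u))) (at 0)"
    using has_derivative_compose[OF d[unfolded has_vector_derivative_def], of R "D R (\<phi> p)"]
      smooth_on_has_derivative[OF smooth_R px] \<gamma>(2) by simp
  moreover have "((\<lambda>r. R ((\<phi> \<circ> \<gamma>) r)) has_derivative (\<lambda>r. 0)) (at 0)"
  proof (rule has_derivative_transform_within_open[OF has_derivative_const open_greaterThanLessThan])
    show "0 \<in> {-\<epsilon><..<\<epsilon>}" using \<epsilon> by simp
    show "\<psi> (\<pi> p) = R ((\<phi> \<circ> \<gamma>) r)" if "r \<in> {-\<epsilon><..<\<epsilon>}" for r
    proof -
      have "\<gamma> r \<in> fiber M \<pi> (\<pi> p) \<inter> A" using \<gamma>(1) that by blast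
      then have "\<gamma> r \<in> A" "\<pi> (\<gamma> r) = \<pi> p" by (auto simp: fiber_def)
      then show ?thesis using chart_inv[OF chA] by simp
    qed
  qed
  ultimately have "(\<lambda>r. D R (\<phi> p) (r *\<^sub>R u)) = (\<lambda>r. 0)" by (rule has_derivative_unique)
  from fun_cong[OF this, of 1] show "u \<in> {u. D R (\<phi> p) u = 0}" by simp
next
  have px: "\<phi> p \<in> \<phi> ` U" using p by blast
  fix u assume "u \<in> {u. D R (\<phi> p) u = 0}"
  then obtain \<epsilon> c where c: "\<epsilon> > (0::real)" "smooth_on {-\<epsilon><..<\<epsilon>} c" "c 0 = \<phi> p" "(c has_vector_derivative u) (at 0)"
    "\<And>t. t \<in> {-\<epsilon><..<\<epsilon>} \<Longrightarrow> c t \<in> \<phi> ` U \<and> R (c t) = R (\<phi> p)"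
    using implicit_curve[OF open_U smooth_R px submersion_at(1)[OF p], of u] by blast
  define \<gamma> where "\<gamma> t = inv_into A \<phi> (c t)" for t
  have g: "\<gamma> t \<in> fiber M \<pi> (\<pi> p) \<inter> A" "\<phi> (\<gamma> t) = c t" if t: "t \<in> {-\<epsilon><..<\<epsilon>}" for t
  proof -
    obtain b where b: "b \<in> U" "c t = \<phi> b" using c(5)[OF t] by blast
    then have gb: "\<gamma> t = b" using chart_inv[OF chA] by (simp add: \<gamma>_def)
    have "\<psi> (\<pi> b) = \<psi> (\<pi> p)" using c(5)[OF t] chart_inv[OF chA] b p by auto
    then have "\<pi> b = \<pi> p" using chart_inj[OF chC] b p by (auto simp: inj_on_def)
    then show "\<gamma> t \<in> fiber M \<pi> (\<pi> p) \<inter> A" "\<phi> (\<gamma> t) = c t" using gb b A_points by (auto simp: fiber_def)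
  qed
  have z: "0 \<in> {-\<epsilon><..<\<epsilon>}" using c(1) by simp
  have "smooth_on {-\<epsilon><..<\<epsilon>} (\<phi> \<circ> \<gamma>)"
    by (rule smooth_on_cong[OF open_greaterThanLessThan c(2)]) (simp add: g(2))
  moreover have "((\<phi> \<circ> \<gamma>) has_vector_derivative u) (at 0)"
    unfolding has_vector_derivative_def
    by (rule has_derivative_transform_within_open[OF c(4)[unfolded has_vector_derivative_def] open_greaterThanLessThan z]) (simp add: g(2))
  moreover have "\<gamma> 0 = p" using c(3) chart_inv[OF chA] p by (simp add: \<gamma>_def)
  ultimately show "u \<in> tangent_space A \<phi> (fiber M \<pi> (\<pi> p)) p"
    unfolding tangent_space_def using c(1) g(1) by blast
qed

text \<open>The model space of \<open>N\<close> is arbitrary at first; the kernel is the tangent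
  space of a fiber, so 4 - 2 remains for the base.\<close>

lemma dim_base: "p \<in> U \<Longrightarrow> DIM('k) = 2"
proof -
  assume p: "p \<in> U"
  have pM: "p \<in> points M" using p A_points by blast
  then have "dim (tangent_space A \<phi> (fiber M \<pi> (\<pi> p)) p) = 2"
    by (intro tangent_space_embedded[OF aM(2) cA emb[OF \<pi>_points]]) (use p in \<open>auto simp: fiber_def\<close>)
  moreover have "linear (D R (\<phi> p))" by (rule smooth_on_linear_D[OF smooth_R]) (use p in blast)
  ultimately show ?thesis
    using dim_kernel_surj[OF _ submersion_at(1)[OF p]] tangent_space_fiber[OF p] dimM by simp
qed

text \<open>A field annihilated by \<open>D R\<close> on \<open>W\<close> is tangent to every fiber,
  in particular to the one through \<open>x\<close>, to which \<open>totally_geodesic\<close>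
  applies.\<close>

lemma geodesic_at:
  assumes W: "open W" "x \<in> W" "W \<subseteq> \<phi> ` U" and V: "smooth_on W V" "\<forall>y\<in>W. D R y (V y) = 0" and u: "D R x u = 0"
  shows "D R x (cov_deriv (local_metric M A \<phi>) V x u) = 0"
proof -
  obtain a where a: "a \<in> U" "x = \<phi> a" using W by blast
  let ?F = "fiber M \<pi> (\<pi> a)"
  have aM': "a \<in> points M" using a A_points by blast
  have aF: "a \<in> A \<inter> ?F" using a aM' by (auto simp: fiber_def)
  note 1 = bspec[OF bspec[OF geo[OF \<pi>_points[OF aM'], unfolded totally_geodesic_def] cA, unfolded prod.case] aF]
  have "V (\<phi> q) \<in> tangent_space A \<phi> ?F q" if q: "q \<in> A \<inter> ?F" "\<phi> q \<in> W" for q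
  proof -
    have "\<pi> q = \<pi> a" "q \<in> U" using q a by (auto simp: fiber_def)
    then show ?thesis using tangent_space_fiber[of q] V(2) q(2) by auto
  qed
  moreover have "u \<in> tangent_space A \<phi> ?F a" using tangent_space_fiber[OF a(1)] u a(2) by simp
  ultimately have "cov_deriv (local_metric M A \<phi>) V (\<phi> a) u \<in> tangent_space A \<phi> ?F a"
    using 1 W V(1) a(2) by blast
  then show ?thesis using tangent_space_fiber[OF a(1)] a(2) by simp
qed

text \<open>Surjectivity of the differential makes the image of \<open>R\<close> a neighborhood of
  \<open>R (\<phi> p)\<close>, which the chart of \<open>N\<close> pulls back.\<close>

lemma image_open_at:
  assumes p: "p \<in> U"
  shows "\<exists>T. openin (mtop N) T \<and> \<pi> p \<in> T \<and> T \<subseteq> \<pi> ` points M"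
proof -
  have px: "\<phi> p \<in> \<phi> ` U" using p by blast
  have lin: "linear (D R (\<phi> p))" by (rule smooth_on_linear_D[OF smooth_R px])
  then obtain k where k: "linear k" "D R (\<phi> p) \<circ> k = id"
    using linear_surjective_right_inverse[OF lin submersion_at(1)[OF p]] by blast
  have "R (\<phi> p) \<in> interior (R ` (\<phi> ` U))"
    by (rule sussmann_open_mapping[OF open_U smooth_on_continuous[OF smooth_R] px smooth_on_has_derivative[OF smooth_R px] _ k(2) order.refl])
      (use k(1) px open_U in \<open>auto simp: linear_conv_bounded_linear interior_open\<close>)
  then have "\<psi> (\<pi> p) \<in> interior (R ` (\<phi> ` U))" using chart_inv[OF chA] p by simp
  moreover have "{y \<in> C. \<psi> y \<in> interior (R ` (\<phi> ` U))} \<subseteq> \<pi> ` points M"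
  proof clarify
    fix y assume y: "y \<in> C" "\<psi> y \<in> interior (R ` (\<phi> ` U))"
    then have "\<psi> y \<in> R ` (\<phi> ` U)" using interior_subset by blast
    then obtain b where b: "b \<in> U" "\<psi> y = \<psi> (\<pi> b)" using chart_inv[OF chA] by auto
    then have "y = \<pi> b" using chart_inj[OF chC] y by (auto simp: inj_on_def)
    then show "y \<in> \<pi> ` points M" using b A_points by blast
  qed
  ultimately show ?thesis
    using chart_open_preimage[OF chC open_interior, of "R ` (\<phi> ` U)"] p by blast
qed

end

lemma image_open: "openin (mtop N) (\<pi> ` points M)"
  unfolding openin_subopen[of _ "\<pi> ` points M"]
proof (intro ballI)
  fix q assume "q \<in> \<pi> ` points M"
  then obtain p where p: "p \<in> points M" "q = \<pi> p" by blast
  obtain A \<phi> C \<psi> where c: "(A, \<phi>) \<in> charts M" "(C, \<psi>) \<in> charts N" and a: "p \<in> A" "\<pi> p \<in> C"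
    using chart_at(1)[OF p(1)] chart_at(2)[OF \<pi>_points[OF p(1)]] by blast
  show "\<exists>T. openin (mtop N) T \<and> q \<in> T \<and> T \<subseteq> \<pi> ` points M"
    unfolding p(2) by (rule image_open_at[OF c]) (use a in blast)
qed

lemma dim_base_points: "p \<in> points M \<Longrightarrow> DIM('k) = 2"
  using chart_at(1)[of p] chart_at(2)[OF \<pi>_points, of p] dim_base by blast

end

text \<open>The factor \<open>B\<close> has the image of \<pi> as its set of points: the curvature
  of the base is determined there, and the image inherits compactness from \<open>M\<close>.\<close>

locale einstein_submersion_base = einstein_submersion M N \<pi> l + open_submanifold_charts N "\<pi> ` points M" J J'
  for M :: "('a, 'e::euclidean_space) riem" and N :: "('b, 'k::euclidean_space) riem"
    and \<pi> l and J :: "'k \<Rightarrow> 'l::euclidean_space" and J' +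
  assumes diml: "DIM('l) = 2"
begin

abbreviation "P \<equiv> \<pi> ` points M"

context
  fixes A \<phi> C \<psi>
  assumes cA: "(A, \<phi>) \<in> charts M" and cC: "(C, \<psi>) \<in> charts N"
begin

abbreviation "\<kappa> \<equiv> J \<circ> \<psi>"
abbreviation "p \<equiv> J \<circ> (\<psi> \<circ> \<pi> \<circ> inv_into A \<phi>)"

lemmas chA = chA[OF cA cC] and chC = chC[OF cA cC]
lemmas chB = chartB[OF cC]

lemma Dp: "x \<in> \<phi> ` (A \<inter> \<pi> -` C) \<Longrightarrow> D p x = (\<lambda>u. J (D (\<psi> \<circ> \<pi> \<circ> inv_into A \<phi>) x u))"
  unfolding o_def[of J]
  by (rule D_eq[OF has_derivative_compose[OF smooth_on_has_derivative[OF smooth_R[OF cA cC]] DJ(1)]])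

lemma Dp_zero: "x \<in> \<phi> ` (A \<inter> \<pi> -` C) \<Longrightarrow> D p x u = 0 \<longleftrightarrow> D (\<psi> \<circ> \<pi> \<circ> inv_into A \<phi>) x u = 0"
  unfolding Dp using J(3) linear_0[OF J(1)] linear_0[OF J(2)] by metis

lemma local_metric_M: "a \<in> A \<Longrightarrow> local_metric M A \<phi> (\<phi> a) = riem_metric M \<phi> a"
  using chart_inv[OF chA] by (simp add: local_metric_def)

lemma p_\<phi>: "a \<in> A \<Longrightarrow> p (\<phi> a) = \<kappa> (\<pi> a)"
  using chart_inv[OF chA] by simp

lemma \<pi>_P: "a \<in> A \<inter> \<pi> -` C \<Longrightarrow> \<pi> a \<in> C \<inter> P"
  using A_points[OF cA cC] by blast

lemma local_metric_B: "y \<in> C \<inter> P \<Longrightarrow> local_metric B (C \<inter> P) \<kappa> (\<kappa> y) = riem_metric B \<kappa> y"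
  using chart_inv[OF chB, of y] by (simp only: local_metric_def)

text \<open>Composing with \<open>J\<close> affects neither the kernel of the differential
  (\<open>Dp_zero\<close>) nor lengths (\<open>metricB\<close>), so the chartwise facts about \<pi>
  hold with target \<open>B\<close>.\<close>

lemma local_sub: "local_submersion (\<phi> ` (A \<inter> \<pi> -` C)) (local_metric M A \<phi>) (\<kappa> ` (C \<inter> P)) (local_metric B (C \<inter> P) \<kappa>) p l"
proof
  let ?U = "\<phi> ` (A \<inter> \<pi> -` C)" and ?R = "\<psi> \<circ> \<pi> \<circ> inv_into A \<phi>"
  show "metric_on ?U (local_metric M A \<phi>)"
    by (rule metric_on_subset[OF riemannian_metric_on[OF RM cA] open_U[OF cA cC]]) auto
  show "metric_on (\<kappa> ` (C \<inter> P)) (local_metric B (C \<inter> P) \<kappa>)"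
    by (rule riemannian_metric_on[OF riemannian_B chartB_mem[OF cC]])
  show "DIM('e) = 4" "DIM('l) = 2" by (fact dimM, fact diml)
  show "smooth_on ?U p"
    using smooth_on_linear[OF open_U[OF cA cC] J(1) smooth_R[OF cA cC]] by (simp add: o_def)
  show "p ` ?U \<subseteq> \<kappa> ` (C \<inter> P)" using p_\<phi> \<pi>_P by force
  show "surj (D p x)" if x: "x \<in> ?U" for x
  proof -
    have "surj (D ?R x)" using submersion_at(1)[OF cA cC] x by blast
    then show ?thesis unfolding Dp[OF x] using injJ(2) comp_surj[of "D ?R x" J] by (simp add: o_def)
  qed
  show "local_metric M A \<phi> x v w = local_metric B (C \<inter> P) \<kappa> (p x) (D p x v) (D p x w)"
    if x: "x \<in> ?U" and v: "\<forall>u. D p x u = 0 \<longrightarrow> local_metric M A \<phi> x v u = 0"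
      and w: "\<forall>u. D p x u = 0 \<longrightarrow> local_metric M A \<phi> x w u = 0" for x v w
  proof -
    obtain a where a: "a \<in> A \<inter> \<pi> -` C" "x = \<phi> a" using x by blast
    have aA: "a \<in> A" using a by blast
    have "riem_metric M \<phi> a v w = riem_metric N \<psi> (\<pi> a) (D ?R (\<phi> a) v) (D ?R (\<phi> a) w)"
      by (rule submersion_at(2)[OF cA cC a(1) v[unfolded Dp_zero[OF x], unfolded a(2) local_metric_M[OF aA]]
        w[unfolded Dp_zero[OF x], unfolded a(2) local_metric_M[OF aA]]])
    then show ?thesis
      unfolding Dp[OF x] unfolding a(2) local_metric_M[OF aA] p_\<phi>[OF aA] local_metric_B[OF \<pi>_P[OF a(1)]] metricB J(3) .
  qed
  show "D p x (cov_deriv (local_metric M A \<phi>) V x u) = 0"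
    if W: "open W" "x \<in> W" "W \<subseteq> ?U" "smooth_on W V" "\<forall>y\<in>W. D p y (V y) = 0" "D p x u = 0" for W V x u
  proof -
    have xU: "x \<in> ?U" using W by blast
    have "\<forall>y\<in>W. D ?R y (V y) = 0" using W(3,5) Dp_zero by blast
    then show ?thesis
      unfolding Dp_zero[OF xU] using geodesic_at[OF cA cC W(1-4)] W(6)[unfolded Dp_zero[OF xU]] by blast
  qed
  show "ricci (local_metric M A \<phi>) x v w = l * local_metric M A \<phi> x v w" if x: "x \<in> ?U" for x v w
  proof -
    obtain a where a: "a \<in> A" "x = \<phi> a" using x by blast
    show ?thesis unfolding a(2) local_metric_M[OF a(1)] by (rule ein[OF cA a(1)])
  qed
qed

lemma sectional_at:
  assumes a: "a \<in> A" "\<pi> a \<in> C" and vw: "v \<noteq> w" "independent {v, w}"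
  shows "sectional_curvature (local_metric B (C \<inter> P) \<kappa>) (\<kappa> (\<pi> a)) v w = l"
proof -
  interpret local_submersion "\<phi> ` (A \<inter> \<pi> -` C)" "local_metric M A \<phi>" "\<kappa> ` (C \<inter> P)" "local_metric B (C \<inter> P) \<kappa>" p l
    by (rule local_sub)
  show ?thesis using base_sectional_curvature[of "\<phi> a", OF _ vw] a p_\<phi>[OF a(1)] by auto
qed

text \<open>\<open>B\<close> carries the metric of \<open>N\<close>, and in the corresponding charts
  the identity is the linear map \<open>J'\<close>.\<close>

lemma isometry_id:
  assumes T: "openin (mtop B) T" "T \<subseteq> C \<inter> P"
  shows "isometry_on B T N T id"
proof (rule isometry_onI_chart[OF riemannian_manifold_metric_atlas[OF riemannian_B] chartB_mem[OF cC] aN(1) cC T])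
  have TN: "openin (mtop N) T" using T(1) unfolding topB openin_open_subtopology[OF P] by blast
  show "openin (mtop N) T" by (rule TN)
  show "T \<subseteq> C" using T by blast
  show "bij_betw id T T" by (rule bij_betw_id)
  have o: "open (\<kappa> ` T)" by (rule chart_open_image[OF chB T])
  have o': "open (\<psi> ` T)" by (rule chart_open_image[OF chC TN]) (use T in blast)
  have e: "J' z = (\<psi> \<circ> id \<circ> inv_into (C \<inter> P) \<kappa>) z" if z: "z \<in> \<kappa> ` T" for z
  proof -
    obtain y where y: "y \<in> T" "z = \<kappa> y" using z by blast
    have "inv_into (C \<inter> P) \<kappa> (\<kappa> y) = y" by (rule chart_inv[OF chB]) (use y T in blast)
    then show ?thesis using y J(3) by simp
  qed
  show "smooth_on (\<kappa> ` T) (\<psi> \<circ> id \<circ> inv_into (C \<inter> P) \<kappa>)"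
    by (rule smooth_on_cong[OF o smooth_on_linear[OF o J(2) smooth_on_ident] e])
  show "smooth_on (\<psi> ` T) (\<kappa> \<circ> inv_into T id \<circ> inv_into C \<psi>)"
  proof (rule smooth_on_cong[OF o' smooth_on_linear[OF o' J(1) smooth_on_ident]])
    fix z assume "z \<in> \<psi> ` T"
    then obtain y where y: "y \<in> T" "z = \<psi> y" by blast
    then have "inv_into C \<psi> z = y" using chart_inv[OF chC] T by auto
    moreover have "inv_into T id y = y" using inv_into_f_f[of id T y] y by simp
    ultimately show "J z = (\<kappa> \<circ> inv_into T id \<circ> inv_into C \<psi>) z" using y by simp
  qed
  fix y v w assume y: "y \<in> T"
  have "coord_diff (C \<inter> P) \<kappa> \<psi> id y = J'"
    unfolding coord_diff_def
    by (rule trans[OF D_cong[OF o _ e[symmetric]] D_eq[OF DJ(2)]]) (use y in auto)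
  then show "riem_metric B \<kappa> y v w = riem_metric N \<psi> (id y) (coord_diff (C \<inter> P) \<kappa> \<psi> id y v) (coord_diff (C \<inter> P) \<kappa> \<psi> id y w)"
    by (simp add: metricB)
qed

text \<open>The coordinate splitting (p, \<sigma>) is read back on the manifolds. As
  \<open>p\<close> represents \<pi>, the first component of \<open>\<Phi>\<close> can be \<pi>
  itself, and the isometry identifying the first factor with part of \<open>N\<close> is the
  identity.\<close>

lemma splitting_at:
  assumes a: "a \<in> A" "\<pi> a \<in> C"
  shows "\<exists>U U\<^sub>1 U\<^sub>2 \<Phi> W \<psi>. a \<in> U \<and> openin (mtop M) U \<and> openin (mtop B) U\<^sub>1 \<and> openin (mtop B) U\<^sub>2 \<and> openin (mtop N) W \<and>
     isometry_on M U (riem_product B B) (U\<^sub>1 \<times> U\<^sub>2) \<Phi> \<and> isometry_on B U\<^sub>1 N W \<psi> \<and> (\<forall>x\<in>U. \<pi> x = \<psi> (fst (\<Phi> x)))"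
proof -
  interpret local_submersion "\<phi> ` (A \<inter> \<pi> -` C)" "local_metric M A \<phi>" "\<kappa> ` (C \<inter> P)" "local_metric B (C \<inter> P) \<kappa>" p l
    by (rule local_sub)
  have "\<phi> a \<in> \<phi> ` (A \<inter> \<pi> -` C)" using a by blast
  then obtain W Y1 Y2 \<sigma> \<Psi> where W: "open W" "\<phi> a \<in> W" "W \<subseteq> \<phi> ` (A \<inter> \<pi> -` C)" "open Y1" "open Y2"
    "Y1 \<subseteq> \<kappa> ` (C \<inter> P)" "Y2 \<subseteq> \<kappa> ` (C \<inter> P)" "smooth_on W \<sigma>" "smooth_on (Y1 \<times> Y2) \<Psi>"
    "\<And>x. x \<in> W \<Longrightarrow> p x \<in> Y1 \<and> \<sigma> x \<in> Y2 \<and> \<Psi> (p x, \<sigma> x) = x"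
    "\<And>y z. y \<in> Y1 \<Longrightarrow> z \<in> Y2 \<Longrightarrow> \<Psi> (y, z) \<in> W \<and> p (\<Psi> (y, z)) = y \<and> \<sigma> (\<Psi> (y, z)) = z"
    "\<And>x u v. x \<in> W \<Longrightarrow> local_metric M A \<phi> x u v = local_metric B (C \<inter> P) \<kappa> (p x) (D p x u) (D p x v)
       + local_metric B (C \<inter> P) \<kappa> (\<sigma> x) (D \<sigma> x u) (D \<sigma> x v)"
    by (rule local_splitting) blast
  define C' where "C' = C \<inter> P"
  define i where "i = inv_into C' \<kappa>"
  define j where "j = inv_into A \<phi>"
  have i: "i (\<kappa> y) = y" if "y \<in> C'" for y using chart_inv[OF chB] that by (simp add: i_def C'_def)
  have i': "i z \<in> C'" "\<kappa> (i z) = z" if "z \<in> \<kappa> ` C'" for z using that i by auto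
  have j: "j (\<phi> x) = x" if "x \<in> A" for x using chart_inv[OF chA that] by (simp add: j_def)
  have j': "j z \<in> A \<inter> \<pi> -` C" "\<phi> (j z) = z" if "z \<in> W" for z using that W(3) j by auto
  have Y: "Y1 \<subseteq> \<kappa> ` C'" "Y2 \<subseteq> \<kappa> ` C'" using W(6,7) by (simp_all add: C'_def)
  define T where "T = {x \<in> A. \<phi> x \<in> W}"
  define U1 where "U1 = {y \<in> C'. \<kappa> y \<in> Y1}"
  define U2 where "U2 = {y \<in> C'. \<kappa> y \<in> Y2}"
  define \<Phi> where "\<Phi> x = (\<pi> x, i (\<sigma> (\<phi> x)))" for x
  have oT: "openin (mtop M) T" unfolding T_def by (rule chart_open_preimage[OF chA W(1)])
  have oU: "openin (mtop B) U1" "openin (mtop B) U2"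
    unfolding U1_def U2_def C'_def by (rule chart_open_preimage[OF chB W(4)], rule chart_open_preimage[OF chB W(5)])
  have TU: "x \<in> A \<inter> \<pi> -` C" if "x \<in> T" for x using that W(3) chart_inj[OF chA] by (auto simp: T_def inj_on_def)
  have \<pi>C: "\<pi> x \<in> C'" if "x \<in> T" for x using \<pi>_P[OF TU[OF that]] by (simp add: C'_def)
  have \<phi>T: "\<phi> ` T = W" using W(3) by (auto simp: T_def)
  have \<kappa>U: "\<kappa> ` U1 = Y1" "\<kappa> ` U2 = Y2" using Y by (auto simp: U1_def U2_def)
  have px: "p (\<phi> x) = \<kappa> (\<pi> x)" if "x \<in> T" for x using p_\<phi> that by (simp add: T_def)
  have \<Phi>U: "\<Phi> x \<in> U1 \<times> U2 \<and> \<kappa> (fst (\<Phi> x)) = p (\<phi> x) \<and> \<kappa> (snd (\<Phi> x)) = \<sigma> (\<phi> x)" if x: "x \<in> T" for x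
  proof -
    have xW: "\<phi> x \<in> W" using x by (simp add: T_def)
    have "\<sigma> (\<phi> x) \<in> \<kappa> ` C'" using W(10)[OF xW] Y by blast
    then show ?thesis using W(10)[OF xW] i' \<pi>C[OF x] px[OF x] by (auto simp: \<Phi>_def U1_def U2_def simp del: o_apply)
  qed
  define \<Psi>' where "\<Psi>' yz = j (\<Psi> (\<kappa> (fst yz), \<kappa> (snd yz)))" for yz
  have \<Psi>T: "\<Psi>' z \<in> T \<and> \<phi> (\<Psi>' z) = \<Psi> (\<kappa> (fst z), \<kappa> (snd z)) \<and> \<Phi> (\<Psi>' z) = z" if z: "z \<in> U1 \<times> U2" for z
  proof -
    let ?x = "\<Psi> (\<kappa> (fst z), \<kappa> (snd z))"
    have zU: "fst z \<in> C'" "snd z \<in> C'" "\<kappa> (fst z) \<in> Y1" "\<kappa> (snd z) \<in> Y2" using z by (auto simp: U1_def U2_def)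
    have x: "?x \<in> W" "p ?x = \<kappa> (fst z)" "\<sigma> ?x = \<kappa> (snd z)" using W(11)[OF zU(3,4)] by auto
    have 1: "\<phi> (\<Psi>' z) = ?x" "\<Psi>' z \<in> T" using j'[OF x(1)] x(1) by (auto simp: \<Psi>'_def T_def)
    have "\<kappa> (\<pi> (\<Psi>' z)) = \<kappa> (fst z)" using px[OF 1(2)] x(2) 1(1) by simp
    then have "\<pi> (\<Psi>' z) = fst z" using i[OF \<pi>C[OF 1(2)]] i[OF zU(1)] by simp
    moreover have "i (\<sigma> (\<phi> (\<Psi>' z))) = snd z" using 1(1) x(3) i[OF zU(2)] by simp
    ultimately show ?thesis using 1 by (simp add: \<Phi>_def)
  qed
  have \<Psi>\<Phi>: "\<Psi>' (\<Phi> x) = x" if x: "x \<in> T" for x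
  proof -
    have "\<phi> x \<in> W" "x \<in> A" using x by (auto simp: T_def)
    then show ?thesis using \<Phi>U[OF x] W(10)[of "\<phi> x"] j by (simp add: \<Psi>'_def del: o_apply)
  qed
  have bij: "bij_betw \<Phi> T (U1 \<times> U2)"
    by (rule bij_betw_byWitness[where f'=\<Psi>']) (use \<Psi>\<Phi> \<Psi>T \<Phi>U in blast)+
  have invT: "inv_into T \<Phi> z = \<Psi>' z" if "z \<in> U1 \<times> U2" for z
    using inv_into_f_f[OF bij_betw_imp_inj_on[OF bij], of "\<Psi>' z"] \<Psi>T[OF that] by simp
  have rep: "(p x, \<sigma> x) = (map_prod \<kappa> \<kappa> \<circ> \<Phi> \<circ> j) x" if x: "x \<in> W" for x
  proof -
    obtain b where b: "b \<in> T" "x = \<phi> b" using x \<phi>T by blast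
    then have "j x = b" using j by (simp add: T_def)
    then show ?thesis using \<Phi>U[OF b(1)] b(2) by (cases "\<Phi> b") (simp del: o_apply add: o_apply[of "map_prod \<kappa> \<kappa> \<circ> \<Phi>"] o_apply[of "map_prod \<kappa> \<kappa>"])
  qed
  have smpW: "smooth_on W p" by (rule smooth_on_subset[OF smp W(3)])
  have aB: "metric_atlas B" by (rule riemannian_manifold_metric_atlas[OF riemannian_B])
  have cBB: "(C' \<times> C', map_prod \<kappa> \<kappa>) \<in> charts (riem_product B B)"
    using chartB_mem[OF cC] by (auto simp: riem_product_def C'_def)
  have "isometry_on M T (riem_product B B) (U1 \<times> U2) \<Phi>"
  proof (rule isometry_onI_chart[OF aM(1) cA metric_atlas_product[OF aB aB] cBB oT _ _ _ bij])
    show "T \<subseteq> A" by (auto simp: T_def)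
    show "openin (mtop (riem_product B B)) (U1 \<times> U2)" using oU by (simp add: riem_product_def openin_prod_Times_iff)
    show "U1 \<times> U2 \<subseteq> C' \<times> C'" by (auto simp: U1_def U2_def)
    show "smooth_on (\<phi> ` T) (map_prod \<kappa> \<kappa> \<circ> \<Phi> \<circ> inv_into A \<phi>)"
      unfolding \<phi>T j_def[symmetric]
      by (rule smooth_on_cong[OF W(1) smooth_on_Pair[OF W(1) smpW W(8)] rep])
    have im: "map_prod \<kappa> \<kappa> ` (U1 \<times> U2) = Y1 \<times> Y2"
      unfolding \<kappa>U[symmetric] by (auto simp del: o_apply)
    show "smooth_on (map_prod \<kappa> \<kappa> ` (U1 \<times> U2)) (\<phi> \<circ> inv_into T \<Phi> \<circ> inv_into (C' \<times> C') (map_prod \<kappa> \<kappa>))"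
      unfolding im
    proof (rule smooth_on_cong[OF open_Times[OF W(4,5)] W(9)])
      fix yz assume yz: "yz \<in> Y1 \<times> Y2"
      then obtain y z where e: "yz = (\<kappa> y, \<kappa> z)" "y \<in> U1" "z \<in> U2" using \<kappa>U by blast
      have "y \<in> C'" "z \<in> C'" using e by (auto simp: U1_def U2_def)
      then have "inv_into (C' \<times> C') (map_prod \<kappa> \<kappa>) yz = (y, z)"
        using inv_into_map_prod[of \<kappa> C' \<kappa> C' "\<kappa> y" "\<kappa> z"] chart_inj[OF chB] i unfolding e(1) i_def C'_def by auto
      moreover have "inv_into T \<Phi> (y, z) = \<Psi>' (y, z)" using invT e by blast
      moreover have "\<phi> (\<Psi>' (y, z)) = \<Psi> yz" using \<Psi>T[of "(y, z)"] e by simp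
      ultimately show "\<Psi> yz = (\<phi> \<circ> inv_into T \<Phi> \<circ> inv_into (C' \<times> C') (map_prod \<kappa> \<kappa>)) yz" by simp
    qed
  next
    fix x v w assume x: "x \<in> T"
    have xW: "\<phi> x \<in> W" and xA: "x \<in> A" using x by (auto simp: T_def)
    have cd: "coord_diff A \<phi> (map_prod \<kappa> \<kappa>) \<Phi> x v = (D p (\<phi> x) v, D \<sigma> (\<phi> x) v)" for v
    proof -
      have "D (\<lambda>x. (p x, \<sigma> x)) (\<phi> x) = D (map_prod \<kappa> \<kappa> \<circ> \<Phi> \<circ> j) (\<phi> x)" by (rule D_cong[OF W(1) xW rep])
      then show ?thesis
        using D_eq[OF has_derivative_Pair[OF smooth_on_has_derivative[OF smpW xW] smooth_on_has_derivative[OF W(8) xW]]]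
        by (simp add: coord_diff_def j_def)
    qed
    define y z where "y = fst (\<Phi> x)" and "z = snd (\<Phi> x)"
    have yz: "\<Phi> x = (y, z)" "y \<in> C'" "z \<in> C'" "\<kappa> y = p (\<phi> x)" "\<kappa> z = \<sigma> (\<phi> x)"
      using \<Phi>U[OF x] by (auto simp: y_def z_def U1_def U2_def)
    have "riem_metric M \<phi> x v w = riem_metric B \<kappa> y (D p (\<phi> x) v) (D p (\<phi> x) w) + riem_metric B \<kappa> z (D \<sigma> (\<phi> x) v) (D \<sigma> (\<phi> x) w)"
      using W(12)[OF xW, of v w] local_metric_B[of y] local_metric_B[of z] yz unfolding local_metric_M[OF xA] C'_def
      by (simp del: o_apply)
    then show "riem_metric M \<phi> x v w = riem_metric (riem_product B B) (map_prod \<kappa> \<kappa>) (\<Phi> x)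
      (coord_diff A \<phi> (map_prod \<kappa> \<kappa>) \<Phi> x v) (coord_diff A \<phi> (map_prod \<kappa> \<kappa>) \<Phi> x w)"
      unfolding cd yz(1) riem_product_metric .
  qed
  moreover have "isometry_on B U1 N U1 id" by (rule isometry_id[OF oU(1)]) (auto simp: U1_def C'_def)
  moreover have "openin (mtop N) U1" using oU(1) unfolding topB openin_open_subtopology[OF P] by blast
  moreover have "a \<in> T" using a W(2) by (simp add: T_def)
  moreover have "\<forall>x\<in>T. \<pi> x = id (fst (\<Phi> x))" by (simp add: \<Phi>_def)
  ultimately show ?thesis using oT oU by blast
qed

end

text \<open>The base curvature is computed at points \<pi> a, and by the choice of \<open>B\<close>
  there are no others.\<close>

lemma constant_curvature_B: "constant_curvature B l"
  unfolding constant_curvature_def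
proof (rule ballI, unfold split_paired_all prod.case, intro ballI allI impI)
  fix D' \<xi> y and v w :: 'l assume "(D', \<xi>) \<in> charts B" and y: "y \<in> D'" and vw: "v \<noteq> w \<and> independent {v, w}"
  then obtain C \<psi> where c: "(C, \<psi>) \<in> charts N" "D' = C \<inter> P" "\<xi> = J \<circ> \<psi>" unfolding chartsB by auto
  obtain a where a: "a \<in> points M" "y = \<pi> a" using y c by blast
  obtain A \<phi> where A: "(A, \<phi>) \<in> charts M" "a \<in> A" using chart_at(1)[OF a(1)] by blast
  show "sectional_curvature (local_metric B D' \<xi>) (\<xi> y) v w = l"
    unfolding c(2,3) a(2) by (rule sectional_at[OF A(1) c(1) A(2)]) (use y c a vw in auto)
qed

lemma locally_projection_B: "locally_projection_of_square M N \<pi> B"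
  unfolding locally_projection_of_square_def
proof
  fix a assume a: "a \<in> points M"
  obtain A \<phi> C \<psi> where c: "(A, \<phi>) \<in> charts M" "(C, \<psi>) \<in> charts N" "a \<in> A" "\<pi> a \<in> C"
    using chart_at(1)[OF a] chart_at(2)[OF \<pi>_points[OF a]] by blast
  show "\<exists>U U\<^sub>1 U\<^sub>2 \<Phi> W \<psi>. a \<in> U \<and> openin (mtop M) U \<and> openin (mtop B) U\<^sub>1 \<and> openin (mtop B) U\<^sub>2 \<and> openin (mtop N) W \<and>
     isometry_on M U (riem_product B B) (U\<^sub>1 \<times> U\<^sub>2) \<Phi> \<and> isometry_on B U\<^sub>1 N W \<psi> \<and> (\<forall>x\<in>U. \<pi> x = \<psi> (fst (\<Phi> x)))"
    by (rule splitting_at[OF c])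
qed

end

theorem theorem1p4:
  fixes M :: "('a, real^4) riem"
    and N :: "('b, 'k::euclidean_space) riem"
    and \<pi> :: "'a \<Rightarrow> 'b"
  assumes "riemannian_manifold M" and "compact_space (mtop M)" and "einstein M"
    and "riemannian_manifold N"
    and "riemannian_submersion M N \<pi>"
    and "\<And>q. q \<in> points N \<Longrightarrow>
           embedded_submanifold M 2 (fiber M \<pi> q) \<and> totally_geodesic M (fiber M \<pi> q)"
  shows "\<exists>(c::real) (B :: ('b, real^2) riem).
           riemannian_manifold B \<and> compact_space (mtop B) \<and> constant_curvature B c \<and>
           locally_projection_of_square M N \<pi> B"
proof (cases "points M = {}")
  \<comment> \<open>Without a point of \<open>M\<close> the dimension of \<open>N\<close> cannot be
    inferred, so an empty \<open>B\<close> over real^2 is supplied directly; the value 0 of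
    \<open>c\<close> is arbitrary.\<close>
  case True
  define B :: "('b, real^2) riem" where "B = \<lparr>mtop = discrete_topology {}, charts = {}, riem_metric = \<lambda>_ _ _ _. 0\<rparr>"
  have "riemannian_manifold B"
    by (auto simp: B_def riemannian_manifold_def smooth_manifold_def second_countable_def intro!: exI[of _ "{}"])
  moreover have "compact_space (mtop B)" by (simp add: B_def compact_space_discrete_topology)
  ultimately show ?thesis
    using True by (intro exI[of _ 0] exI[of _ B]) (auto simp: constant_curvature_def locally_projection_of_square_def B_def)
next
  case False
  obtain l where l: "\<forall>(A, \<phi>)\<in>charts M. \<forall>p\<in>A. \<forall>v w. ricci (local_metric M A \<phi>) (\<phi> p) v w = l * riem_metric M \<phi> p v w"
    using assms(3) unfolding einstein_def by blast
  have ein: "ricci (local_metric M A \<phi>) (\<phi> p) v w = l * riem_metric M \<phi> p v w"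
    if "(A, \<phi>) \<in> charts M" "p \<in> A" for A \<phi> p v w
    using bspec[OF l that(1), unfolded prod.case] that(2) by blast
  interpret einstein_submersion M N \<pi> l
    by (rule einstein_submersion.intro[OF assms(1,4,5) ein]) (simp_all add: assms(6))
  obtain a where "a \<in> points M" using False by blast
  then have "DIM('k) = DIM(real^2)" using dim_base_points by simp
  then obtain J :: "'k \<Rightarrow> real^2" and J' where J: "linear J" "linear J'" "\<And>x. J' (J x) = x" "\<And>y. J (J' y) = y"
    using isomorphisms_UNIV_UNIV by metis
  interpret einstein_submersion_base M N \<pi> l J J'
    by (intro einstein_submersion_base.intro einstein_submersion_axioms open_submanifold_charts.intro
      einstein_submersion_base_axioms.intro assms(4) image_open J) simp
  \<comment> \<open>The points of \<open>B\<close> are the continuous image of the compact space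
    \<open>M\<close>.\<close>
  have "compact_space (mtop B)"
    unfolding topB
    by (rule compact_space_subtopology[OF image_compactin[OF _ continuous_\<pi>]]) (use assms(2) in \<open>simp add: compact_space_def\<close>)
  then show ?thesis using riemannian_B constant_curvature_B locally_projection_B by blast
qed

end
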